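(* Let $F=\mathbb{R}\rtimes\mathbb{R}$ be the real affine motion group. Let $v_1\in L^1(\mathbb{R})$ be such that $\hat{v}_1\in A_c(\mathbb{R})$, let $v_2\in\mathcal{C}_c(\mathbb{R})$, and set $v(b,a)=v_1(b)v_2(a)$. Then there is $S=S_{Y,v}\in VN(F\times F)$ such that \[ S(u)=\int_F\partial_{(Y,0)}u(g,g^{-1})\,v(g)\,dg \] for every $u\in\mathcal{D}(F\times F)$.
   Context: $F=\mathbb{R}\rtimes\mathbb{R}$ has multiplication $(b,a)(b',a')=(b+e^ab',a+a')$ and inverse $(b,a)^{-1}=(-e^{-a}b,-a)$. Its left Haar integral (denoted $dg$) is $\int_{\mathbb{R}}\int_{\mathbb{R}}u(b,a)e^{-a}\,da\,db$. $Y$ is the element of its Lie algebra with $\exp(hY)=(h,0)$ for $h\in\mathbb{R}$. $\hat{v}_1$ is the Fourier transform on $\mathbb{R}$, and $\mathcal{C}_c(\mathbb{R})$ is the space of compactly supported continuous functions. For a locally compact group $G$, the Fourier algebra $A(G)$ (Eymard) is the Banach algebra of all functions $u(g)=\langle\lambda(g)\xi|\eta\rangle$ with $\xi,\eta\in L^2(G)$, where $\lambda$ is the left regular representation of $G$ on $L^2(G)$; its norm is $\|u\|_A=\inf\{\|\xi\|_2\|\eta\|_2: u=\langle\lambda(\cdot)\xi|\eta\rangle\}$. $A_c(G)$ is the set of compactly supported elements of $A(G)$. The dual of $A(G)$ is the group von Neumann algebra $VN(G)=\lambda(G)''\subset\mathcal{B}(L^2(G))$ via $T(u)=\langle T\xi|\eta\rangle$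 for $u=\langle\lambda(\cdot)\xi|\eta\rangle$. For a Lie group $G$, $\mathcal{D}(G)$ is the space of compactly supported smooth functions on $G$; it is contained in $A(G)$. For $X$ in the Lie algebra of $G$ and $u\in\mathcal{D}(G\times G)$, $\partial_{(X,0)}u(g,h)=\frac{d}{dt}u(g\exp(tX),h)|_{t=0}$. *)

theory Defs
  imports "HOL-Analysis.Analysis" "HOL-Algebra.Group"
begin

section \<open>The Fourier algebra and the group von Neumann algebra\<close>

text \<open>
  A locally compact group is given by a group record \<open>G\<close> whose carrier is a whole type
  \<open>'g\<close>, together with a left Haar measure \<open>\<mu>\<close> on \<open>'g\<close>; its topology is that of the type \<open>'g\<close>.
  The elements of \<open>L\<^sup>2(G)\<close> are handled through representatives: functions that agree
  \<open>\<mu>\<close>-almost everywhere stand for the same vector, and equations between vectors are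
  equations almost everywhere.
\<close>

definition L2 :: "'g measure \<Rightarrow> ('g \<Rightarrow> complex) set" where
  "L2 \<mu> = {\<xi>. \<xi> \<in> borel_measurable \<mu> \<and> integrable \<mu> (\<lambda>x. (cmod (\<xi> x))\<^sup>2)}"

definition L2_inner :: "'g measure \<Rightarrow> ('g \<Rightarrow> complex) \<Rightarrow> ('g \<Rightarrow> complex) \<Rightarrow> complex" where
  "L2_inner \<mu> \<xi> \<eta> = (LINT x|\<mu>. \<xi> x * cnj (\<eta> x))"

definition L2_norm :: "'g measure \<Rightarrow> ('g \<Rightarrow> complex) \<Rightarrow> real" where
  "L2_norm \<mu> \<xi> = sqrt (LINT x|\<mu>. (cmod (\<xi> x))\<^sup>2)"

text \<open>
  An operator acts on representatives; only its values on \<open>L2 \<mu>\<close> matter. Linearity and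
  boundedness together imply that it respects equality almost everywhere.
\<close>

definition bounded_op :: "'g measure \<Rightarrow> (('g \<Rightarrow> complex) \<Rightarrow> ('g \<Rightarrow> complex)) \<Rightarrow> bool" where
  "bounded_op \<mu> T \<longleftrightarrow>
     (\<forall>\<xi>\<in>L2 \<mu>. T \<xi> \<in> L2 \<mu>) \<and>
     (\<forall>\<xi>\<in>L2 \<mu>. \<forall>\<eta>\<in>L2 \<mu>. AE x in \<mu>. T (\<lambda>y. \<xi> y + \<eta> y) x = T \<xi> x + T \<eta> x) \<and>
     (\<forall>c. \<forall>\<xi>\<in>L2 \<mu>. AE x in \<mu>. T (\<lambda>y. c * \<xi> y) x = c * T \<xi> x) \<and>
     (\<exists>C. \<forall>\<xi>\<in>L2 \<mu>. L2_norm \<mu> (T \<xi>) \<le> C * L2_norm \<mu> \<xi>)"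

definition commutant ::
  "'g measure \<Rightarrow> (('g \<Rightarrow> complex) \<Rightarrow> ('g \<Rightarrow> complex)) set \<Rightarrow> (('g \<Rightarrow> complex) \<Rightarrow> ('g \<Rightarrow> complex)) set" where
  "commutant \<mu> A =
     {T. bounded_op \<mu> T \<and> (\<forall>R\<in>A. \<forall>\<xi>\<in>L2 \<mu>. AE x in \<mu>. T (R \<xi>) x = R (T \<xi>) x)}"

definition left_regular ::
  "('g, 'z) monoid_scheme \<Rightarrow> 'g \<Rightarrow> ('g \<Rightarrow> complex) \<Rightarrow> ('g \<Rightarrow> complex)" where
  "left_regular G g \<xi> = (\<lambda>h. \<xi> (inv\<^bsub>G\<^esub> g \<otimes>\<^bsub>G\<^esub> h))"

definition VN ::
  "('g, 'z) monoid_scheme \<Rightarrow> 'g measure \<Rightarrow> (('g \<Rightarrow> complex) \<Rightarrow> ('g \<Rightarrow> complex)) set" where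
  "VN G \<mu> = commutant \<mu> (commutant \<mu> (left_regular G ` carrier G))"

definition coefficient_fun ::
  "('g, 'z) monoid_scheme \<Rightarrow> 'g measure \<Rightarrow> ('g \<Rightarrow> complex) \<Rightarrow> ('g \<Rightarrow> complex) \<Rightarrow> 'g \<Rightarrow> complex" where
  "coefficient_fun G \<mu> \<xi> \<eta> = (\<lambda>g. L2_inner \<mu> (left_regular G g \<xi>) \<eta>)"

definition fourier_algebra ::
  "('g, 'z) monoid_scheme \<Rightarrow> 'g measure \<Rightarrow> ('g \<Rightarrow> complex) set" where
  "fourier_algebra G \<mu> = {u. \<exists>\<xi>\<in>L2 \<mu>. \<exists>\<eta>\<in>L2 \<mu>. u = coefficient_fun G \<mu> \<xi> \<eta>}"

definition compactly_supported :: "('g::topological_space \<Rightarrow> complex) \<Rightarrow> bool" where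
  "compactly_supported u \<longleftrightarrow> compact (closure {x. u x \<noteq> 0})"

definition fourier_algebra_c ::
  "('g::topological_space, 'z) monoid_scheme \<Rightarrow> 'g measure \<Rightarrow> ('g \<Rightarrow> complex) set" where
  "fourier_algebra_c G \<mu> = {u \<in> fourier_algebra G \<mu>. compactly_supported u}"

text \<open>
  The value \<open>T(u) = \<langle>T \<xi> | \<eta>\<rangle>\<close> of \<open>T \<in> VN(G) = A(G)\<^sup>*\<close> at \<open>u = \<langle>\<lambda>(\<cdot>) \<xi> | \<eta>\<rangle> \<in> A(G)\<close>. For such
  \<open>T\<close> and \<open>u\<close> it does not depend on the choice of \<open>\<xi>\<close> and \<open>\<eta>\<close>; for \<open>u \<notin> A(G)\<close> it is unspecified.
\<close>

definition VN_apply ::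
  "('g, 'z) monoid_scheme \<Rightarrow> 'g measure \<Rightarrow> (('g \<Rightarrow> complex) \<Rightarrow> ('g \<Rightarrow> complex)) \<Rightarrow>
   ('g \<Rightarrow> complex) \<Rightarrow> complex" where
  "VN_apply G \<mu> T u =
     (THE c. \<exists>\<xi>\<in>L2 \<mu>. \<exists>\<eta>\<in>L2 \<mu>. u = coefficient_fun G \<mu> \<xi> \<eta> \<and> c = L2_inner \<mu> (T \<xi>) \<eta>)"


section \<open>Test functions\<close>

text \<open>\<open>Ck k u\<close> says that \<open>u\<close> is \<open>k\<close> times continuously differentiable.\<close>

primrec Ck :: "nat \<Rightarrow> ('a::euclidean_space \<Rightarrow> complex) \<Rightarrow> bool" where
  "Ck 0 u \<longleftrightarrow> continuous_on UNIV u"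
| "Ck (Suc k) u \<longleftrightarrow>
     (\<forall>x. u differentiable (at x)) \<and> (\<forall>w. Ck k (\<lambda>x. frechet_derivative u (at x) w))"

text \<open>
  For a Lie group whose underlying manifold is a Euclidean space, this is the space
  \<open>\<D>(G)\<close> of compactly supported smooth functions.
\<close>

definition test_functions :: "('a::euclidean_space \<Rightarrow> complex) set" where
  "test_functions = {u. (\<forall>k. Ck k u) \<and> compactly_supported u}"

definition Cc :: "('a::topological_space \<Rightarrow> complex) set" where
  "Cc = {u. continuous_on UNIV u \<and> compactly_supported u}"


section \<open>The real line\<close>

definition real_group :: "real monoid" where
  "real_group = \<lparr>carrier = UNIV, mult = (+), one = 0\<rparr>"

text \<open>
  Other normalisations of the Fourier transform only rescale the argument or the values,
  which affects neither membership in \<open>A(\<real>)\<close> nor compactness of the support.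
\<close>

definition fourier_transform :: "(real \<Rightarrow> complex) \<Rightarrow> real \<Rightarrow> complex" where
  "fourier_transform f s = (LINT x|lborel. f x * cis (- (s * x)))"


section \<open>The real affine motion group\<close>

definition aff :: "(real \<times> real) monoid" where
  "aff = \<lparr>carrier = UNIV,
          mult = (\<lambda>(b, a) (b', a'). (b + exp a * b', a + a')),
          one = (0, 0)\<rparr>"

definition aff_haar :: "(real \<times> real) measure" where
  "aff_haar = density (lborel \<Otimes>\<^sub>M lborel) (\<lambda>(b, a). ennreal (exp (- a)))"

abbreviation aff2 :: "((real \<times> real) \<times> (real \<times> real)) monoid" where
  "aff2 \<equiv> aff \<times>\<times> aff"

abbreviation aff2_haar :: "((real \<times> real) \<times> (real \<times> real)) measure" where
  "aff2_haar \<equiv> aff_haar \<Otimes>\<^sub>M aff_haar"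

text \<open>
  An element \<open>X\<close> of the Lie algebra is represented by its one-parameter subgroup
  \<open>t \<mapsto> exp (t X)\<close>; \<open>deriv_fst G X\<close> is the derivation \<open>\<partial>\<^bsub>(X,0)\<^esub>\<close>.
\<close>

definition deriv_fst ::
  "('g, 'z) monoid_scheme \<Rightarrow> (real \<Rightarrow> 'g) \<Rightarrow> ('g \<times> 'g \<Rightarrow> complex) \<Rightarrow> 'g \<times> 'g \<Rightarrow> complex" where
  "deriv_fst G X u = (\<lambda>(g, h). vector_derivative (\<lambda>t. u (g \<otimes>\<^bsub>G\<^esub> X t, h)) (at 0))"

definition aff_Y :: "real \<Rightarrow> real \<times> real" where
  "aff_Y t = (t, 0)"

lemma group_real_group: "group real_group"
  by (rule groupI) (auto simp: real_group_def intro: exI[of _ "- x" for x])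

lemma group_aff: "group aff"
proof (rule groupI)
  fix x assume "x \<in> carrier aff"
  show "\<exists>y\<in>carrier aff. y \<otimes>\<^bsub>aff\<^esub> x = \<one>\<^bsub>aff\<^esub>"
    by (rule bexI[of _ "(- exp (- snd x) * fst x, - snd x)"]) (auto simp: aff_def split: prod.splits)
qed (auto simp: aff_def exp_add algebra_simps)

lemma inv_aff: "inv\<^bsub>aff\<^esub> (b, a) = (- exp (- a) * b, - a)"
  by (rule group.inv_equality[OF group_aff]) (auto simp: aff_def)

lemma aff_Y_add: "aff_Y (s + t) = aff_Y s \<otimes>\<^bsub>aff\<^esub> aff_Y t"
  by (simp add: aff_Y_def aff_def)

lemma nn_integral_aff_haar:
  assumes [measurable]: "f \<in> borel_measurable borel"
  shows "(\<integral>\<^sup>+g. f g \<partial>aff_haar) = (\<integral>\<^sup>+a. \<integral>\<^sup>+b. ennreal (exp (- a)) * f (b, a) \<partial>lborel \<partial>lborel)"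
proof -
  have [measurable]: "f \<in> borel_measurable (borel \<Otimes>\<^sub>M borel)"
    using assms by (simp add: borel_prod)
  show ?thesis
    unfolding aff_haar_def
    by (subst nn_integral_density, measurable)
      (subst lborel_pair.nn_integral_snd[symmetric], auto simp: case_prod_beta)
qed

lemma aff_haar_left_invariant:
  assumes f[measurable]: "f \<in> borel_measurable borel"
  shows "(\<integral>\<^sup>+g. f (x \<otimes>\<^bsub>aff\<^esub> g) \<partial>aff_haar) = (\<integral>\<^sup>+g. f g \<partial>aff_haar)"
proof -
  obtain b0 a0 where x: "x = (b0, a0)" by (cases x)
  have fp[measurable]: "f \<in> borel_measurable (borel \<Otimes>\<^sub>M borel)"
    using f by (simp add: borel_prod)
  have m: "(\<lambda>g. f (x \<otimes>\<^bsub>aff\<^esub> g)) \<in> borel_measurable borel"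
    unfolding borel_prod[symmetric] x aff_def by simp
  have "(\<integral>\<^sup>+g. f g \<partial>aff_haar) = (\<integral>\<^sup>+a. \<integral>\<^sup>+b. ennreal (exp (- a)) * f (b, a) \<partial>lborel \<partial>lborel)"
    by (rule nn_integral_aff_haar) fact
  also have "\<dots> = (\<integral>\<^sup>+a. \<integral>\<^sup>+b. ennreal (exp (- (a0 + a))) * f (b, a0 + a) \<partial>lborel \<partial>lborel)"
    by (subst nn_integral_real_affine[of _ 1 a0]) auto
  also have "\<dots> = (\<integral>\<^sup>+a. \<integral>\<^sup>+b. ennreal (exp (- a)) * f (b0 + exp a0 * b, a0 + a) \<partial>lborel \<partial>lborel)"
  proof (rule nn_integral_cong)
    fix a :: real
    have "(\<integral>\<^sup>+b. ennreal (exp (- (a0 + a))) * f (b, a0 + a) \<partial>lborel) =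
        ennreal (exp a0) * (\<integral>\<^sup>+b. ennreal (exp (- (a0 + a))) * f (b0 + exp a0 * b, a0 + a) \<partial>lborel)"
      by (subst nn_integral_real_affine[of _ "exp a0" b0]) auto
    also have "\<dots> = (\<integral>\<^sup>+b. ennreal (exp a0) * (ennreal (exp (- (a0 + a))) * f (b0 + exp a0 * b, a0 + a)) \<partial>lborel)"
      by (rule nn_integral_cmult[symmetric]) measurable
    also have "\<dots> = (\<integral>\<^sup>+b. ennreal (exp (- a)) * f (b0 + exp a0 * b, a0 + a) \<partial>lborel)"
      by (simp add: mult.assoc[symmetric] ennreal_mult[symmetric] exp_add[symmetric])
    finally show "(\<integral>\<^sup>+b. ennreal (exp (- (a0 + a))) * f (b, a0 + a) \<partial>lborel) =
        (\<integral>\<^sup>+b. ennreal (exp (- a)) * f (b0 + exp a0 * b, a0 + a) \<partial>lborel)" .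
  qed
  also have "\<dots> = (\<integral>\<^sup>+g. f (x \<otimes>\<^bsub>aff\<^esub> g) \<partial>aff_haar)"
    by (subst nn_integral_aff_haar[OF m]) (simp add: aff_def x)
  finally show ?thesis ..
qed

end

theory Submission
  imports Defs "HOL-Probability.Probability"
begin

text \<open>
  Formally \<open>S\<close> is the integral of \<open>v(g) \<lambda>(g, g\<^sup>-\<^sup>1)\<close> times the generator of the translations
  \<open>b \<mapsto> b + h\<close> in the first factor. A Fourier transform in the two \<open>b\<close>-variables, with dual variables
  \<open>p\<close> and \<open>q\<close>, turns \<open>S\<close> into an integral operator along the orbits \<open>\<alpha> \<mapsto> (e\<^sup>\<alpha> p, e\<^sup>-\<^sup>\<alpha> q)\<close> with kernel
  \<open>p v\<^sub>2(\<alpha>) f(p - e\<^sup>-\<^sup>\<alpha> q)\<close>, where \<open>f\<close> is the Fourier transform of \<open>v\<^sub>1\<close>. If \<open>f\<close> is supported in \<open>[-R, R]\<close>, then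
  \<open>|p| \<le> |e\<^sup>-\<^sup>\<alpha> q| + R\<close> on the support of the kernel, and the substitution \<open>x = e\<^sup>-\<^sup>\<alpha> q\<close> bounds the integral of
  \<open>|e\<^sup>-\<^sup>\<alpha> q f(p - e\<^sup>-\<^sup>\<alpha> q)|\<close> over \<open>\<alpha>\<close> by \<open>\<parallel>f\<parallel>\<^sub>1\<close>; so the Schur test applies although the factor \<open>p\<close> is unbounded.

  To avoid the Plancherel theorem, the derivative in \<open>S(u)\<close> is replaced by a difference quotient mollified
  by a Gaussian. For coefficients \<open>u\<close> of bounded functions with bounded support the Fourier formula then
  converges absolutely, Bessel's inequality suffices for a bound uniform in the mollification, and
  dominated convergence gives the limit. By density one obtains a bounded linear functional on
  \<open>A(F \<times> F)\<close>, which comes from an operator in the bicommutant of \<open>\<lambda>\<close>. Test functions are coefficients, being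
  convolutions of an \<open>L\<^sup>2\<close> fundamental solution of a product of operators \<open>1 + X\<close> with a function
  in \<open>C\<^sub>c\<close>.
\<close>

section \<open>Square-integrable functions\<close>

text \<open>Evaluation at \<open>(g, g^-1)\<close> pairs opposite \<open>a\<close>-coordinates
  \<alpha> and -\<alpha>. So the shifts of the \<open>a\<close>-coordinates preserve the Haar
  weight, and the dilations of the \<open>b\<close>-coordinates by exp \<alpha> and exp (-\<alpha>)
  have joint Jacobian 1; no modular factor enters either half of the Schur test. The approximating
  functionals are integrals of values of \<open>u\<close>, not expressions in \<open>\<xi>\<close>
  and \<open>\<eta>\<close>. They are thus linear in \<open>u\<close>, independent of its
  representation as a coefficient, and defined on all of A(F x F), although the Fourier formula is
  proved only for coefficients of nice vectors. For a fixed step \<open>e\<close> they have a crude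
  bound of order 1/e. This is enough to extend the uniform bound from nice vectors by density, and
  the uniform bound in turn extends the convergence. The constant (2 pi)^2 of Bessel's inequality
  cancels the one of Fourier inversion, so the Schur constant \<open>C\<close> itself bounds the
  limiting form.\<close>

lemma borel_measurable_cnj [measurable]: "cnj \<in> borel_measurable borel"
  by (intro borel_measurable_continuous_onI continuous_intros)

lemma L2_measurable: "\<xi> \<in> L2 \<mu> \<Longrightarrow> \<xi> \<in> borel_measurable \<mu>"
  by (simp add: L2_def)

lemma L2_integrable_square: "\<xi> \<in> L2 \<mu> \<Longrightarrow> integrable \<mu> (\<lambda>x. (cmod (\<xi> x))\<^sup>2)"
  by (simp add: L2_def)

lemma L2_norm_nonneg [simp]: "0 \<le> L2_norm \<mu> \<xi>"
  by (simp add: L2_norm_def)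

lemma L2_norm_power2: "(L2_norm \<mu> \<xi>)\<^sup>2 = (LINT x|\<mu>. (cmod (\<xi> x))\<^sup>2)"
  by (simp add: L2_norm_def)

lemma L2_zero: "(\<lambda>x. 0) \<in> L2 \<mu>"
  by (simp add: L2_def)

lemma cmod_add_power2_le: "(cmod (a + b))\<^sup>2 \<le> 2 * (cmod a)\<^sup>2 + 2 * (cmod b)\<^sup>2"
proof -
  have "(cmod (a + b))\<^sup>2 \<le> (cmod a + cmod b)\<^sup>2"
    by (intro power_mono norm_triangle_ineq) simp
  also have "\<dots> \<le> 2 * (cmod a)\<^sup>2 + 2 * (cmod b)\<^sup>2"
    using sum_squares_bound[of "cmod a" "cmod b"] by (simp add: power2_sum)
  finally show ?thesis .
qed

lemma cmod_mult_cnj_le: "2 * cmod (a * cnj b) \<le> (cmod a)\<^sup>2 + (cmod b)\<^sup>2"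
  using sum_squares_bound[of "cmod a" "cmod b"] by (simp add: norm_mult mult.assoc)

lemma L2_add:
  assumes "\<xi> \<in> L2 \<mu>" "\<eta> \<in> L2 \<mu>"
  shows "(\<lambda>x. \<xi> x + \<eta> x) \<in> L2 \<mu>"
proof -
  have [measurable]: "\<xi> \<in> borel_measurable \<mu>" "\<eta> \<in> borel_measurable \<mu>"
    using assms by (auto dest: L2_measurable)
  have "integrable \<mu> (\<lambda>x. 2 * (cmod (\<xi> x))\<^sup>2 + 2 * (cmod (\<eta> x))\<^sup>2)"
    using assms by (intro Bochner_Integration.integrable_add integrable_mult_right L2_integrable_square)
  then have "integrable \<mu> (\<lambda>x. (cmod (\<xi> x + \<eta> x))\<^sup>2)"
    by (rule Bochner_Integration.integrable_bound) (use cmod_add_power2_le in auto)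
  then show ?thesis
    by (simp add: L2_def)
qed

lemma L2_cmult:
  assumes "\<xi> \<in> L2 \<mu>"
  shows "(\<lambda>x. c * \<xi> x) \<in> L2 \<mu>"
  using assms by (auto simp: L2_def norm_mult power_mult_distrib)

lemma L2_diff:
  assumes "\<xi> \<in> L2 \<mu>" "\<eta> \<in> L2 \<mu>"
  shows "(\<lambda>x. \<xi> x - \<eta> x) \<in> L2 \<mu>"
  using L2_add[OF assms(1) L2_cmult[OF assms(2), of "-1"]] by simp

lemma L2_inner_integrable:
  assumes "\<xi> \<in> L2 \<mu>" "\<eta> \<in> L2 \<mu>"
  shows "integrable \<mu> (\<lambda>x. \<xi> x * cnj (\<eta> x))"
proof -
  have [measurable]: "\<xi> \<in> borel_measurable \<mu>" "\<eta> \<in> borel_measurable \<mu>"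
    using assms by (auto dest: L2_measurable)
  have "integrable \<mu> (\<lambda>x. (cmod (\<xi> x))\<^sup>2 + (cmod (\<eta> x))\<^sup>2)"
    using assms by (auto dest: L2_integrable_square)
  then show ?thesis
  proof (rule Bochner_Integration.integrable_bound)
    show "AE x in \<mu>. norm (\<xi> x * cnj (\<eta> x)) \<le> norm ((cmod (\<xi> x))\<^sup>2 + (cmod (\<eta> x))\<^sup>2)"
    proof (rule AE_I2)
      fix x
      show "norm (\<xi> x * cnj (\<eta> x)) \<le> norm ((cmod (\<xi> x))\<^sup>2 + (cmod (\<eta> x))\<^sup>2)"
        using cmod_mult_cnj_le[of "\<xi> x" "\<eta> x"] norm_ge_zero[of "\<xi> x * cnj (\<eta> x)"]
        unfolding real_norm_def by linarith
    qed
  qed measurable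
qed

lemma L2_inner_add_left:
  assumes "\<xi> \<in> L2 \<mu>" "\<xi>' \<in> L2 \<mu>" "\<eta> \<in> L2 \<mu>"
  shows "L2_inner \<mu> (\<lambda>x. \<xi> x + \<xi>' x) \<eta> = L2_inner \<mu> \<xi> \<eta> + L2_inner \<mu> \<xi>' \<eta>"
  unfolding L2_inner_def
  by (subst Bochner_Integration.integral_add[symmetric])
    (auto simp: algebra_simps intro!: L2_inner_integrable assms)

lemma L2_inner_cmult_left: "L2_inner \<mu> (\<lambda>x. c * \<xi> x) \<eta> = c * L2_inner \<mu> \<xi> \<eta>"
  by (simp add: L2_inner_def mult.assoc)

lemma L2_inner_diff_left:
  assumes "\<xi> \<in> L2 \<mu>" "\<xi>' \<in> L2 \<mu>" "\<eta> \<in> L2 \<mu>"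
  shows "L2_inner \<mu> (\<lambda>x. \<xi> x - \<xi>' x) \<eta> = L2_inner \<mu> \<xi> \<eta> - L2_inner \<mu> \<xi>' \<eta>"
  unfolding L2_inner_def
  by (subst Bochner_Integration.integral_diff[symmetric])
    (auto simp: algebra_simps intro!: L2_inner_integrable assms)

lemma L2_inner_commute: "L2_inner \<mu> \<eta> \<xi> = cnj (L2_inner \<mu> \<xi> \<eta>)"
  unfolding L2_inner_def by (simp add: mult.commute flip: Bochner_Integration.integral_cnj)

lemma L2_inner_add_right:
  assumes "\<xi> \<in> L2 \<mu>" "\<eta> \<in> L2 \<mu>" "\<eta>' \<in> L2 \<mu>"
  shows "L2_inner \<mu> \<xi> (\<lambda>x. \<eta> x + \<eta>' x) = L2_inner \<mu> \<xi> \<eta> + L2_inner \<mu> \<xi> \<eta>'"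
  using L2_inner_add_left[OF assms(2,3,1)]
  by (subst L2_inner_commute, subst (2) L2_inner_commute, subst (3) L2_inner_commute) simp

lemma L2_inner_cmult_right: "L2_inner \<mu> \<xi> (\<lambda>x. c * \<eta> x) = cnj c * L2_inner \<mu> \<xi> \<eta>"
proof -
  have "(\<lambda>x. \<xi> x * cnj (c * \<eta> x)) = (\<lambda>x. cnj c * (\<xi> x * cnj (\<eta> x)))"
    by (simp add: algebra_simps)
  then show ?thesis
    by (simp add: L2_inner_def)
qed

lemma L2_inner_self: "L2_inner \<mu> \<xi> \<xi> = complex_of_real ((L2_norm \<mu> \<xi>)\<^sup>2)"
  unfolding L2_inner_def L2_norm_power2
  by (simp add: complex_norm_square[symmetric] flip: integral_complex_of_real)

lemma L2_norm_cmult: "L2_norm \<mu> (\<lambda>x. c * \<xi> x) = cmod c * L2_norm \<mu> \<xi>"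
  by (simp add: L2_norm_def norm_mult power_mult_distrib real_sqrt_mult)

lemma L2_norm_diff_commute: "L2_norm \<mu> (\<lambda>x. \<xi> x - \<eta> x) = L2_norm \<mu> (\<lambda>x. \<eta> x - \<xi> x)"
  by (simp add: L2_norm_def norm_minus_commute)

lemma L2_norm_eq_0_iff:
  assumes "\<xi> \<in> L2 \<mu>"
  shows "L2_norm \<mu> \<xi> = 0 \<longleftrightarrow> (AE x in \<mu>. \<xi> x = 0)"
  using integral_nonneg_eq_0_iff_AE[OF L2_integrable_square[OF assms]]
  by (simp add: L2_norm_def)

lemma L2_inner_cong_AE:
  assumes "\<xi> \<in> borel_measurable \<mu>" "\<xi>' \<in> borel_measurable \<mu>" "\<eta> \<in> borel_measurable \<mu>"
    and "AE x in \<mu>. \<xi> x = \<xi>' x"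
  shows "L2_inner \<mu> \<xi> \<eta> = L2_inner \<mu> \<xi>' \<eta>"
  unfolding L2_inner_def
proof (rule integral_cong_AE)
  show "AE x in \<mu>. \<xi> x * cnj (\<eta> x) = \<xi>' x * cnj (\<eta> x)"
    using assms(4) by eventually_elim simp
qed (use assms(1-3) in measurable)

text \<open>The inequalities 2 |a b| \<le> t^2 |a|^2 + |b|^2 / t^2 are integrated and then optimised
  over \<open>t\<close>. A vanishing norm leaves no optimal \<open>t\<close> and is treated
  apart.\<close>

lemma L2_Cauchy_Schwarz_abs:
  assumes "\<xi> \<in> L2 \<mu>" "\<eta> \<in> L2 \<mu>"
  shows "(LINT x|\<mu>. cmod (\<xi> x * cnj (\<eta> x))) \<le> L2_norm \<mu> \<xi> * L2_norm \<mu> \<eta>"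
proof -
  let ?a = "L2_norm \<mu> \<xi>" and ?b = "L2_norm \<mu> \<eta>"
  let ?I = "LINT x|\<mu>. cmod (\<xi> x * cnj (\<eta> x))"
  have *: "2 * ?I \<le> t\<^sup>2 * ?a\<^sup>2 + ?b\<^sup>2 / t\<^sup>2" if "t > 0" for t :: real
  proof -
    have "2 * ?I = (LINT x|\<mu>. 2 * cmod (\<xi> x * cnj (\<eta> x)))"
      by simp
    also have "\<dots> \<le> (LINT x|\<mu>. t\<^sup>2 * (cmod (\<xi> x))\<^sup>2 + (cmod (\<eta> x))\<^sup>2 / t\<^sup>2)"
    proof (rule integral_mono)
      show "integrable \<mu> (\<lambda>x. 2 * cmod (\<xi> x * cnj (\<eta> x)))"
        using L2_inner_integrable[OF assms] by (intro integrable_mult_right integrable_norm)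
      show "integrable \<mu> (\<lambda>x. t\<^sup>2 * (cmod (\<xi> x))\<^sup>2 + (cmod (\<eta> x))\<^sup>2 / t\<^sup>2)"
        using assms by (intro Bochner_Integration.integrable_add integrable_mult_right integrable_divide L2_integrable_square)
      show "2 * cmod (\<xi> x * cnj (\<eta> x)) \<le> t\<^sup>2 * (cmod (\<xi> x))\<^sup>2 + (cmod (\<eta> x))\<^sup>2 / t\<^sup>2" for x
        using cmod_mult_cnj_le[of "of_real t * \<xi> x" "\<eta> x / of_real t"] that
        by (simp add: norm_mult norm_divide power_mult_distrib power_divide)
    qed
    also have "\<dots> = t\<^sup>2 * ?a\<^sup>2 + ?b\<^sup>2 / t\<^sup>2"
      using assms by (simp add: L2_norm_power2 L2_integrable_square)
    finally show ?thesis .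
  qed
  show ?thesis
  proof (cases "?a = 0 \<or> ?b = 0")
    case True
    then have "AE x in \<mu>. cmod (\<xi> x * cnj (\<eta> x)) = 0"
      using assms by (auto simp: L2_norm_eq_0_iff)
    then have "?I = 0"
      using L2_inner_integrable[OF assms] by (intro integral_eq_zero_AE)
    then show ?thesis
      by simp
  next
    case False
    then have ab: "?a > 0" "?b > 0"
      by (simp_all add: less_le)
    from *[of "sqrt (?b / ?a)"] ab have "2 * ?I \<le> ?b / ?a * ?a\<^sup>2 + ?b\<^sup>2 / (?b / ?a)"
      by simp
    also have "\<dots> = 2 * (?a * ?b)"
      using ab by (simp add: power2_eq_square field_simps)
    finally show ?thesis
      by simp
  qed
qed

lemma L2_Cauchy_Schwarz:
  assumes "\<xi> \<in> L2 \<mu>" "\<eta> \<in> L2 \<mu>"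
  shows "cmod (L2_inner \<mu> \<xi> \<eta>) \<le> L2_norm \<mu> \<xi> * L2_norm \<mu> \<eta>"
  unfolding L2_inner_def
  using integral_norm_bound L2_Cauchy_Schwarz_abs[OF assms] by (rule order_trans)

lemma L2_norm_add_power2:
  assumes "\<xi> \<in> L2 \<mu>" "\<eta> \<in> L2 \<mu>"
  shows "(L2_norm \<mu> (\<lambda>x. \<xi> x + \<eta> x))\<^sup>2 =
    (L2_norm \<mu> \<xi>)\<^sup>2 + (L2_norm \<mu> \<eta>)\<^sup>2 + 2 * Re (L2_inner \<mu> \<xi> \<eta>)"
proof -
  have "complex_of_real ((L2_norm \<mu> (\<lambda>x. \<xi> x + \<eta> x))\<^sup>2) =
      L2_inner \<mu> \<xi> \<xi> + L2_inner \<mu> \<eta> \<eta> + (L2_inner \<mu> \<xi> \<eta> + cnj (L2_inner \<mu> \<xi> \<eta>))"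
    unfolding L2_inner_self[symmetric]
    by (simp add: L2_inner_add_left L2_inner_add_right L2_add assms
        L2_inner_commute[of \<mu> \<eta> \<xi>])
  also have "\<dots> = complex_of_real
      ((L2_norm \<mu> \<xi>)\<^sup>2 + (L2_norm \<mu> \<eta>)\<^sup>2 + 2 * Re (L2_inner \<mu> \<xi> \<eta>))"
    by (simp add: L2_inner_self complex_add_cnj)
  finally show ?thesis
    unfolding of_real_eq_iff .
qed

lemma L2_norm_triangle:
  assumes "\<xi> \<in> L2 \<mu>" "\<eta> \<in> L2 \<mu>"
  shows "L2_norm \<mu> (\<lambda>x. \<xi> x + \<eta> x) \<le> L2_norm \<mu> \<xi> + L2_norm \<mu> \<eta>"
proof (rule power2_le_imp_le)
  have "Re (L2_inner \<mu> \<xi> \<eta>) \<le> L2_norm \<mu> \<xi> * L2_norm \<mu> \<eta>"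
    using L2_Cauchy_Schwarz[OF assms] complex_Re_le_cmod by (rule order_trans[rotated])
  then show "(L2_norm \<mu> (\<lambda>x. \<xi> x + \<eta> x))\<^sup>2 \<le> (L2_norm \<mu> \<xi> + L2_norm \<mu> \<eta>)\<^sup>2"
    unfolding L2_norm_add_power2[OF assms] by (simp add: power2_sum)
qed simp

lemma L2_norm_diff_le:
  assumes "\<xi> \<in> L2 \<mu>" "\<eta> \<in> L2 \<mu>"
  shows "\<bar>L2_norm \<mu> \<xi> - L2_norm \<mu> \<eta>\<bar> \<le> L2_norm \<mu> (\<lambda>x. \<xi> x - \<eta> x)"
  using L2_norm_triangle[OF L2_diff[OF assms] assms(2)]
    L2_norm_triangle[OF L2_diff[OF assms(2,1)] assms(1)]
  by (simp add: L2_norm_diff_commute[of \<mu> \<xi> \<eta>])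

lemma L2_AE_eqI:
  assumes "\<xi> \<in> L2 \<mu>" "\<xi>' \<in> L2 \<mu>"
    and "\<And>\<eta>. \<eta> \<in> L2 \<mu> \<Longrightarrow> L2_inner \<mu> \<xi> \<eta> = L2_inner \<mu> \<xi>' \<eta>"
  shows "AE x in \<mu>. \<xi> x = \<xi>' x"
proof -
  let ?d = "\<lambda>x. \<xi> x - \<xi>' x"
  have d: "?d \<in> L2 \<mu>"
    by (rule L2_diff[OF assms(1,2)])
  have "L2_inner \<mu> ?d ?d = 0"
    using assms d by (simp add: L2_inner_diff_left[of \<xi> \<mu> \<xi>' ?d])
  then have "L2_norm \<mu> ?d = 0"
    by (simp add: L2_inner_self)
  then show ?thesis
    using L2_norm_eq_0_iff[OF d] by simp
qed

lemma L2_nn_integral: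
  assumes "\<xi> \<in> L2 \<mu>"
  shows "(\<integral>\<^sup>+x. ennreal ((cmod (\<xi> x))\<^sup>2) \<partial>\<mu>) = ennreal ((L2_norm \<mu> \<xi>)\<^sup>2)"
  unfolding L2_norm_power2 by (rule nn_integral_eq_integral[OF L2_integrable_square[OF assms]]) simp

lemma L2I:
  assumes "\<xi> \<in> borel_measurable \<mu>" "(\<integral>\<^sup>+x. ennreal ((cmod (\<xi> x))\<^sup>2) \<partial>\<mu>) \<le> ennreal c"
  shows "\<xi> \<in> L2 \<mu>"
proof -
  have "integrable \<mu> (\<lambda>x. (cmod (\<xi> x))\<^sup>2)"
    using assms by (intro integrableI_bounded) (auto simp: le_less_trans)
  then show ?thesis
    using assms(1) by (simp add: L2_def)
qed

lemma L2_norm_le: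
  assumes "\<xi> \<in> L2 \<mu>" "(\<integral>\<^sup>+x. ennreal ((cmod (\<xi> x))\<^sup>2) \<partial>\<mu>) \<le> ennreal (c\<^sup>2)" "0 \<le> c"
  shows "L2_norm \<mu> \<xi> \<le> c"
  using assms(2) unfolding L2_nn_integral[OF assms(1)]
  by (intro power2_le_imp_le[OF _ assms(3)]) simp

text \<open>Riesz-Fischer: weights 2^k in the series of squared increments keep it integrable and
  force geometric decay of the increments almost everywhere. Fatou's lemma turns the pointwise limit
  into a limit in norm.\<close>

lemma L2_complete:
  fixes f :: "nat \<Rightarrow> 'a \<Rightarrow> complex"
  assumes f: "\<And>n. f n \<in> L2 \<mu>"
    and Cauchy: "\<And>e. e > 0 \<Longrightarrow> \<exists>N. \<forall>m\<ge>N. \<forall>n\<ge>N. L2_norm \<mu> (\<lambda>x. f m x - f n x) < e"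
  shows "\<exists>g\<in>L2 \<mu>. (\<lambda>n. L2_norm \<mu> (\<lambda>x. f n x - g x)) \<longlonglongrightarrow> 0"
proof -
  have [measurable]: "f n \<in> borel_measurable \<mu>" for n
    using f by (rule L2_measurable)
  have "\<forall>k::nat. \<exists>N. \<forall>m\<ge>N. \<forall>n\<ge>N. L2_norm \<mu> (\<lambda>x. f m x - f n x) < (1/2)^k"
    using Cauchy by simp
  then obtain N where N: "\<And>k m n. N k \<le> m \<Longrightarrow> N k \<le> n \<Longrightarrow> L2_norm \<mu> (\<lambda>x. f m x - f n x) < (1/2)^k"
    by metis
  \<comment> \<open>The sum dominates every \<open>N k\<close> with \<open>k \<le> j\<close>, so
    \<open>r j\<close> meets all earlier Cauchy thresholds at once.\<close>
  define r where "r k = (\<Sum>i\<le>k. N i)" for k :: nat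
  have r: "N k \<le> r j" if "k \<le> j" for k j
    unfolding r_def using that by (intro member_le_sum) auto
  define h where "h k x = f (r (Suc k)) x - f (r k) x" for k x
  have h: "h k \<in> L2 \<mu>" for k
    unfolding h_def by (intro L2_diff f)
  have [measurable]: "h k \<in> borel_measurable \<mu>" for k
    using h by (rule L2_measurable)
  have h_norm: "L2_norm \<mu> (h k) \<le> (1/2)^k" for k
    unfolding h_def using N[of k "r (Suc k)" "r k"] r by (simp add: less_imp_le)
  have "(\<integral>\<^sup>+x. (\<Sum>k. ennreal (2^k * (cmod (h k x))\<^sup>2)) \<partial>\<mu>) = (\<Sum>k. \<integral>\<^sup>+x. ennreal (2^k * (cmod (h k x))\<^sup>2) \<partial>\<mu>)"
    by (rule nn_integral_suminf) measurable
  also have "\<dots> = (\<Sum>k. ennreal (2^k * (L2_norm \<mu> (h k))\<^sup>2))"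
    by (simp add: ennreal_mult nn_integral_cmult L2_nn_integral[OF h])
  also have "\<dots> \<le> (\<Sum>k. ennreal ((1/2)^k))"
  proof (intro suminf_le)
    fix k
    have "2^k * (L2_norm \<mu> (h k))\<^sup>2 \<le> 2^k * ((1/2)^k)\<^sup>2"
      using h_norm[of k] by (intro mult_left_mono power_mono) auto
    also have "\<dots> = (1/2)^k"
      by (simp add: power2_eq_square power_one_over)
    finally show "ennreal (2^k * (L2_norm \<mu> (h k))\<^sup>2) \<le> ennreal ((1/2)^k)"
      by (rule ennreal_leI)
  qed auto
  also have "\<dots> = ennreal 2"
    using geometric_sums[of "1/2::real"] by (intro suminf_ennreal_eq) auto
  finally have "AE x in \<mu>. (\<Sum>k. ennreal (2^k * (cmod (h k x))\<^sup>2)) \<noteq> \<infinity>"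
    by (intro nn_integral_noteq_infinite) (auto simp: top_unique)
  then have conv: "AE x in \<mu>. convergent (\<lambda>k. f (r k) x)"
  proof eventually_elim
    fix x assume "(\<Sum>k. ennreal (2^k * (cmod (h k x))\<^sup>2)) \<noteq> \<infinity>"
    then have "summable (\<lambda>k. 2^k * (cmod (h k x))\<^sup>2)"
      by (intro summable_suminf_not_top) auto
    then have "Bseq (\<lambda>k. 2^k * (cmod (h k x))\<^sup>2)"
      by (intro convergent_imp_Bseq convergentI[of _ 0] summable_LIMSEQ_zero)
    then obtain c where c: "c > 0" "\<And>k. norm (2^k * (cmod (h k x))\<^sup>2) \<le> c"
      by (auto elim: BseqE)
    have le: "cmod (h k x) \<le> sqrt c * (sqrt (1/2))^k" for k
    proof (rule power2_le_imp_le)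
      have "(cmod (h k x))\<^sup>2 \<le> c * (1/2)^k"
        using c(2)[of k] by (simp add: abs_mult field_simps)
      also have "\<dots> = (sqrt c * (sqrt (1/2))^k)\<^sup>2"
        using c(1) by (simp add: power_mult_distrib power_even_eq[symmetric] power_mult[symmetric] mult.commute[of k] power_mult)
      finally show "(cmod (h k x))\<^sup>2 \<le> (sqrt c * (sqrt (1/2))^k)\<^sup>2" .
    qed (use c in auto)
    have "summable (\<lambda>k. h k x)"
    proof (rule summable_comparison_test'[where N = 0])
      show "summable (\<lambda>k. sqrt c * (sqrt (1/2))^k)"
        by (intro summable_mult summable_geometric) (simp add: real_sqrt_divide)
    qed (use le in auto)
    then have "convergent (\<lambda>k. \<Sum>i<k. h i x)"
      by (simp add: summable_iff_convergent)
    then have "convergent (\<lambda>k. f (r 0) x + (\<Sum>i<k. h i x))"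
      by (intro convergent_add convergent_const)
    also have "(\<lambda>k. f (r 0) x + (\<Sum>i<k. h i x)) = (\<lambda>k. f (r k) x)"
      unfolding h_def by (subst sum_lessThan_telescope) simp
    finally show "convergent (\<lambda>k. f (r k) x)" .
  qed
  define g where "g x = lim (\<lambda>k. f (r k) x)" for x
  have [measurable]: "g \<in> borel_measurable \<mu>"
    unfolding g_def by measurable
  have fg: "(\<integral>\<^sup>+x. ennreal ((cmod (f n x - g x))\<^sup>2) \<partial>\<mu>) \<le> ennreal (((1/2)^j)\<^sup>2)" if "N j \<le> n" for n j
  proof -
    have "(\<integral>\<^sup>+x. ennreal ((cmod (f n x - g x))\<^sup>2) \<partial>\<mu>) =
        (\<integral>\<^sup>+x. liminf (\<lambda>k. ennreal ((cmod (f n x - f (r k) x))\<^sup>2)) \<partial>\<mu>)"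
    proof (rule nn_integral_cong_AE)
      show "AE x in \<mu>. ennreal ((cmod (f n x - g x))\<^sup>2) = liminf (\<lambda>k. ennreal ((cmod (f n x - f (r k) x))\<^sup>2))"
        using conv
      proof eventually_elim
        fix x assume "convergent (\<lambda>k. f (r k) x)"
        then have "(\<lambda>k. f (r k) x) \<longlonglongrightarrow> g x"
          by (simp add: g_def convergent_LIMSEQ_iff)
        then have "(\<lambda>k. ennreal ((cmod (f n x - f (r k) x))\<^sup>2)) \<longlonglongrightarrow> ennreal ((cmod (f n x - g x))\<^sup>2)"
          by (intro tendsto_intros)
        then show "ennreal ((cmod (f n x - g x))\<^sup>2) = liminf (\<lambda>k. ennreal ((cmod (f n x - f (r k) x))\<^sup>2))"
          by (intro lim_imp_Liminf[symmetric]) auto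
      qed
    qed
    also have "\<dots> \<le> liminf (\<lambda>k. \<integral>\<^sup>+x. ennreal ((cmod (f n x - f (r k) x))\<^sup>2) \<partial>\<mu>)"
      by (rule nn_integral_liminf) measurable
    also have "\<dots> \<le> ennreal (((1/2)^j)\<^sup>2)"
    proof -
      have "\<forall>\<^sub>F k in sequentially. (\<integral>\<^sup>+x. ennreal ((cmod (f n x - f (r k) x))\<^sup>2) \<partial>\<mu>) \<le> ennreal (((1/2)^j)\<^sup>2)"
      proof (rule eventually_sequentiallyI[of j])
        fix k assume "j \<le> k"
        then have "L2_norm \<mu> (\<lambda>x. f n x - f (r k) x) \<le> (1/2)^j"
          using N[of j n "r k"] r that by (simp add: less_imp_le)
        then have "(L2_norm \<mu> (\<lambda>x. f n x - f (r k) x))\<^sup>2 \<le> ((1/2)^j)\<^sup>2"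
          by (intro power_mono) auto
        then show "(\<integral>\<^sup>+x. ennreal ((cmod (f n x - f (r k) x))\<^sup>2) \<partial>\<mu>) \<le> ennreal (((1/2)^j)\<^sup>2)"
          by (simp add: L2_nn_integral[OF L2_diff[OF f f]] ennreal_leI)
      qed
      then show ?thesis
        by (intro order_trans[OF Liminf_le]) auto
    qed
    finally show ?thesis .
  qed
  have "(\<lambda>x. f (N 0) x - g x) \<in> L2 \<mu>"
    by (rule L2I[OF _ fg[of 0]]) auto
  from L2_diff[OF f[of "N 0"] this] have g: "g \<in> L2 \<mu>"
    by simp
  have "(\<lambda>n. L2_norm \<mu> (\<lambda>x. f n x - g x)) \<longlonglongrightarrow> 0"
  proof (rule LIMSEQ_I)
    fix e :: real assume "e > 0"
    then obtain j where j: "(1/2)^j < e"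
      using real_arch_pow_inv[of e "1/2"] by auto
    have "L2_norm \<mu> (\<lambda>x. f n x - g x) \<le> (1/2)^j" if "n \<ge> N j" for n
      by (rule L2_norm_le[OF L2_diff[OF f g] fg[OF that]]) simp
    with j show "\<exists>no. \<forall>n\<ge>no. norm (L2_norm \<mu> (\<lambda>x. f n x - g x) - 0) < e"
      by (intro exI[of _ "N j"]) (auto intro: le_less_trans)
  qed
  with g show ?thesis
    by blast
qed

section \<open>Riesz representation and operators from bounded forms\<close>

lemma L2_norm_parallelogram:
  assumes "\<xi> \<in> L2 \<mu>" "\<eta> \<in> L2 \<mu>"
  shows "(L2_norm \<mu> (\<lambda>x. \<xi> x - \<eta> x))\<^sup>2 + (L2_norm \<mu> (\<lambda>x. \<xi> x + \<eta> x))\<^sup>2 =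
    2 * (L2_norm \<mu> \<xi>)\<^sup>2 + 2 * (L2_norm \<mu> \<eta>)\<^sup>2"
  using L2_norm_add_power2[OF assms] L2_norm_add_power2[OF assms(1) L2_cmult[OF assms(2), of "-1"]]
    L2_inner_cmult_right[of \<mu> \<xi> "-1" \<eta>] L2_norm_cmult[of \<mu> "-1" \<eta>]
  by simp

text \<open>The representing vector minimises \<open>\<parallel>\<xi>\<parallel>\<^sup>2 - 2 Re (l \<xi>)\<close>.\<close>

lemma L2_Riesz_representation:
  fixes l :: "('a \<Rightarrow> complex) \<Rightarrow> complex"
  assumes add: "\<And>\<xi> \<eta>. \<xi> \<in> L2 \<mu> \<Longrightarrow> \<eta> \<in> L2 \<mu> \<Longrightarrow> l (\<lambda>x. \<xi> x + \<eta> x) = l \<xi> + l \<eta>"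
    and scale: "\<And>c \<xi>. \<xi> \<in> L2 \<mu> \<Longrightarrow> l (\<lambda>x. c * \<xi> x) = c * l \<xi>"
    and bound: "\<And>\<xi>. \<xi> \<in> L2 \<mu> \<Longrightarrow> cmod (l \<xi>) \<le> C * L2_norm \<mu> \<xi>"
  shows "\<exists>\<zeta>\<in>L2 \<mu>. \<forall>\<xi>\<in>L2 \<mu>. l \<xi> = L2_inner \<mu> \<xi> \<zeta>"
proof -
  define J where "J \<xi> = (L2_norm \<mu> \<xi>)\<^sup>2 - 2 * Re (l \<xi>)" for \<xi>
  define m where "m = Inf (J ` L2 \<mu>)"
  have "J \<xi> \<ge> - C\<^sup>2" if "\<xi> \<in> L2 \<mu>" for \<xi>
  proof -
    have "Re (l \<xi>) \<le> C * L2_norm \<mu> \<xi>"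
      using bound[OF that] complex_Re_le_cmod order_trans by blast
    then have "J \<xi> + C\<^sup>2 \<ge> (L2_norm \<mu> \<xi> - C)\<^sup>2"
      by (simp add: J_def power2_diff mult.commute)
    then show ?thesis
      using zero_le_power2[of "L2_norm \<mu> \<xi> - C"] by linarith
  qed
  then have bdd: "bdd_below (J ` L2 \<mu>)"
    by (intro bdd_belowI2)
  have m: "m \<le> J \<xi>" if "\<xi> \<in> L2 \<mu>" for \<xi>
    unfolding m_def using bdd that by (intro cInf_lower) auto
  have "\<exists>\<xi>\<in>L2 \<mu>. J \<xi> < m + 1 / real (Suc n)" for n
    using cInf_less_iff[OF _ bdd, of "m + 1 / real (Suc n)"] L2_zero by (auto simp: m_def)
  then obtain f where f: "\<And>n. f n \<in> L2 \<mu>" and Jf: "\<And>n. J (f n) < m + 1 / real (Suc n)"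
    by metis
  \<comment> \<open>The midpoint of two near-minimisers is again a competitor, so the parallelogram
    law makes a minimising sequence Cauchy.\<close>
  have par: "(L2_norm \<mu> (\<lambda>x. \<xi> x - \<eta> x))\<^sup>2 \<le> 2 * J \<xi> + 2 * J \<eta> - 4 * m"
    if \<xi>: "\<xi> \<in> L2 \<mu>" and \<eta>: "\<eta> \<in> L2 \<mu>" for \<xi> \<eta>
  proof -
    have "m \<le> J (\<lambda>x. 1 / 2 * (\<xi> x + \<eta> x))"
      by (intro m L2_cmult L2_add \<xi> \<eta>)
    also have "\<dots> = 1 / 4 * (L2_norm \<mu> (\<lambda>x. \<xi> x + \<eta> x))\<^sup>2 - Re (l \<xi>) - Re (l \<eta>)"
      unfolding J_def scale[OF L2_add[OF \<xi> \<eta>]] add[OF \<xi> \<eta>] L2_norm_cmult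
      by (simp add: power_mult_distrib power_divide field_simps)
    finally show ?thesis
      using L2_norm_parallelogram[OF \<xi> \<eta>] by (simp add: J_def)
  qed
  have "\<exists>\<zeta>\<in>L2 \<mu>. (\<lambda>n. L2_norm \<mu> (\<lambda>x. f n x - \<zeta> x)) \<longlonglongrightarrow> 0"
  proof (rule L2_complete[OF f])
    fix e :: real assume e: "e > 0"
    then obtain N where N: "1 / real (Suc N) < e\<^sup>2 / 4"
      using reals_Archimedean[of "e\<^sup>2 / 4"] by (auto simp: inverse_eq_divide)
    show "\<exists>N. \<forall>m\<ge>N. \<forall>n\<ge>N. L2_norm \<mu> (\<lambda>x. f m x - f n x) < e"
    proof (intro exI[of _ N] allI impI)
      fix i j assume ij: "N \<le> i" "N \<le> j"
      then have "1 / real (Suc i) \<le> 1 / real (Suc N)" "1 / real (Suc j) \<le> 1 / real (Suc N)"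
        by (auto intro!: divide_left_mono)
      then have "(L2_norm \<mu> (\<lambda>x. f i x - f j x))\<^sup>2 < e\<^sup>2"
        using par[OF f f, of i j] Jf[of i] Jf[of j] N by linarith
      then show "L2_norm \<mu> (\<lambda>x. f i x - f j x) < e"
        using e by (simp add: power_less_imp_less_base)
    qed
  qed
  then obtain \<zeta> where \<zeta>: "\<zeta> \<in> L2 \<mu>" and lim: "(\<lambda>n. L2_norm \<mu> (\<lambda>x. f n x - \<zeta> x)) \<longlonglongrightarrow> 0"
    by blast
  have l_diff: "l (\<lambda>x. \<xi> x - \<eta> x) = l \<xi> - l \<eta>" if "\<xi> \<in> L2 \<mu>" "\<eta> \<in> L2 \<mu>" for \<xi> \<eta>
    using add[OF that(1) L2_cmult[OF that(2), of "-1"]] scale[OF that(2), of "-1"] by simp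
  have "(\<lambda>n. L2_norm \<mu> (f n) - L2_norm \<mu> \<zeta>) \<longlonglongrightarrow> 0"
    by (rule Lim_null_comparison[OF _ lim]) (auto intro!: always_eventually L2_norm_diff_le f \<zeta>)
  then have "(\<lambda>n. L2_norm \<mu> (f n)) \<longlonglongrightarrow> L2_norm \<mu> \<zeta>"
    by (simp add: LIM_zero_iff)
  moreover have "(\<lambda>n. l (f n) - l \<zeta>) \<longlonglongrightarrow> 0"
  proof (rule Lim_null_comparison)
    show "\<forall>\<^sub>F n in sequentially. norm (l (f n) - l \<zeta>) \<le> C * L2_norm \<mu> (\<lambda>x. f n x - \<zeta> x)"
      by (intro always_eventually allI) (metis l_diff[OF f \<zeta>] bound[OF L2_diff[OF f \<zeta>]])
    show "(\<lambda>n. C * L2_norm \<mu> (\<lambda>x. f n x - \<zeta> x)) \<longlonglongrightarrow> 0"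
      using tendsto_mult_left[OF lim, of C] by simp
  qed
  then have "(\<lambda>n. l (f n)) \<longlonglongrightarrow> l \<zeta>"
    by (simp add: LIM_zero_iff)
  ultimately have "(\<lambda>n. J (f n)) \<longlonglongrightarrow> J \<zeta>"
    unfolding J_def by (intro tendsto_intros)
  moreover have "(\<lambda>n. m + 1 / real (Suc n)) \<longlonglongrightarrow> m"
    using tendsto_add[OF tendsto_const LIMSEQ_inverse_real_of_nat] by (simp add: inverse_eq_divide)
  ultimately have "J \<zeta> \<le> m"
    by (rule LIMSEQ_le) (use Jf less_imp_le in blast)
  then have min: "J \<zeta> \<le> J \<xi>" if "\<xi> \<in> L2 \<mu>" for \<xi>
    using m[OF that] by simp
  have Re_eq: "Re (L2_inner \<mu> \<zeta> \<xi>) = Re (l \<xi>)" if \<xi>: "\<xi> \<in> L2 \<mu>" for \<xi>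
  proof -
    define a where "a = Re (L2_inner \<mu> \<zeta> \<xi>) - Re (l \<xi>)"
    have *: "0 \<le> t\<^sup>2 * (L2_norm \<mu> \<xi>)\<^sup>2 + 2 * t * a" for t :: real
    proof -
      have "J \<zeta> \<le> J (\<lambda>x. \<zeta> x + of_real t * \<xi> x)"
        by (intro min L2_add L2_cmult \<zeta> \<xi>)
      also have "\<dots> = J \<zeta> + t\<^sup>2 * (L2_norm \<mu> \<xi>)\<^sup>2 + 2 * t * a"
        unfolding J_def L2_norm_add_power2[OF \<zeta> L2_cmult[OF \<xi>]] add[OF \<zeta> L2_cmult[OF \<xi>]]
          scale[OF \<xi>] L2_norm_cmult L2_inner_cmult_right a_def
        by (simp add: power_mult_distrib algebra_simps)
      finally show ?thesis by simp
    qed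
    define n where "n = (L2_norm \<mu> \<xi>)\<^sup>2"
    \<comment> \<open>The minimiser of the quadratic polynomial in \<open>*\<close>, up to the
      \<open>+ 1\<close> that keeps the denominator positive when \<open>\<xi>\<close> has norm
      0.\<close>
    define t where "t = - a / (n + 1)"
    have n: "0 \<le> n"
      by (simp add: n_def)
    then have a: "a = - t * (n + 1)"
      by (simp add: t_def)
    have "0 \<le> t\<^sup>2 * n + 2 * t * a"
      using *[of t] by (simp add: n_def)
    also have "\<dots> = - (t\<^sup>2 * (n + 2))"
      unfolding a by (simp add: power2_eq_square algebra_simps)
    finally have "t\<^sup>2 * (n + 2) \<le> 0"
      by simp
    then have "t = 0"
      using n by (simp add: mult_le_0_iff)
    then have "a = 0"
      by (simp add: a)
    then show ?thesis
      by (simp add: a_def)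
  qed
  have "l \<xi> = L2_inner \<mu> \<xi> \<zeta>" if \<xi>: "\<xi> \<in> L2 \<mu>" for \<xi>
  proof (rule complex_eqI)
    show "Re (l \<xi>) = Re (L2_inner \<mu> \<xi> \<zeta>)"
      using Re_eq[OF \<xi>] by (subst L2_inner_commute) simp
    \<comment> \<open>Im z = - Re (i z), so the identity for real parts is applied to the multiple
      of \<open>\<xi>\<close> by the imaginary unit.\<close>
    show "Im (l \<xi>) = Im (L2_inner \<mu> \<xi> \<zeta>)"
      using Re_eq[OF L2_cmult[OF \<xi>, of \<i>]] unfolding scale[OF \<xi>] L2_inner_cmult_right
      by (subst L2_inner_commute) simp
  qed
  with \<zeta> show ?thesis by blast
qed

text \<open>Riesz representation of the functional that takes \<open>\<xi>\<close> to the inner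
  product of \<open>R \<xi>\<close> with \<open>\<eta>\<close>. As \<open>R\<close> is linear only
  almost everywhere, each algebraic identity passes through \<open>L2_inner_cong_AE\<close>.\<close>

lemma bounded_op_adjoint:
  assumes R: "bounded_op \<mu> R" and \<eta>: "\<eta> \<in> L2 \<mu>"
  shows "\<exists>\<zeta>\<in>L2 \<mu>. \<forall>\<xi>\<in>L2 \<mu>. L2_inner \<mu> (R \<xi>) \<eta> = L2_inner \<mu> \<xi> \<zeta>"
proof -
  have RL: "R \<xi> \<in> L2 \<mu>" if "\<xi> \<in> L2 \<mu>" for \<xi>
    using R that by (simp add: bounded_op_def)
  note meas = L2_measurable[OF L2_add] L2_measurable[OF L2_cmult] L2_measurable[OF \<eta>] L2_measurable[OF RL]
  obtain C where C: "\<And>\<xi>. \<xi> \<in> L2 \<mu> \<Longrightarrow> L2_norm \<mu> (R \<xi>) \<le> C * L2_norm \<mu> \<xi>"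
    using R unfolding bounded_op_def by blast
  show ?thesis
  proof (rule L2_Riesz_representation)
    fix \<xi> \<xi>' assume *: "\<xi> \<in> L2 \<mu>" "\<xi>' \<in> L2 \<mu>"
    have "AE x in \<mu>. R (\<lambda>y. \<xi> y + \<xi>' y) x = R \<xi> x + R \<xi>' x"
      using R * by (simp add: bounded_op_def)
    then have "L2_inner \<mu> (R (\<lambda>y. \<xi> y + \<xi>' y)) \<eta> = L2_inner \<mu> (\<lambda>x. R \<xi> x + R \<xi>' x) \<eta>"
      by (intro L2_inner_cong_AE meas L2_add RL *)
    then show "L2_inner \<mu> (R (\<lambda>y. \<xi> y + \<xi>' y)) \<eta> = L2_inner \<mu> (R \<xi>) \<eta> + L2_inner \<mu> (R \<xi>') \<eta>"
      by (simp add: L2_inner_add_left RL * \<eta>)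
  next
    fix c \<xi> assume *: "\<xi> \<in> L2 \<mu>"
    have "AE x in \<mu>. R (\<lambda>y. c * \<xi> y) x = c * R \<xi> x"
      using R * by (simp add: bounded_op_def)
    then have "L2_inner \<mu> (R (\<lambda>y. c * \<xi> y)) \<eta> = L2_inner \<mu> (\<lambda>x. c * R \<xi> x) \<eta>"
      by (intro L2_inner_cong_AE meas L2_cmult RL *)
    then show "L2_inner \<mu> (R (\<lambda>y. c * \<xi> y)) \<eta> = c * L2_inner \<mu> (R \<xi>) \<eta>"
      by (simp add: L2_inner_cmult_left)
  next
    fix \<xi> assume *: "\<xi> \<in> L2 \<mu>"
    have "cmod (L2_inner \<mu> (R \<xi>) \<eta>) \<le> L2_norm \<mu> (R \<xi>) * L2_norm \<mu> \<eta>"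
      by (intro L2_Cauchy_Schwarz RL * \<eta>)
    also have "\<dots> \<le> C * L2_norm \<mu> \<xi> * L2_norm \<mu> \<eta>"
      by (intro mult_right_mono C *) simp
    finally show "cmod (L2_inner \<mu> (R \<xi>) \<eta>) \<le> C * L2_norm \<mu> \<eta> * L2_norm \<mu> \<xi>"
      by (simp add: mult_ac)
  qed
qed

lemma bounded_sesquilinear_form_operator:
  fixes B :: "('g \<Rightarrow> complex) \<Rightarrow> ('g \<Rightarrow> complex) \<Rightarrow> complex"
  assumes add_left: "\<And>\<xi> \<xi>' \<eta>. \<xi> \<in> L2 \<mu> \<Longrightarrow> \<xi>' \<in> L2 \<mu> \<Longrightarrow> \<eta> \<in> L2 \<mu> \<Longrightarrow>
      B (\<lambda>x. \<xi> x + \<xi>' x) \<eta> = B \<xi> \<eta> + B \<xi>' \<eta>"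
    and scale_left: "\<And>c \<xi> \<eta>. \<xi> \<in> L2 \<mu> \<Longrightarrow> \<eta> \<in> L2 \<mu> \<Longrightarrow> B (\<lambda>x. c * \<xi> x) \<eta> = c * B \<xi> \<eta>"
    and add_right: "\<And>\<xi> \<eta> \<eta>'. \<xi> \<in> L2 \<mu> \<Longrightarrow> \<eta> \<in> L2 \<mu> \<Longrightarrow> \<eta>' \<in> L2 \<mu> \<Longrightarrow>
      B \<xi> (\<lambda>x. \<eta> x + \<eta>' x) = B \<xi> \<eta> + B \<xi> \<eta>'"
    and scale_right: "\<And>c \<xi> \<eta>. \<xi> \<in> L2 \<mu> \<Longrightarrow> \<eta> \<in> L2 \<mu> \<Longrightarrow> B \<xi> (\<lambda>x. c * \<eta> x) = cnj c * B \<xi> \<eta>"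
    and bound: "\<And>\<xi> \<eta>. \<xi> \<in> L2 \<mu> \<Longrightarrow> \<eta> \<in> L2 \<mu> \<Longrightarrow> cmod (B \<xi> \<eta>) \<le> C * L2_norm \<mu> \<xi> * L2_norm \<mu> \<eta>"
  shows "\<exists>S. bounded_op \<mu> S \<and> (\<forall>\<xi>\<in>L2 \<mu>. \<forall>\<eta>\<in>L2 \<mu>. L2_inner \<mu> (S \<xi>) \<eta> = B \<xi> \<eta>)"
proof -
  \<comment> \<open>The form is antilinear in its second argument; conjugation makes it linear, as
    the representation of functionals requires.\<close>
  have "\<exists>\<zeta>\<in>L2 \<mu>. \<forall>\<eta>\<in>L2 \<mu>. cnj (B \<xi> \<eta>) = L2_inner \<mu> \<eta> \<zeta>" if \<xi>: "\<xi> \<in> L2 \<mu>" for \<xi>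
  proof (rule L2_Riesz_representation)
    show "cmod (cnj (B \<xi> \<eta>)) \<le> C * L2_norm \<mu> \<xi> * L2_norm \<mu> \<eta>" if "\<eta> \<in> L2 \<mu>" for \<eta>
      using bound[OF \<xi> that] by simp
  qed (simp_all add: add_right scale_right \<xi>)
  then obtain S where S: "\<And>\<xi>. \<xi> \<in> L2 \<mu> \<Longrightarrow> S \<xi> \<in> L2 \<mu>"
    and S': "\<And>\<xi> \<eta>. \<xi> \<in> L2 \<mu> \<Longrightarrow> \<eta> \<in> L2 \<mu> \<Longrightarrow> cnj (B \<xi> \<eta>) = L2_inner \<mu> \<eta> (S \<xi>)"
    by metis
  have inner_S: "L2_inner \<mu> (S \<xi>) \<eta> = B \<xi> \<eta>" if "\<xi> \<in> L2 \<mu>" "\<eta> \<in> L2 \<mu>" for \<xi> \<eta>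
    by (subst L2_inner_commute) (simp add: S'[OF that, symmetric])
  have "bounded_op \<mu> S"
    unfolding bounded_op_def
  proof (intro conjI ballI allI)
    show "S \<xi> \<in> L2 \<mu>" if "\<xi> \<in> L2 \<mu>" for \<xi>
      by (rule S[OF that])
    show "AE x in \<mu>. S (\<lambda>y. \<xi> y + \<eta> y) x = S \<xi> x + S \<eta> x" if "\<xi> \<in> L2 \<mu>" "\<eta> \<in> L2 \<mu>" for \<xi> \<eta>
      by (rule L2_AE_eqI) (simp_all add: that S L2_add inner_S L2_inner_add_left add_left)
    show "AE x in \<mu>. S (\<lambda>y. c * \<xi> y) x = c * S \<xi> x" if "\<xi> \<in> L2 \<mu>" for c \<xi>
      by (rule L2_AE_eqI) (simp_all add: that S L2_cmult inner_S L2_inner_cmult_left scale_left)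
    \<comment> \<open>The sign of \<open>C\<close> is unknown, and the case of vanishing
      \<open>S \<xi>\<close> needs a nonnegative constant.\<close>
    have "L2_norm \<mu> (S \<xi>) \<le> \<bar>C\<bar> * L2_norm \<mu> \<xi>" if \<xi>: "\<xi> \<in> L2 \<mu>" for \<xi>
    proof (cases "L2_norm \<mu> (S \<xi>) = 0")
      case False
      have "L2_norm \<mu> (S \<xi>) * L2_norm \<mu> (S \<xi>) = cmod (L2_inner \<mu> (S \<xi>) (S \<xi>))"
        by (simp add: L2_inner_self norm_power power2_eq_square norm_mult)
      also have "\<dots> \<le> C * L2_norm \<mu> \<xi> * L2_norm \<mu> (S \<xi>)"
        unfolding inner_S[OF \<xi> S[OF \<xi>]] by (rule bound[OF \<xi> S[OF \<xi>]])
      also have "\<dots> \<le> \<bar>C\<bar> * L2_norm \<mu> \<xi> * L2_norm \<mu> (S \<xi>)"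
        by (intro mult_right_mono) auto
      finally show ?thesis
        using False by (simp add: less_le)
    qed simp
    then show "\<exists>C. \<forall>\<xi>\<in>L2 \<mu>. L2_norm \<mu> (S \<xi>) \<le> C * L2_norm \<mu> \<xi>"
      by blast
  qed
  with inner_S show ?thesis by blast
qed


section \<open>Bounded functionals on the Fourier algebra\<close>

lemma coefficient_fun_add_left:
  assumes inv: "\<And>g \<xi>. \<xi> \<in> L2 \<mu> \<Longrightarrow> left_regular G g \<xi> \<in> L2 \<mu>"
    and "\<xi> \<in> L2 \<mu>" "\<xi>' \<in> L2 \<mu>" "\<eta> \<in> L2 \<mu>"
  shows "coefficient_fun G \<mu> (\<lambda>x. \<xi> x + \<xi>' x) \<eta> =
    (\<lambda>g. coefficient_fun G \<mu> \<xi> \<eta> g + coefficient_fun G \<mu> \<xi>' \<eta> g)"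
  using L2_inner_add_left[OF inv inv] assms(2-)
  by (simp add: coefficient_fun_def left_regular_def)

lemma coefficient_fun_cmult_left:
  "coefficient_fun G \<mu> (\<lambda>x. c * \<xi> x) \<eta> = (\<lambda>g. c * coefficient_fun G \<mu> \<xi> \<eta> g)"
  by (simp add: coefficient_fun_def left_regular_def L2_inner_cmult_left)

lemma coefficient_fun_add_right:
  assumes inv: "\<And>g \<xi>. \<xi> \<in> L2 \<mu> \<Longrightarrow> left_regular G g \<xi> \<in> L2 \<mu>"
    and "\<xi> \<in> L2 \<mu>" "\<eta> \<in> L2 \<mu>" "\<eta>' \<in> L2 \<mu>"
  shows "coefficient_fun G \<mu> \<xi> (\<lambda>x. \<eta> x + \<eta>' x) =
    (\<lambda>g. coefficient_fun G \<mu> \<xi> \<eta> g + coefficient_fun G \<mu> \<xi> \<eta>' g)"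
  using L2_inner_add_right[OF inv] assms(2-) by (simp add: coefficient_fun_def)

lemma coefficient_fun_cmult_right:
  "coefficient_fun G \<mu> \<xi> (\<lambda>x. c * \<eta> x) = (\<lambda>g. cnj c * coefficient_fun G \<mu> \<xi> \<eta> g)"
  by (simp add: coefficient_fun_def L2_inner_cmult_right)

text \<open>
  The operator of the form \<open>(\<xi>, \<eta>) \<mapsto> \<Lambda> \<langle>\<lambda>(\<cdot>) \<xi> | \<eta>\<rangle>\<close> commutes with every \<open>R \<in> \<lambda>(G)'\<close> because
  \<open>\<langle>\<lambda>(\<cdot>) R \<xi> | \<eta>\<rangle>\<close> and \<open>\<langle>\<lambda>(\<cdot>) \<xi> | R\<^sup>* \<eta>\<rangle>\<close> are the same element of \<open>A(G)\<close>.
\<close>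

lemma VN_of_functional:
  fixes G :: "('g, 'z) monoid_scheme" and \<Lambda> :: "('g \<Rightarrow> complex) \<Rightarrow> complex"
  assumes G: "carrier G = UNIV"
    and inv: "\<And>g \<xi>. \<xi> \<in> L2 \<mu> \<Longrightarrow> left_regular G g \<xi> \<in> L2 \<mu>"
    and add: "\<And>u w. u \<in> fourier_algebra G \<mu> \<Longrightarrow> w \<in> fourier_algebra G \<mu> \<Longrightarrow> \<Lambda> (\<lambda>g. u g + w g) = \<Lambda> u + \<Lambda> w"
    and scale: "\<And>c u. u \<in> fourier_algebra G \<mu> \<Longrightarrow> \<Lambda> (\<lambda>g. c * u g) = c * \<Lambda> u"
    and bound: "\<And>\<xi> \<eta>. \<xi> \<in> L2 \<mu> \<Longrightarrow> \<eta> \<in> L2 \<mu> \<Longrightarrow>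
      cmod (\<Lambda> (coefficient_fun G \<mu> \<xi> \<eta>)) \<le> C * L2_norm \<mu> \<xi> * L2_norm \<mu> \<eta>"
  shows "\<exists>S\<in>VN G \<mu>. \<forall>u\<in>fourier_algebra G \<mu>. VN_apply G \<mu> S u = \<Lambda> u"
proof -
  let ?B = "\<lambda>\<xi> \<eta>. \<Lambda> (coefficient_fun G \<mu> \<xi> \<eta>)"
  have FA: "coefficient_fun G \<mu> \<xi> \<eta> \<in> fourier_algebra G \<mu>" if "\<xi> \<in> L2 \<mu>" "\<eta> \<in> L2 \<mu>" for \<xi> \<eta>
    using that by (auto simp: fourier_algebra_def)
  have "\<exists>S. bounded_op \<mu> S \<and> (\<forall>\<xi>\<in>L2 \<mu>. \<forall>\<eta>\<in>L2 \<mu>. L2_inner \<mu> (S \<xi>) \<eta> = ?B \<xi> \<eta>)"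
    by (rule bounded_sesquilinear_form_operator[where C = C])
      (simp_all add: coefficient_fun_add_left[OF inv] coefficient_fun_add_right[OF inv] FA add
        coefficient_fun_cmult_left coefficient_fun_cmult_right scale bound)
  then obtain S where S: "bounded_op \<mu> S"
    and inner_S: "\<And>\<xi> \<eta>. \<xi> \<in> L2 \<mu> \<Longrightarrow> \<eta> \<in> L2 \<mu> \<Longrightarrow> L2_inner \<mu> (S \<xi>) \<eta> = ?B \<xi> \<eta>"
    by blast
  have SL: "S \<xi> \<in> L2 \<mu>" if "\<xi> \<in> L2 \<mu>" for \<xi>
    using S that by (simp add: bounded_op_def)
  have "S \<in> VN G \<mu>"
    unfolding VN_def commutant_def[of \<mu> "commutant _ _"]
  proof (intro CollectI conjI ballI S)
    fix R \<xi> assume R: "R \<in> commutant \<mu> (left_regular G ` carrier G)" and \<xi>: "\<xi> \<in> L2 \<mu>"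
    then have Rb: "bounded_op \<mu> R"
      and Rc: "\<And>g \<xi>. \<xi> \<in> L2 \<mu> \<Longrightarrow> AE x in \<mu>. R (left_regular G g \<xi>) x = left_regular G g (R \<xi>) x"
      by (auto simp: commutant_def G)
    then have RL: "R \<xi> \<in> L2 \<mu>" if "\<xi> \<in> L2 \<mu>" for \<xi>
      using that by (simp add: bounded_op_def)
    show "AE x in \<mu>. S (R \<xi>) x = R (S \<xi>) x"
    proof (rule L2_AE_eqI)
      fix \<eta> assume \<eta>: "\<eta> \<in> L2 \<mu>"
      obtain \<zeta> where \<zeta>: "\<zeta> \<in> L2 \<mu>" and adj: "\<And>\<xi>. \<xi> \<in> L2 \<mu> \<Longrightarrow> L2_inner \<mu> (R \<xi>) \<eta> = L2_inner \<mu> \<xi> \<zeta>"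
        using bounded_op_adjoint[OF Rb \<eta>] by blast
      have "coefficient_fun G \<mu> (R \<xi>) \<eta> g = coefficient_fun G \<mu> \<xi> \<zeta> g" for g
      proof -
        have "L2_inner \<mu> (left_regular G g (R \<xi>)) \<eta> = L2_inner \<mu> (R (left_regular G g \<xi>)) \<eta>"
        proof (rule L2_inner_cong_AE)
          show "AE x in \<mu>. left_regular G g (R \<xi>) x = R (left_regular G g \<xi>) x"
            using Rc[OF \<xi>, of g] by eventually_elim simp
        qed (intro L2_measurable inv RL \<xi> \<eta>)+
        then show ?thesis
          by (simp add: coefficient_fun_def adj inv \<xi>)
      qed
      then have "coefficient_fun G \<mu> (R \<xi>) \<eta> = coefficient_fun G \<mu> \<xi> \<zeta>"
        by (rule ext)
      then show "L2_inner \<mu> (S (R \<xi>)) \<eta> = L2_inner \<mu> (R (S \<xi>)) \<eta>"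
        by (simp add: inner_S RL \<xi> \<eta> \<zeta> adj SL)
    qed (simp_all add: SL RL \<xi>)
  qed
  moreover have "VN_apply G \<mu> S u = \<Lambda> u" if "u \<in> fourier_algebra G \<mu>" for u
    unfolding VN_apply_def
  proof (rule the_equality)
    show "\<exists>\<xi>\<in>L2 \<mu>. \<exists>\<eta>\<in>L2 \<mu>. u = coefficient_fun G \<mu> \<xi> \<eta> \<and> \<Lambda> u = L2_inner \<mu> (S \<xi>) \<eta>"
      using that by (auto simp: fourier_algebra_def inner_S)
  qed (auto simp: inner_S)
  ultimately show ?thesis by blast
qed

section \<open>The Haar measure of \<open>F \<times> F\<close>\<close>

lemma borel_measurable_fst_snd [measurable]:
  "fst \<in> borel_measurable (borel :: ('a::second_countable_topology \<times> 'b::second_countable_topology) measure)"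
  "snd \<in> borel_measurable (borel :: ('a::second_countable_topology \<times> 'b::second_countable_topology) measure)"
  by (auto intro!: borel_measurable_continuous_onI continuous_intros)

lemma nn_integral_lborel_prod:
  fixes f :: "'a::euclidean_space \<times> 'b::euclidean_space \<Rightarrow> ennreal"
  assumes [measurable]: "f \<in> borel_measurable borel"
  shows "(\<integral>\<^sup>+z. f z \<partial>lborel) = (\<integral>\<^sup>+x. \<integral>\<^sup>+y. f (x, y) \<partial>lborel \<partial>lborel)"
proof -
  have "f \<in> borel_measurable (lborel \<Otimes>\<^sub>M lborel)"
    unfolding lborel_prod by simp
  from lborel.nn_integral_fst[OF this] show ?thesis
    unfolding lborel_prod by simp
qed

lemma nn_integral_lborel_swap:
  fixes f :: "'a::euclidean_space \<Rightarrow> 'b::euclidean_space \<Rightarrow> ennreal"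
  assumes "(\<lambda>z. f (fst z) (snd z)) \<in> borel_measurable borel"
  shows "(\<integral>\<^sup>+x. \<integral>\<^sup>+y. f x y \<partial>lborel \<partial>lborel) = (\<integral>\<^sup>+y. \<integral>\<^sup>+x. f x y \<partial>lborel \<partial>lborel)"
proof -
  have "case_prod f \<in> borel_measurable (lborel \<Otimes>\<^sub>M lborel)"
    unfolding lborel_prod using assms by (simp add: case_prod_beta')
  from lborel_pair.Fubini'[OF this] show ?thesis ..
qed

lemma sets_aff_haar [measurable_cong, simp]: "sets aff_haar = sets borel"
  by (simp add: aff_haar_def lborel_prod del: space_borel)

lemma sets_aff2_haar [measurable_cong, simp]: "sets aff2_haar = sets borel"
  using sets_pair_measure_cong[OF sets_aff_haar sets_aff_haar] by (simp only: borel_prod)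

lemma aff_haar_eq: "aff_haar = density lborel (\<lambda>g. ennreal (exp (- snd g)))"
  by (simp add: aff_haar_def lborel_prod case_prod_beta')

lemma sigma_finite_aff_haar: "sigma_finite_measure aff_haar"
  unfolding aff_haar_eq
  by (subst sigma_finite_measure.sigma_finite_iff_density_finite[OF lborel.sigma_finite_measure_axioms]) auto

interpretation aff_haar: sigma_finite_measure aff_haar
  by (rule sigma_finite_aff_haar)

interpretation aff2_haar: sigma_finite_measure aff2_haar
proof -
  interpret pair_sigma_finite aff_haar aff_haar ..
  show "sigma_finite_measure aff2_haar" ..
qed

lemma nn_integral_aff2_haar_iterated:
  assumes [measurable]: "f \<in> borel_measurable borel"
  shows "(\<integral>\<^sup>+z. f z \<partial>aff2_haar) = (\<integral>\<^sup>+g. \<integral>\<^sup>+h. f (g, h) \<partial>aff_haar \<partial>aff_haar)"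
proof -
  have "f \<in> borel_measurable aff2_haar"
    by (simp add: measurable_cong_sets[OF sets_aff2_haar refl])
  from aff_haar.nn_integral_fst[OF this] show ?thesis ..
qed

lemma L2_aff2_measurable: "\<xi> \<in> L2 aff2_haar \<Longrightarrow> \<xi> \<in> borel_measurable borel"
  using L2_measurable[of \<xi> aff2_haar] by (simp only: measurable_cong_sets[OF sets_aff2_haar refl])

text \<open>
  The coordinates \<open>((b, a), (c, d))\<close> of \<open>F \<times> F\<close> are regrouped as \<open>((a, d), (b, c))\<close>: the Fourier
  transform will act on \<open>(b, c)\<close> only.
\<close>

type_synonym real4 = "(real \<times> real) \<times> (real \<times> real)"

definition regroup :: "real4 \<Rightarrow> real4" where
  "regroup z = ((fst (snd z), fst (fst z)), (snd (snd z), snd (fst z)))"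

definition haar_weight :: "real \<times> real \<Rightarrow> real" where
  "haar_weight A = exp (- (fst A + snd A))"

lemma haar_weight_pos [simp]: "0 < haar_weight A" "0 \<le> haar_weight A"
  by (simp_all add: haar_weight_def)

lemma borel_measurable_haar_weight [measurable]: "haar_weight \<in> borel_measurable borel"
  unfolding haar_weight_def by measurable

lemma borel_measurable_regroup [measurable]: "regroup \<in> borel_measurable borel"
  unfolding regroup_def by measurable

lemma nn_integral_aff2_haar:
  assumes [measurable]: "f \<in> borel_measurable borel"
  shows "(\<integral>\<^sup>+z. f z \<partial>aff2_haar) = (\<integral>\<^sup>+z. ennreal (haar_weight (fst z)) * f (regroup z) \<partial>lborel)"
proof -
  have "(\<integral>\<^sup>+z. f z \<partial>aff2_haar) = (\<integral>\<^sup>+g. \<integral>\<^sup>+h. f (g, h) \<partial>aff_haar \<partial>aff_haar)"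
    by (rule nn_integral_aff2_haar_iterated) simp
  also have "\<dots> = (\<integral>\<^sup>+a. \<integral>\<^sup>+b. \<integral>\<^sup>+d. \<integral>\<^sup>+c.
      ennreal (exp (- a)) * (ennreal (exp (- d)) * f ((b, a), (c, d))) \<partial>lborel \<partial>lborel \<partial>lborel \<partial>lborel)"
    by (subst nn_integral_aff_haar)
      (simp_all add: nn_integral_aff_haar nn_integral_cmult)
  also have "\<dots> = (\<integral>\<^sup>+a. \<integral>\<^sup>+d. \<integral>\<^sup>+b. \<integral>\<^sup>+c.
      ennreal (exp (- a)) * (ennreal (exp (- d)) * f ((b, a), (c, d))) \<partial>lborel \<partial>lborel \<partial>lborel \<partial>lborel)"
    by (intro nn_integral_cong nn_integral_lborel_swap) measurable
  also have "\<dots> = (\<integral>\<^sup>+z. ennreal (haar_weight (fst z)) * f (regroup z) \<partial>lborel)"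
    by (simp add: nn_integral_lborel_prod haar_weight_def regroup_def mult.assoc[symmetric]
        ennreal_mult[symmetric] exp_add[symmetric] add.commute)
  finally show ?thesis .
qed

text \<open>As an equality of measures this transports Bochner integrals as well as nonnegative
  ones.\<close>

lemma aff2_haar_eq_distr:
  "aff2_haar = distr (density lborel (\<lambda>z. ennreal (haar_weight (fst z)))) borel regroup"
proof (rule measure_eqI)
  fix X assume X: "X \<in> sets aff2_haar"
  then have [measurable]: "X \<in> sets borel"
    unfolding sets_aff2_haar .
  have "emeasure aff2_haar X = (\<integral>\<^sup>+z. indicator X z \<partial>aff2_haar)"
    by (rule nn_integral_indicator[OF X, symmetric])
  also have "\<dots> = (\<integral>\<^sup>+z. indicator X z \<partial>distr (density lborel (\<lambda>z. ennreal (haar_weight (fst z)))) borel regroup)"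
    by (simp add: nn_integral_aff2_haar nn_integral_distr nn_integral_density del: nn_integral_indicator)
  finally show "emeasure aff2_haar X =
      emeasure (distr (density lborel (\<lambda>z. ennreal (haar_weight (fst z)))) borel regroup) X"
    by simp
qed (unfold sets_aff2_haar, simp)

lemma integral_aff2_haar:
  fixes f :: "_ \<Rightarrow> complex"
  assumes [measurable]: "f \<in> borel_measurable borel"
  shows "(LINT z|aff2_haar. f z) = (LINT z|lborel. of_real (haar_weight (fst z)) * f (regroup z))"
  unfolding aff2_haar_eq_distr
  by (simp add: integral_distr integral_density scaleR_conv_of_real)

lemma inv_aff2: "inv\<^bsub>aff2\<^esub> (g, h) = (inv\<^bsub>aff\<^esub> g, inv\<^bsub>aff\<^esub> h)"
  by (rule inv_DirProd[OF group_aff group_aff]) (simp_all add: aff_def)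

lemma carrier_aff2: "carrier aff2 = UNIV"
  by (simp add: aff_def)

lemma left_regular_aff2:
  "left_regular aff2 g \<xi> h =
    \<xi> ((exp (- snd (fst g)) * (fst (fst h) - fst (fst g)), snd (fst h) - snd (fst g)),
       (exp (- snd (snd g)) * (fst (snd h) - fst (snd g)), snd (snd h) - snd (snd g)))"
proof -
  have inv: "inv\<^bsub>aff\<^esub> x = (- exp (- snd x) * fst x, - snd x)" for x
    using inv_aff[of "fst x" "snd x"] by simp
  have mult: "x \<otimes>\<^bsub>aff\<^esub> y = (fst x + exp (snd x) * fst y, snd x + snd y)" for x y
    by (simp add: aff_def case_prod_beta')
  show ?thesis
    by (cases g; cases h) (simp add: left_regular_def inv_aff2 inv mult algebra_simps)
qed

lemma aff2_haar_left_invariant: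
  assumes [measurable]: "f \<in> borel_measurable borel"
  shows "(\<integral>\<^sup>+z. f (g \<otimes>\<^bsub>aff2\<^esub> z) \<partial>aff2_haar) = (\<integral>\<^sup>+z. f z \<partial>aff2_haar)"
proof -
  have [measurable]: "(\<lambda>z. x \<otimes>\<^bsub>aff\<^esub> z) \<in> borel_measurable borel" for x
    by (cases x) (simp add: aff_def case_prod_beta')
  have eq: "g \<otimes>\<^bsub>aff2\<^esub> z = (fst g \<otimes>\<^bsub>aff\<^esub> fst z, snd g \<otimes>\<^bsub>aff\<^esub> snd z)" for z
    by (cases g; cases z) simp
  have "(\<integral>\<^sup>+z. f (g \<otimes>\<^bsub>aff2\<^esub> z) \<partial>aff2_haar) =
      (\<integral>\<^sup>+x. \<integral>\<^sup>+y. f (fst g \<otimes>\<^bsub>aff\<^esub> x, snd g \<otimes>\<^bsub>aff\<^esub> y) \<partial>aff_haar \<partial>aff_haar)"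
    unfolding eq by (subst nn_integral_aff2_haar_iterated) simp_all
  also have "\<dots> = (\<integral>\<^sup>+x. \<integral>\<^sup>+y. f (x, y) \<partial>aff_haar \<partial>aff_haar)"
    by (subst aff_haar_left_invariant[of "\<lambda>y. f (_, y)"], measurable)
      (rule aff_haar_left_invariant[of "\<lambda>x. \<integral>\<^sup>+y. f (x, y) \<partial>aff_haar"], measurable)
  also have "\<dots> = (\<integral>\<^sup>+z. f z \<partial>aff2_haar)"
    by (subst nn_integral_aff2_haar_iterated) simp_all
  finally show ?thesis .
qed

lemma left_regular_aff2_L2:
  assumes "\<xi> \<in> L2 aff2_haar"
  shows "left_regular aff2 g \<xi> \<in> L2 aff2_haar" "L2_norm aff2_haar (left_regular aff2 g \<xi>) = L2_norm aff2_haar \<xi>"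
proof -
  have [measurable]: "\<xi> \<in> borel_measurable borel"
    using assms by (rule L2_aff2_measurable)
  have [measurable]: "left_regular aff2 g \<xi> \<in> borel_measurable borel"
    unfolding left_regular_aff2 by measurable
  have *: "(\<integral>\<^sup>+z. ennreal ((cmod (left_regular aff2 g \<xi> z))\<^sup>2) \<partial>aff2_haar) = ennreal ((L2_norm aff2_haar \<xi>)\<^sup>2)"
    unfolding left_regular_def L2_nn_integral[OF assms, symmetric]
    by (rule aff2_haar_left_invariant) measurable
  show L: "left_regular aff2 g \<xi> \<in> L2 aff2_haar"
    by (rule L2I[OF _ eq_refl[OF *]]) measurable
  show "L2_norm aff2_haar (left_regular aff2 g \<xi>) = L2_norm aff2_haar \<xi>"
    using * unfolding L2_nn_integral[OF L] by simp
qed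

lemma cmod_coefficient_fun_aff2_le:
  assumes "\<xi> \<in> L2 aff2_haar" "\<eta> \<in> L2 aff2_haar"
  shows "cmod (coefficient_fun aff2 aff2_haar \<xi> \<eta> g) \<le> L2_norm aff2_haar \<xi> * L2_norm aff2_haar \<eta>"
  unfolding coefficient_fun_def
  using L2_Cauchy_Schwarz[OF left_regular_aff2_L2(1)[OF assms(1)] assms(2)]
  by (simp add: left_regular_aff2_L2 assms)

lemma borel_measurable_coefficient_fun_aff2:
  assumes "\<xi> \<in> L2 aff2_haar" "\<eta> \<in> L2 aff2_haar"
  shows "coefficient_fun aff2 aff2_haar \<xi> \<eta> \<in> borel_measurable borel"
proof -
  have [measurable]: "\<xi> \<in> borel_measurable borel" "\<eta> \<in> borel_measurable borel"
    using assms by (simp_all add: L2_aff2_measurable)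
  have "(\<lambda>g. LINT z|aff2_haar. left_regular aff2 g \<xi> z * cnj (\<eta> z)) \<in> borel_measurable borel"
    unfolding left_regular_aff2 by measurable
  then show ?thesis
    by (simp add: coefficient_fun_def L2_inner_def[abs_def])
qed

section \<open>Test functions belong to the Fourier algebra\<close>

lemma Ck_add: "Ck k u \<Longrightarrow> Ck k w \<Longrightarrow> Ck k (\<lambda>x. u x + w x)"
proof (induction k arbitrary: u w)
  case 0
  then show ?case by (simp add: continuous_on_add)
next
  case (Suc k)
  have "frechet_derivative (\<lambda>x. u x + w x) (at x) =
      (\<lambda>h. frechet_derivative u (at x) h + frechet_derivative w (at x) h)" for x
    using Suc.prems by (intro frechet_derivative_at[symmetric] has_derivative_add)
      (simp_all add: frechet_derivative_works[symmetric])
  then show ?case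
    using Suc by (auto intro!: differentiable_add)
qed

locale smooth_function =
  fixes u :: "'a::euclidean_space \<Rightarrow> complex"
  assumes Ck: "Ck k u"
begin

abbreviation dd :: "'a \<Rightarrow> 'a \<Rightarrow> complex" where
  "dd w \<equiv> (\<lambda>x. frechet_derivative u (at x) w)"

lemma cont: "continuous_on UNIV u"
  using Ck[of 0] by simp

lemma deriv: "(u has_derivative frechet_derivative u (at x)) (at x)"
  using Ck[of 1] by (simp add: frechet_derivative_works[symmetric])

lemma smooth_dd: "smooth_function (dd w)"
proof
  show "Ck k (dd w)" for k
    using Ck[of "Suc k"] by simp
qed

lemma linear_deriv: "linear (frechet_derivative u (at x))"
  using deriv by (rule has_derivative_linear)

lemma has_vector_derivative_curve:
  assumes "(\<gamma> has_vector_derivative v) (at t)"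
  shows "((\<lambda>t. u (\<gamma> t)) has_vector_derivative dd v (\<gamma> t)) (at t)"
proof -
  have "((u \<circ> \<gamma>) has_derivative (frechet_derivative u (at (\<gamma> t)) \<circ> (\<lambda>h. h *\<^sub>R v))) (at t)"
    using assms deriv unfolding has_vector_derivative_def by (intro diff_chain_at)
  then show ?thesis
    unfolding has_vector_derivative_def
    by (simp add: o_def linear_scale[OF linear_deriv])
qed

lemma dd_eq_0:
  assumes "closed K" "\<And>x. x \<notin> K \<Longrightarrow> u x = 0" "x \<notin> K"
  shows "dd w x = 0"
proof -
  have "(u has_derivative (\<lambda>h. 0)) (at x)"
    using has_derivative_const
  proof (rule has_derivative_transform_within_open)
    show "open (- K)" "x \<in> - K"
      using assms by auto
  qed (use assms(2) in auto)
  then have "frechet_derivative u (at x) = (\<lambda>h. 0)"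
    by (rule frechet_derivative_at[symmetric])
  then show ?thesis by simp
qed

end

lemma test_functionsD:
  assumes "u \<in> test_functions"
  shows "smooth_function u" "\<exists>K. compact K \<and> (\<forall>x. x \<notin> K \<longrightarrow> u x = 0)"
proof -
  show "smooth_function u"
    using assms by (simp add: test_functions_def smooth_function_def)
  show "\<exists>K. compact K \<and> (\<forall>x. x \<notin> K \<longrightarrow> u x = 0)"
    using assms closure_subset[of "{x. u x \<noteq> 0}"]
    by (intro exI[of _ "closure {x. u x \<noteq> 0}"]) (auto simp: test_functions_def compactly_supported_def)
qed

lemma bounded_if_compact_support:
  fixes w :: "'a::euclidean_space \<Rightarrow> complex"
  assumes "continuous_on UNIV w" "compact K" "\<And>x. x \<notin> K \<Longrightarrow> w x = 0"
  obtains M where "0 \<le> M" "\<And>x. cmod (w x) \<le> M"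
proof -
  have "bounded (w ` K)"
    using assms by (intro compact_imp_bounded compact_continuous_image) (auto intro: continuous_on_subset)
  then obtain M where M: "\<And>x. x \<in> K \<Longrightarrow> cmod (w x) \<le> M"
    by (auto simp: bounded_iff)
  then have "cmod (w x) \<le> max M 0" for x
    by (cases "x \<in> K") (auto simp: assms(3) le_max_iff_disj)
  then show ?thesis
    using that[of "max M 0"] by auto
qed

lemma abs_coordinate_le_norm:
  fixes z :: "real4"
  shows "\<bar>fst (fst z)\<bar> \<le> norm z" "\<bar>snd (fst z)\<bar> \<le> norm z" "\<bar>fst (snd z)\<bar> \<le> norm z" "\<bar>snd (snd z)\<bar> \<le> norm z"
proof -
  have "\<bar>fst x\<bar> \<le> norm x" "\<bar>snd x\<bar> \<le> norm x" for x :: "real \<times> real"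
    using norm_fst_le[of "fst x" "snd x"] norm_snd_le[of "snd x" "fst x"] by simp_all
  then show "\<bar>fst (fst z)\<bar> \<le> norm z" "\<bar>snd (fst z)\<bar> \<le> norm z" "\<bar>fst (snd z)\<bar> \<le> norm z" "\<bar>snd (snd z)\<bar> \<le> norm z"
    using norm_fst_le[of "fst z" "snd z"] norm_snd_le[of "snd z" "fst z"]
    unfolding prod.collapse by (meson order_trans)+
qed

text \<open>On the ball of radius \<open>r\<close> both \<open>a\<close>-coordinates are at least
  \<open>- r\<close>, which caps the Haar weight at exp (2 r).\<close>

lemma L2_aff2_bounded_support:
  assumes [measurable]: "\<xi> \<in> borel_measurable borel"
    and M: "\<And>x. cmod (\<xi> x) \<le> M" and r: "\<And>x. norm x > r \<Longrightarrow> \<xi> x = 0"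
  shows "\<xi> \<in> L2 aff2_haar"
proof (rule L2I)
  let ?C = "cball 0 :: real \<Rightarrow> real4 set"
  show "\<xi> \<in> borel_measurable aff2_haar"
    using assms(1) unfolding measurable_cong_sets[OF sets_aff2_haar refl] .
  have norm: "norm (regroup z) = norm z" for z
    by (simp add: regroup_def norm_prod_def)
  have le: "ennreal (haar_weight (fst z)) * ennreal ((cmod (\<xi> (regroup z)))\<^sup>2) \<le>
      ennreal (exp (2 * r) * M\<^sup>2) * indicator (?C r) z" for z
  proof (cases "norm z \<le> r")
    case True
    have "\<bar>fst (fst z)\<bar> \<le> r" "\<bar>snd (fst z)\<bar> \<le> r"
      using abs_coordinate_le_norm[of z] True by linarith+
    then have "haar_weight (fst z) * (cmod (\<xi> (regroup z)))\<^sup>2 \<le> exp (2 * r) * M\<^sup>2"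
      using M by (intro mult_mono power_mono) (auto simp: haar_weight_def)
    then show ?thesis
      using True by (simp add: ennreal_mult[symmetric] ennreal_leI)
  next
    case False
    then show ?thesis
      by (simp add: r norm)
  qed
  have "(\<integral>\<^sup>+z. ennreal ((cmod (\<xi> z))\<^sup>2) \<partial>aff2_haar) =
      (\<integral>\<^sup>+z. ennreal (haar_weight (fst z)) * ennreal ((cmod (\<xi> (regroup z)))\<^sup>2) \<partial>lborel)"
    by (rule nn_integral_aff2_haar) measurable
  also have "\<dots> \<le> (\<integral>\<^sup>+z. ennreal (exp (2 * r) * M\<^sup>2) * indicator (?C r) z \<partial>lborel)"
    by (intro nn_integral_mono le)
  also have "\<dots> = ennreal (exp (2 * r) * M\<^sup>2) * emeasure lborel (?C r)"
    by (simp add: nn_integral_cmult_indicator)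
  also have "\<dots> = ennreal (exp (2 * r) * M\<^sup>2) * ennreal (measure lborel (?C r))"
    using emeasure_compact_finite[OF compact_cball, of "0 :: real4" r]
    by (subst emeasure_eq_ennreal_measure) auto
  also have "\<dots> = ennreal (exp (2 * r) * M\<^sup>2 * measure lborel (?C r))"
    by (simp add: ennreal_mult)
  finally show "(\<integral>\<^sup>+z. ennreal ((cmod (\<xi> z))\<^sup>2) \<partial>aff2_haar) \<le>
      ennreal (exp (2 * r) * M\<^sup>2 * measure lborel (?C r))" .
qed

section \<open>One-sided exponential kernels and their reproducing formula\<close>

definition exp_density :: "real \<Rightarrow> real" where
  "exp_density t = (if t > 0 then exp (- t) else 0)"

lemma borel_measurable_exp_density [measurable]: "exp_density \<in> borel_measurable borel"
  unfolding exp_density_def by measurable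

lemma exp_density_nonneg [simp]: "0 \<le> exp_density t"
  by (simp add: exp_density_def)

lemma nn_integral_exp_density: "(\<integral>\<^sup>+t. ennreal (exp_density t) \<partial>lborel) = 1"
proof -
  have "(\<integral>\<^sup>+t. ennreal (exp_density t) \<partial>lborel) = (\<integral>\<^sup>+t. ennreal (exponential_density 1 t) \<partial>lborel)"
  proof (intro nn_integral_cong_AE)
    \<comment> \<open>The two densities differ only at 0.\<close>
    show "AE t in lborel. ennreal (exp_density t) = ennreal (exponential_density 1 t)"
      using AE_lborel_singleton[of 0]
      by eventually_elim (simp add: exp_density_def exponential_density_def)
  qed
  also have "\<dots> = emeasure (density lborel (exponential_density 1)) UNIV"
    by (simp add: emeasure_density)
  also have "\<dots> = 1"
    using prob_space.emeasure_space_1[OF prob_space_exponential_density[of 1]] by simp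
  finally show ?thesis .
qed

lemma integrable_exp_density: "integrable lborel exp_density"
  by (rule integrableI_bounded) (simp_all add: nn_integral_exp_density)

text \<open>\<open>exp_density\<close> is the fundamental solution of 1 + d/dt: the integrand is the
  derivative of - exp (-t) \<phi> (-t) on the positive half-line, and only the boundary term at 0
  survives because \<phi> vanishes far to the left.\<close>

lemma exp_density_integral:
  fixes \<phi> :: "real \<Rightarrow> complex"
  assumes der: "\<And>t. (\<phi> has_vector_derivative \<phi>' t) (at t)" and cont: "continuous_on UNIV \<phi>'"
    and zero: "\<And>t. t < - M \<Longrightarrow> \<phi> t = 0" "\<And>t. t < - M \<Longrightarrow> \<phi>' t = 0" and M: "0 \<le> M"
  shows "(LINT t|lborel. of_real (exp_density t) * (\<phi> (- t) + \<phi>' (- t))) = \<phi> 0"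
proof -
  \<comment> \<open>One unit beyond \<open>M\<close>, because the vanishing of \<phi> is assumed
    only strictly below \<open>- M\<close>.\<close>
  let ?M = "M + 1"
  define f where "f t = of_real (exp (- t)) * (\<phi> (- t) + \<phi>' (- t))" for t
  define F where "F t = - (of_real (exp (- t)) * \<phi> (- t))" for t
  have cont\<phi>: "continuous_on UNIV \<phi>"
    using der by (meson continuous_at_imp_continuous_on has_vector_derivative_continuous)
  have contm: "continuous_on S (\<lambda>t. h (- t))" if "continuous_on UNIV h" for S :: "real set" and h :: "real \<Rightarrow> complex"
    by (rule continuous_on_compose2[OF that]) (auto intro!: continuous_intros)
  have "(\<integral>t. indicator {0..?M} t *\<^sub>R f t \<partial>lborel) = F ?M - F 0"
  proof (rule integral_FTC_Icc)
    have "((\<lambda>t. \<phi> (- t)) has_vector_derivative - \<phi>' (- t)) (at t)" for t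
      using vector_diff_chain_at[of uminus "- 1" t \<phi> "\<phi>' (- t)"] der[of "- t"]
      by (simp add: o_def has_vector_derivative_minus[of "\<lambda>t. t" 1, simplified])
    then have "(F has_vector_derivative f t) (at t)" for t
      unfolding F_def f_def
      by (auto intro!: derivative_eq_intros simp: algebra_simps)
    then show "(F has_vector_derivative f t) (at t within {0..?M})" for t
      by (rule has_vector_derivative_at_within)
    show "continuous_on {0..?M} f"
      unfolding f_def by (intro continuous_intros contm cont cont\<phi>)
  qed (use M in auto)
  also have "\<dots> = \<phi> 0"
    using zero M by (simp add: F_def)
  also have "(\<integral>t. indicator {0..?M} t *\<^sub>R f t \<partial>lborel) =
      (LINT t|lborel. of_real (exp_density t) * (\<phi> (- t) + \<phi>' (- t)))"
  proof (rule integral_cong_AE)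
    have [measurable]: "(\<lambda>t. \<phi> (- t)) \<in> borel_measurable borel" "(\<lambda>t. \<phi>' (- t)) \<in> borel_measurable borel"
      by (intro borel_measurable_continuous_onI contm cont cont\<phi>)+
    show "(\<lambda>t. indicator {0..?M} t *\<^sub>R f t) \<in> borel_measurable lborel"
      unfolding f_def by measurable
    show "(\<lambda>t. of_real (exp_density t) * (\<phi> (- t) + \<phi>' (- t))) \<in> borel_measurable lborel"
      by measurable
    show "AE t in lborel. indicator {0..?M} t *\<^sub>R f t = of_real (exp_density t) * (\<phi> (- t) + \<phi>' (- t))"
      using AE_lborel_singleton[of 0]
      by eventually_elim (auto simp: f_def exp_density_def indicator_def zero)
  qed
  finally show ?thesis .
qed

lemma integral_lborel_prod:
  fixes f :: "'a::euclidean_space \<times> 'b::euclidean_space \<Rightarrow> complex"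
  assumes "integrable lborel f"
  shows "(LINT z|lborel. f z) = (LINT x|lborel. LINT y|lborel. f (x, y))"
    and "(LINT z|lborel. f z) = (LINT y|lborel. LINT x|lborel. f (x, y))"
proof -
  have *: "integrable (lborel \<Otimes>\<^sub>M lborel) (\<lambda>(x, y). f (x, y))"
    using assms by (simp add: lborel_prod)
  from lborel_pair.integral_fst[OF *] lborel_pair.integral_snd[OF *]
  show "(LINT z|lborel. f z) = (LINT x|lborel. LINT y|lborel. f (x, y))"
    "(LINT z|lborel. f z) = (LINT y|lborel. LINT x|lborel. f (x, y))"
    by (simp_all add: lborel_prod)
qed

lemma integrable_lborel_prod_mult:
  fixes f :: "'a::euclidean_space \<Rightarrow> complex" and g :: "'b::euclidean_space \<Rightarrow> complex"
  assumes f: "integrable lborel f" and g: "integrable lborel g"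
  shows "integrable lborel (\<lambda>z. f (fst z) * g (snd z))"
proof (rule integrableI_bounded)
  have [measurable]: "f \<in> borel_measurable borel" "g \<in> borel_measurable borel"
    using assms by (auto dest: borel_measurable_integrable)
  show "(\<lambda>z. f (fst z) * g (snd z)) \<in> borel_measurable lborel"
    by measurable
  have "(\<integral>\<^sup>+z. ennreal (norm (f (fst z) * g (snd z))) \<partial>lborel) =
      (\<integral>\<^sup>+x. ennreal (norm (f x)) \<partial>lborel) * (\<integral>\<^sup>+y. ennreal (norm (g y)) \<partial>lborel)"
    by (simp add: nn_integral_lborel_prod norm_mult ennreal_mult nn_integral_cmult nn_integral_multc)
  also have "\<dots> < \<infinity>"
    using f g unfolding integrable_iff_bounded by (simp add: ennreal_mult_less_top)
  finally show "(\<integral>\<^sup>+z. ennreal (norm (f (fst z) * g (snd z))) \<partial>lborel) < \<infinity>" .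
qed

lemma integrable_mult_bounded:
  fixes f g :: "'a \<Rightarrow> complex"
  assumes f: "integrable M f" and [measurable]: "g \<in> borel_measurable M" and B: "\<And>x. cmod (g x) \<le> B"
  shows "integrable M (\<lambda>x. f x * g x)"
proof (rule Bochner_Integration.integrable_bound)
  have [measurable]: "f \<in> borel_measurable M"
    using f by (rule borel_measurable_integrable)
  show "integrable M (\<lambda>x. B * norm (f x))"
    using f by (intro integrable_mult_right integrable_norm)
  have "B \<ge> 0"
    using B[of undefined] norm_ge_zero order_trans by blast
  then show "AE x in M. norm (f x * g x) \<le> norm (B * norm (f x))"
    using B by (intro AE_I2) (simp add: norm_mult mult.commute[of B] mult_left_mono)
  show "(\<lambda>x. f x * g x) \<in> borel_measurable M"
    by measurable
qed

definition exp_density2 :: "real \<times> real \<Rightarrow> complex" where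
  "exp_density2 x = of_real (exp_density (fst x)) * of_real (exp_density (snd x))"

lemma integrable_exp_density2: "integrable lborel exp_density2"
  unfolding exp_density2_def
  by (intro integrable_lborel_prod_mult integrable_exp_density integrable_of_real)

lemma integral_exp_density2:
  fixes w :: "real \<times> real \<Rightarrow> complex"
  assumes "w \<in> borel_measurable borel" "\<And>x. cmod (w x) \<le> B"
  shows "(LINT x|lborel. exp_density2 x * w x) =
    (LINT s|lborel. of_real (exp_density s) * (LINT t|lborel. of_real (exp_density t) * w (s, t)))"
  using integral_lborel_prod(1)[OF integrable_mult_bounded[OF integrable_exp_density2 _ assms(2)]] assms(1)
  by (simp add: exp_density2_def mult.assoc)

lemma smooth_function_add_dd:
  assumes "smooth_function u"
  shows "smooth_function (\<lambda>x. u x + frechet_derivative u (at x) w)"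
proof -
  interpret smooth_function u by fact
  interpret d: smooth_function "dd w" by (rule smooth_dd)
  show ?thesis
    by unfold_locales (intro Ck_add Ck d.Ck)
qed

text \<open>The hypothesis \<open>far\<close> makes the curve leave the compact set for very
  negative \<open>t\<close>, which reduces the claim to the formula on the line. In every use some
  coordinate of the curve is a plain translation by \<open>t\<close>, so \<open>far\<close>
  holds.\<close>

lemma kernel_reproduces_along_curve:
  fixes f h :: "'a::euclidean_space \<Rightarrow> complex" and \<gamma> :: "real \<Rightarrow> 'a"
  assumes "compact K"
    and f: "\<And>t. ((\<lambda>t. f (\<gamma> t)) has_vector_derivative h (\<gamma> t)) (at t)"
    and cont: "continuous_on UNIV h" "continuous_on UNIV \<gamma>"
    and zero: "\<And>x. x \<notin> K \<Longrightarrow> f x = 0" "\<And>x. x \<notin> K \<Longrightarrow> h x = 0"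
    and far: "\<And>t. \<bar>t\<bar> \<le> c + norm (\<gamma> t)"
  shows "(LINT t|lborel. of_real (exp_density t) * (f (\<gamma> (- t)) + h (\<gamma> (- t)))) = f (\<gamma> 0)"
proof -
  obtain r where r: "\<And>x. x \<in> K \<Longrightarrow> norm x \<le> r"
    using compact_imp_bounded[OF assms(1)] by (auto simp: bounded_iff)
  have out: "\<gamma> t \<notin> K" if "t < - \<bar>c + r\<bar>" for t
    using far[of t] r[of "\<gamma> t"] that by fastforce
  show ?thesis
  proof (rule exp_density_integral[where \<phi>' = "\<lambda>t. h (\<gamma> t)" and M = "\<bar>c + r\<bar>"])
    show "continuous_on UNIV (\<lambda>t. h (\<gamma> t))"
      by (rule continuous_on_compose2[OF cont]) simp
  qed (use f out zero in auto)
qed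

text \<open>
  On each factor \<open>exp_density(t) dt\<close>, pushed to a one-parameter subgroup \<open>exp (t X)\<close>, is a
  fundamental solution of \<open>1 + X\<close> acting by left translations. The convolution of the four of them
  has an \<open>L\<^sup>2\<close> density, and \<open>w\<close> arises from \<open>u\<close> by applying the four operators \<open>1 + X\<close>.
\<close>

lemma test_functions_reproduced:
  assumes u: "u \<in> test_functions"
  obtains w K where "continuous_on UNIV w" "compact K" "\<And>x. x \<notin> K \<Longrightarrow> w x = 0"
    "\<And>b a c d. u ((b, a), (c, d)) = (LINT x|lborel. exp_density2 x *
      (LINT A|lborel. exp_density2 A *
        w ((exp (- fst A) * (b - fst x), a - fst A), (exp (- snd A) * (c - snd x), d - snd A))))"
proof -
  obtain K where K: "compact K" and u0: "\<And>x. x \<notin> K \<Longrightarrow> u x = 0"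
    using test_functionsD(2)[OF u] by blast
  note Kc = compact_imp_closed[OF K]
  define eb :: "real4" where "eb = ((1, 0), (0, 0))"
  define ea :: "real4" where "ea = ((0, 1), (0, 0))"
  define ec :: "real4" where "ec = ((0, 0), (1, 0))"
  define ed :: "real4" where "ed = ((0, 0), (0, 1))"
  define D where "D e f = (\<lambda>x. frechet_derivative f (at x) e)"
    for e :: "real4" and f :: "real4 \<Rightarrow> complex"
  define good where "good f \<longleftrightarrow> smooth_function f \<and> (\<forall>x. x \<notin> K \<longrightarrow> f x = 0)"
    for f :: "real4 \<Rightarrow> complex"
  have good_D: "good (D e f)" if "good f" for e f
    using that smooth_function.smooth_dd smooth_function.dd_eq_0[OF _ Kc]
    unfolding good_def D_def by blast
  have good_add: "good (\<lambda>x. f x + D e f x)" if "good f" for e f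
    using that smooth_function_add_dd good_D[OF that]
    unfolding good_def D_def by auto
  have cont: "continuous_on UNIV f" if "good f" for f
    using that smooth_function.cont unfolding good_def by blast
  have zero: "f x = 0" if "good f" "x \<notin> K" for f x
    using that unfolding good_def by blast
  have meas: "f \<in> borel_measurable borel" if "good f" for f
    using cont[OF that] by (rule borel_measurable_continuous_onI)
  have der: "((\<lambda>t. f (\<gamma> t)) has_vector_derivative p * D e f (\<gamma> t) + q * D e' f (\<gamma> t)) (at t)"
    if "good f" "(\<gamma> has_vector_derivative p *\<^sub>R e + q *\<^sub>R e') (at t)" for f \<gamma> p q e e' t
  proof -
    have sm: "smooth_function f"
      using that(1) by (simp add: good_def)
    have "D (p *\<^sub>R e + q *\<^sub>R e') f x = p * D e f x + q * D e' f x" for x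
      using smooth_function.linear_deriv[OF sm, of x]
      by (simp add: D_def linear_add linear_scale scaleR_conv_of_real)
    then show ?thesis
      using smooth_function.has_vector_derivative_curve[OF sm that(2)] by (simp add: D_def)
  qed
  have gu: "good u"
    using test_functionsD(1)[OF u] u0 by (simp add: good_def)
  \<comment> \<open>The four operators are applied in the order b, c, a, d, because the reproducing
    integral translates first by \<open>(x, 0)\<close> and then by \<open>(0, A)\<close>:
    \<open>w\<close> gives back \<open>y\<close>, then \<open>z\<close>, then \<open>y1\<close>,
    then \<open>u\<close>.\<close>
  define y1 where "y1 = (\<lambda>x. u x + D eb u x)"
  define z where "z = (\<lambda>x. y1 x + D ec y1 x)"
  have gy1: "good y1" unfolding y1_def by (rule good_add[OF gu])
  have gz: "good z" unfolding z_def by (rule good_add[OF gy1])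
  \<comment> \<open>\<open>hz\<close> and \<open>hw\<close> differentiate along the curves (exp t *
    b, a + t), the orbits of left translation by (0, t), in the first and in the second
    factor.\<close>
  define hz where "hz f x = D ea f x + of_real (fst (fst x)) * D eb f x" for f x
  define hw where "hw f x = D ed f x + of_real (fst (snd x)) * D ec f x" for f x
  define y where "y x = z x + hz z x" for x
  \<comment> \<open>The coefficient \<open>fst (fst x)\<close> in \<open>y\<close> is constant along
    the curves of the second factor, so \<open>y\<close> is differentiated term by term and only
    derivatives of \<open>z\<close> occur.\<close>
  define hy where "hy x = hw z x + (hw (D ea z) x + of_real (fst (fst x)) * hw (D eb z) x)" for x
  define w where "w x = y x + hy x" for x
  note gzD = good_D[OF gz] good_D[OF good_D[OF gz]]
  have cont_w: "continuous_on UNIV w"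
    and cont_hz: "continuous_on UNIV (hz z)" and cont_hy: "continuous_on UNIV hy"
    unfolding y_def[abs_def] w_def[abs_def] hz_def[abs_def] hy_def[abs_def] hw_def
    by (intro continuous_intros cont[OF gz] cont[OF gzD(1)] cont[OF gzD(2)])+
  have zero_y: "y x = 0" and zero_w: "w x = 0" and zero_hz: "hz z x = 0" and zero_hy: "hy x = 0"
    if "x \<notin> K" for x
    unfolding y_def[abs_def] w_def[abs_def] hz_def[abs_def] hy_def[abs_def] hw_def
    using zero[OF gz that] zero[OF gzD(1) that] zero[OF gzD(2) that] by simp_all
  have exp_der: "(exp has_vector_derivative exp t) (at t)" for t :: real
    unfolding has_real_derivative_iff_has_vector_derivative[symmetric] by (rule DERIV_exp)
  note coord = abs_coordinate_le_norm[of "((_, _), (_, _))", simplified]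

  have step_b: "(LINT t|lborel. of_real (exp_density t) * y1 ((b - t, a), (c, d))) = u ((b, a), (c, d))" for a b c d
  proof -
    have "(LINT t|lborel. of_real (exp_density t) * (u ((b + - t, a), (c, d)) + D eb u ((b + - t, a), (c, d))))
        = u ((b + 0, a), (c, d))"
    proof (rule kernel_reproduces_along_curve[OF K, where \<gamma> = "\<lambda>t. ((b + t, a), (c, d))" and c = "\<bar>b\<bar>"])
      fix t
      have "((\<lambda>t. ((b + t, a), (c, d))) has_vector_derivative 1 *\<^sub>R eb + 0 *\<^sub>R eb) (at t)"
        unfolding eb_def by (auto intro!: derivative_eq_intros has_vector_derivative_Pair simp: zero_prod_def)
      from der[OF gu this]
      show "((\<lambda>t. u ((b + t, a), (c, d))) has_vector_derivative D eb u ((b + t, a), (c, d))) (at t)"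
        by simp
      show "\<bar>t\<bar> \<le> \<bar>b\<bar> + norm ((b + t, a), (c, d))"
        using coord(1)[of "b + t" a c d] by linarith
    qed (auto intro!: continuous_intros cont[OF good_D[OF gu]] zero[OF gu] zero[OF good_D[OF gu]])
    then show ?thesis by (simp add: y1_def)
  qed
  have step_c: "(LINT t|lborel. of_real (exp_density t) * z ((b, a), (c - t, d))) = y1 ((b, a), (c, d))" for a b c d
  proof -
    have "(LINT t|lborel. of_real (exp_density t) * (y1 ((b, a), (c + - t, d)) + D ec y1 ((b, a), (c + - t, d))))
        = y1 ((b, a), (c + 0, d))"
    proof (rule kernel_reproduces_along_curve[OF K, where \<gamma> = "\<lambda>t. ((b, a), (c + t, d))" and c = "\<bar>c\<bar>"])
      fix t
      have "((\<lambda>t. ((b, a), (c + t, d))) has_vector_derivative 1 *\<^sub>R ec + 0 *\<^sub>R ec) (at t)"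
        unfolding ec_def by (auto intro!: derivative_eq_intros has_vector_derivative_Pair simp: zero_prod_def)
      from der[OF gy1 this]
      show "((\<lambda>t. y1 ((b, a), (c + t, d))) has_vector_derivative D ec y1 ((b, a), (c + t, d))) (at t)"
        by simp
      show "\<bar>t\<bar> \<le> \<bar>c\<bar> + norm ((b, a), (c + t, d))"
        using coord(3)[of "c + t" b a d] by linarith
    qed (auto intro!: continuous_intros cont[OF good_D[OF gy1]] zero[OF gy1] zero[OF good_D[OF gy1]])
    then show ?thesis by (simp add: z_def)
  qed
  have step_a: "(LINT t|lborel. of_real (exp_density t) * y ((exp (- t) * b, a - t), (c, d))) = z ((b, a), (c, d))" for a b c d
  proof -
    have "(LINT t|lborel. of_real (exp_density t) *
          (z ((exp (- t) * b, a + - t), (c, d)) + hz z ((exp (- t) * b, a + - t), (c, d))))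
        = z ((exp 0 * b, a + 0), (c, d))"
    proof (rule kernel_reproduces_along_curve[OF K, where \<gamma> = "\<lambda>t. ((exp t * b, a + t), (c, d))" and c = "\<bar>a\<bar>"])
      fix t
      have "((\<lambda>t. ((exp t * b, a + t), (c, d))) has_vector_derivative 1 *\<^sub>R ea + (exp t * b) *\<^sub>R eb) (at t)"
        unfolding eb_def ea_def by (auto intro!: derivative_eq_intros has_vector_derivative_Pair exp_der simp: zero_prod_def)
      from der[OF gz this]
      show "((\<lambda>t. z ((exp t * b, a + t), (c, d))) has_vector_derivative hz z ((exp t * b, a + t), (c, d))) (at t)"
        by (simp add: hz_def)
      show "\<bar>t\<bar> \<le> \<bar>a\<bar> + norm ((exp t * b, a + t), (c, d))"
        using coord(2)[of "a + t" "exp t * b" c d] by linarith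
    qed (auto intro!: continuous_intros cont_hz zero[OF gz] zero_hz)
    then show ?thesis by (simp add: y_def)
  qed
  have step_d: "(LINT t|lborel. of_real (exp_density t) * w ((b, a), (exp (- t) * c, d - t))) = y ((b, a), (c, d))" for a b c d
  proof -
    have "(LINT t|lborel. of_real (exp_density t) *
          (y ((b, a), (exp (- t) * c, d + - t)) + hy ((b, a), (exp (- t) * c, d + - t))))
        = y ((b, a), (exp 0 * c, d + 0))"
    proof (rule kernel_reproduces_along_curve[OF K, where \<gamma> = "\<lambda>t. ((b, a), (exp t * c, d + t))" and c = "\<bar>d\<bar>"])
      fix t
      have \<gamma>: "((\<lambda>t. ((b, a), (exp t * c, d + t))) has_vector_derivative 1 *\<^sub>R ed + (exp t * c) *\<^sub>R ec) (at t)"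
        unfolding ec_def ed_def by (auto intro!: derivative_eq_intros has_vector_derivative_Pair exp_der simp: zero_prod_def)
      have d: "((\<lambda>t. f ((b, a), (exp t * c, d + t))) has_vector_derivative hw f ((b, a), (exp t * c, d + t))) (at t)"
        if "good f" for f
        using der[OF that \<gamma>] by (simp add: hw_def)
      have "((\<lambda>t. z ((b, a), (exp t * c, d + t)) + (D ea z ((b, a), (exp t * c, d + t)) + of_real b * D eb z ((b, a), (exp t * c, d + t))))
          has_vector_derivative hy ((b, a), (exp t * c, d + t))) (at t)"
        unfolding hy_def fst_conv
        by (intro has_vector_derivative_add has_vector_derivative_mult_right d gz gzD(1))
      then show "((\<lambda>t. y ((b, a), (exp t * c, d + t))) has_vector_derivative hy ((b, a), (exp t * c, d + t))) (at t)"
        by (simp add: y_def hz_def)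
      show "\<bar>t\<bar> \<le> \<bar>d\<bar> + norm ((b, a), (exp t * c, d + t))"
        using coord(4)[of "d + t" b a "exp t * c"] by linarith
    qed (auto intro!: continuous_intros cont_hy zero_y zero_hy)
    then show ?thesis by (simp add: w_def)
  qed
  obtain Mw where Mw: "\<And>x. cmod (w x) \<le> Mw"
    using bounded_if_compact_support[OF cont_w K zero_w] by blast
  obtain Mz where Mz: "\<And>x. cmod (z x) \<le> Mz"
    using bounded_if_compact_support[OF cont[OF gz] K zero[OF gz]] by blast
  have [measurable]: "w \<in> borel_measurable borel" "z \<in> borel_measurable borel"
    using cont_w meas[OF gz] by (auto intro: borel_measurable_continuous_onI)
  have inner: "(LINT A|lborel. exp_density2 A * w ((exp (- fst A) * b, a - fst A), (exp (- snd A) * c, d - snd A)))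
      = z ((b, a), (c, d))" for a b c d
    by (subst integral_exp_density2[where B = Mw]) (simp_all add: Mw step_d step_a)
  have outer: "(LINT x|lborel. exp_density2 x * z ((b - fst x, a), (c - snd x, d))) = u ((b, a), (c, d))" for a b c d
    by (subst integral_exp_density2[where B = Mz]) (simp_all add: Mz step_c step_b)
  show ?thesis
    by (rule that[OF cont_w K zero_w]) (simp_all add: inner outer)
qed

text \<open>With \<open>ginv\<close> the inversion of F x F and \<open>\<xi> k = w (ginv k)\<close>,
  the coefficient becomes the integral of w (h^-1 g) against a kernel in \<open>h\<close>. Writing h
  = (x, 0) (0, A) in each factor turns it into the formula of
  \<open>test_functions_reproduced\<close>.\<close>

lemma test_functions_subset_fourier_algebra:
  "test_functions \<subseteq> fourier_algebra aff2 aff2_haar"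
proof
  fix u :: "real4 \<Rightarrow> complex" assume u: "u \<in> test_functions"
  obtain w K where w: "continuous_on UNIV w" "compact K" "\<And>x. x \<notin> K \<Longrightarrow> w x = 0"
    and eq: "\<And>b a c d. u ((b, a), (c, d)) = (LINT x|lborel. exp_density2 x *
      (LINT A|lborel. exp_density2 A *
        w ((exp (- fst A) * (b - fst x), a - fst A), (exp (- snd A) * (c - snd x), d - snd A))))"
    by (rule test_functions_reproduced[OF u]) blast
  obtain M where M: "\<And>x. cmod (w x) \<le> M"
    using bounded_if_compact_support[OF w] by blast
  have [measurable]: "w \<in> borel_measurable borel"
    using w(1) by (rule borel_measurable_continuous_onI)
  define ginv where "ginv k = ((- exp (- snd (fst k)) * fst (fst k), - snd (fst k)),
      (- exp (- snd (snd k)) * fst (snd k), - snd (snd k)))" for k :: "real4"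
  have [measurable]: "ginv \<in> borel_measurable borel"
    unfolding ginv_def by measurable
  have cont_ginv: "continuous_on UNIV ginv"
    unfolding ginv_def by (intro continuous_intros)
  have ginv_ginv: "ginv (ginv k) = k" for k
    by (cases k; cases "fst k"; cases "snd k") (simp add: ginv_def exp_add[symmetric] flip: mult.assoc)
  define \<xi> where "\<xi> k = w (ginv k)" for k
  have [measurable]: "\<xi> \<in> borel_measurable borel"
    unfolding \<xi>_def by measurable
  have "compact (ginv ` K)"
    using w(2) cont_ginv by (intro compact_continuous_image) (auto intro: continuous_on_subset)
  then obtain r where r: "\<And>x. x \<in> K \<Longrightarrow> norm (ginv x) \<le> r"
    using compact_imp_bounded by (force simp: bounded_iff)
  have "ginv k \<notin> K" if "norm k > r" for k
    using r[of "ginv k"] that by (auto simp: ginv_ginv)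
  then have \<xi>: "\<xi> \<in> L2 aff2_haar"
    by (intro L2_aff2_bounded_support[where M = M and r = r]) (auto simp: \<xi>_def M w(3))
  \<comment> \<open>The density of the kernel with respect to Haar measure: the weight exp (-a)
    already supplies the exponential factor in the \<open>a\<close>-coordinates, so only the
    indicator of a half-line remains there.\<close>
  define \<kappa> where "\<kappa> h = (if snd (fst h) > 0 \<and> snd (snd h) > 0 then exp_density (fst (fst h)) * exp_density (fst (snd h)) else 0)"
    for h :: "real4"
  have [measurable]: "\<kappa> \<in> borel_measurable borel"
    unfolding \<kappa>_def by measurable
  have weight: "of_real (haar_weight A) * complex_of_real (\<kappa> (regroup (A, x))) = exp_density2 x * exp_density2 A" for A x
    by (simp add: \<kappa>_def regroup_def haar_weight_def exp_density2_def exp_density_def exp_diff exp_minus divide_inverse)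
  have \<eta>: "(\<lambda>h. complex_of_real (\<kappa> h)) \<in> L2 aff2_haar"
  proof (rule L2I)
    show "(\<lambda>h. complex_of_real (\<kappa> h)) \<in> borel_measurable aff2_haar"
      unfolding measurable_cong_sets[OF sets_aff2_haar refl] by measurable
    have "(\<integral>\<^sup>+h. ennreal ((cmod (complex_of_real (\<kappa> h)))\<^sup>2) \<partial>aff2_haar) =
        (\<integral>\<^sup>+z. ennreal (haar_weight (fst z)) * ennreal ((cmod (complex_of_real (\<kappa> (regroup z))))\<^sup>2) \<partial>lborel)"
      by (rule nn_integral_aff2_haar) measurable
    also have "\<dots> \<le> (\<integral>\<^sup>+z. ennreal (norm (exp_density2 (fst z) * exp_density2 (snd z))) \<partial>lborel)"
    proof (rule nn_integral_mono)
      fix z :: "real4"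
      have k: "0 \<le> \<kappa> h" "\<kappa> h \<le> 1" for h
        by (auto simp: \<kappa>_def exp_density_def mult_le_one)
      \<comment> \<open>Since \<kappa> takes values in [0, 1], it dominates its square, and the
        integrable kernel is also square-integrable.\<close>
      have "haar_weight (fst z) * (\<kappa> (regroup z))\<^sup>2 \<le> haar_weight (fst z) * \<kappa> (regroup z)"
        using k[of "regroup z"] by (intro mult_left_mono) (auto simp: power2_eq_square mult_left_le)
      also have "\<dots> = norm (of_real (haar_weight (fst z)) * complex_of_real (\<kappa> (regroup (fst z, snd z))))"
        using k(1) by (simp add: norm_mult)
      also have "\<dots> = norm (exp_density2 (fst z) * exp_density2 (snd z))"
        unfolding weight by (simp add: mult.commute)
      finally show "ennreal (haar_weight (fst z)) * ennreal ((cmod (complex_of_real (\<kappa> (regroup z))))\<^sup>2) \<le>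
          ennreal (norm (exp_density2 (fst z) * exp_density2 (snd z)))"
        by (simp add: ennreal_mult[symmetric] ennreal_leI)
    qed
    also have "\<dots> = ennreal (LINT z|lborel. norm (exp_density2 (fst z) * exp_density2 (snd z)))"
      by (intro nn_integral_eq_integral integrable_norm integrable_lborel_prod_mult integrable_exp_density2) simp
    finally show "(\<integral>\<^sup>+h. ennreal ((cmod (complex_of_real (\<kappa> h)))\<^sup>2) \<partial>aff2_haar) \<le>
        ennreal (LINT z|lborel. norm (exp_density2 (fst z) * exp_density2 (snd z)))" .
  qed
  have "u g = coefficient_fun aff2 aff2_haar \<xi> (\<lambda>h. complex_of_real (\<kappa> h)) g" for g
  proof -
    obtain b a c d where g: "g = ((b, a), (c, d))"
      by (cases g; cases "fst g"; cases "snd g") auto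
    define f where "f A x = w ((exp (- fst A) * (b - fst x), a - fst A), (exp (- snd A) * (c - snd x), d - snd A))"
      for A x :: "real \<times> real"
    have e: "- exp (s - t) * (exp (- s) * (p - q)) = exp (- t) * (q - p)" for p q s t :: real
    proof -
      have "exp (s - t) * exp (- s) = exp (- t)"
        by (simp add: exp_add[symmetric])
      then have "- (exp (s - t) * exp (- s)) * (p - q) = exp (- t) * (q - p)"
        by (simp add: algebra_simps)
      then show ?thesis
        by (simp add: mult.assoc)
    qed
    have lr: "left_regular aff2 g \<xi> (regroup (A, x)) = f A x" for A x
      by (simp only: left_regular_aff2 g \<xi>_def ginv_def regroup_def f_def fst_conv snd_conv minus_diff_eq e)
    have [measurable]: "left_regular aff2 g \<xi> \<in> borel_measurable borel"
      unfolding left_regular_aff2 by measurable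
    have "coefficient_fun aff2 aff2_haar \<xi> (\<lambda>h. complex_of_real (\<kappa> h)) g =
        (LINT z|lborel. of_real (haar_weight (fst z)) * (left_regular aff2 g \<xi> (regroup z) * cnj (complex_of_real (\<kappa> (regroup z)))))"
      unfolding coefficient_fun_def L2_inner_def by (rule integral_aff2_haar) measurable
    also have "\<dots> = (LINT z|lborel. exp_density2 (fst z) * exp_density2 (snd z) * f (fst z) (snd z))"
    proof (rule Bochner_Integration.integral_cong[OF refl])
      fix z :: "real4"
      obtain A x where z: "z = (A, x)" by (cases z)
      have "of_real (haar_weight A) * (f A x * cnj (complex_of_real (\<kappa> (regroup (A, x))))) =
          (of_real (haar_weight A) * complex_of_real (\<kappa> (regroup (A, x)))) * f A x"
        by simp
      then show "of_real (haar_weight (fst z)) * (left_regular aff2 g \<xi> (regroup z) * cnj (complex_of_real (\<kappa> (regroup z)))) =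
          exp_density2 (fst z) * exp_density2 (snd z) * f (fst z) (snd z)"
        unfolding z fst_conv snd_conv lr weight by (simp add: mult_ac)
    qed
    also have "\<dots> = (LINT x|lborel. LINT A|lborel. exp_density2 A * exp_density2 x * f A x)"
    proof (subst integral_lborel_prod(2))
      show "integrable lborel (\<lambda>z. exp_density2 (fst z) * exp_density2 (snd z) * f (fst z) (snd z))"
        by (intro integrable_mult_bounded[where B = M] integrable_lborel_prod_mult integrable_exp_density2)
          (simp_all add: f_def M)
    qed simp
    also have "\<dots> = u g"
      unfolding g eq f_def by (simp add: mult_ac)
    finally show ?thesis ..
  qed
  then show "u \<in> fourier_algebra aff2 aff2_haar"
    using \<xi> \<eta> unfolding fourier_algebra_def by blast
qed

section \<open>Fourier analysis on the plane\<close>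

lemma borel_measurable_cis [measurable]: "cis \<in> borel_measurable borel"
  by (intro borel_measurable_continuous_onI continuous_intros)

section \<open>Affine changes of variable in the plane\<close>

lemma nn_integral_lborel_affine2:
  fixes f :: "real \<times> real \<Rightarrow> ennreal"
  assumes [measurable]: "f \<in> borel_measurable borel" and c: "c1 \<noteq> 0" "c2 \<noteq> 0"
  shows "(\<integral>\<^sup>+x. f x \<partial>lborel) = ennreal \<bar>c1 * c2\<bar> * (\<integral>\<^sup>+x. f (t + (c1 * fst x, c2 * snd x)) \<partial>lborel)"
proof -
  have "(\<integral>\<^sup>+x. f x \<partial>lborel) = (\<integral>\<^sup>+x. \<integral>\<^sup>+y. f (x, y) \<partial>lborel \<partial>lborel)"
    by (rule nn_integral_lborel_prod) measurable
  also have "\<dots> = ennreal \<bar>c1\<bar> * (\<integral>\<^sup>+x. \<integral>\<^sup>+y. f (fst t + c1 * x, y) \<partial>lborel \<partial>lborel)"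
    by (rule nn_integral_real_affine[OF _ c(1)]) measurable
  also have "(\<integral>\<^sup>+x. \<integral>\<^sup>+y. f (fst t + c1 * x, y) \<partial>lborel \<partial>lborel) =
      (\<integral>\<^sup>+x. ennreal \<bar>c2\<bar> * (\<integral>\<^sup>+y. f (fst t + c1 * x, snd t + c2 * y) \<partial>lborel) \<partial>lborel)"
    by (intro nn_integral_cong nn_integral_real_affine[OF _ c(2)]) measurable
  also have "\<dots> = ennreal \<bar>c2\<bar> * (\<integral>\<^sup>+x. f (t + (c1 * fst x, c2 * snd x)) \<partial>lborel)"
    by (simp add: nn_integral_cmult nn_integral_lborel_prod plus_prod_def)
  finally show ?thesis
    by (simp add: abs_mult ennreal_mult mult.assoc)
qed

lemma lborel_affine2:
  fixes t :: "real \<times> real"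
  assumes c: "c1 \<noteq> 0" "c2 \<noteq> 0"
  shows "lborel = density (distr lborel borel (\<lambda>x. t + (c1 * fst x, c2 * snd x))) (\<lambda>_. ennreal \<bar>c1 * c2\<bar>)"
proof (rule measure_eqI)
  fix X :: "(real \<times> real) set" assume "X \<in> sets lborel"
  then have [measurable]: "X \<in> sets borel" by simp
  have "emeasure lborel X = (\<integral>\<^sup>+x. indicator X x \<partial>lborel)"
    by simp
  also have "\<dots> = ennreal \<bar>c1 * c2\<bar> * (\<integral>\<^sup>+x. indicator X (t + (c1 * fst x, c2 * snd x)) \<partial>lborel)"
    by (rule nn_integral_lborel_affine2[OF _ c]) measurable
  also have "\<dots> = (\<integral>\<^sup>+x. indicator X x \<partial>density (distr lborel borel (\<lambda>x. t + (c1 * fst x, c2 * snd x))) (\<lambda>_. ennreal \<bar>c1 * c2\<bar>))"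
    by (simp add: nn_integral_density nn_integral_distr nn_integral_cmult del: nn_integral_indicator)
  finally show "emeasure lborel X =
      emeasure (density (distr lborel borel (\<lambda>x. t + (c1 * fst x, c2 * snd x))) (\<lambda>_. ennreal \<bar>c1 * c2\<bar>)) X"
    by simp
qed simp

lemma integral_lborel_affine2:
  fixes f :: "real \<times> real \<Rightarrow> complex"
  assumes [measurable]: "f \<in> borel_measurable borel" and c: "c1 \<noteq> 0" "c2 \<noteq> 0"
  shows "(LINT x|lborel. f x) = of_real \<bar>c1 * c2\<bar> * (LINT x|lborel. f (t + (c1 * fst x, c2 * snd x)))"
  by (subst lborel_affine2[OF c, of t])
    (simp add: integral_density integral_distr scaleR_conv_of_real)

lemma integrable_lborel_affine2:
  fixes f :: "real \<times> real \<Rightarrow> complex"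
  assumes f: "integrable lborel f" and c: "c1 \<noteq> 0" "c2 \<noteq> 0"
  shows "integrable lborel (\<lambda>x. f (t + (c1 * fst x, c2 * snd x)))"
proof -
  have [measurable]: "f \<in> borel_measurable borel"
    using f by (auto dest: borel_measurable_integrable)
  have "integrable (density (distr lborel borel (\<lambda>x. t + (c1 * fst x, c2 * snd x))) (\<lambda>_. ennreal \<bar>c1 * c2\<bar>)) f"
    using f lborel_affine2[OF c, of t] by simp
  then have "integrable lborel (\<lambda>x. \<bar>c1 * c2\<bar> *\<^sub>R f (t + (c1 * fst x, c2 * snd x)))"
    by (simp add: integrable_density integrable_distr_eq)
  from integrable_scaleR_right[OF this, of "1 / \<bar>c1 * c2\<bar>"] show ?thesis
    using c by simp
qed

lemma ennreal_norm_integral_le: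
  fixes f :: "'a \<Rightarrow> complex"
  shows "ennreal (norm (LINT x|M. f x)) \<le> (\<integral>\<^sup>+x. ennreal (norm (f x)) \<partial>M)"
  using integral_norm_bound_ennreal[of M f] not_integrable_integral_eq[of M f] by (cases "integrable M f") auto

lemma integral_lborel_mult_prod:
  fixes f :: "'a::euclidean_space \<Rightarrow> complex" and g :: "'b::euclidean_space \<Rightarrow> complex"
  assumes "integrable lborel f" "integrable lborel g"
  shows "(LINT z|lborel. f (fst z) * g (snd z)) = (LINT x|lborel. f x) * (LINT y|lborel. g y)"
  using integral_lborel_prod(1)[OF integrable_lborel_prod_mult[OF assms]] by simp

lemma Fubini_lborel:
  fixes f :: "'a::euclidean_space \<Rightarrow> 'b::euclidean_space \<Rightarrow> complex"
  assumes "integrable lborel (\<lambda>z. f (fst z) (snd z))"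
  shows "(LINT x|lborel. LINT y|lborel. f x y) = (LINT y|lborel. LINT x|lborel. f x y)"
  using integral_lborel_prod[OF assms] by simp

lemma cis_inner_diff_right: "cis (p \<bullet> (y - c)) = cis (- (p \<bullet> c)) * cis (p \<bullet> y)"
  by (simp add: inner_diff_right cis_mult)

section \<open>The planar Gaussian and mollified Fourier inversion\<close>

definition gauss2 :: "real \<times> real \<Rightarrow> real" where
  "gauss2 x = std_normal_density (fst x) * std_normal_density (snd x)"

lemma borel_measurable_gauss2 [measurable]: "gauss2 \<in> borel_measurable borel"
  unfolding gauss2_def by measurable

lemma gauss2_nonneg [simp]: "0 \<le> gauss2 x"
  by (simp add: gauss2_def)

lemma gauss2_minus [simp]: "gauss2 (- x) = gauss2 x"
  by (simp add: gauss2_def std_normal_density_def)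

lemma gauss2_eq: "gauss2 x = exp (- (x \<bullet> x) / 2) / (2 * pi)"
  by (cases x) (simp add: gauss2_def std_normal_density_def exp_add[symmetric] power2_eq_square field_simps flip: real_sqrt_mult)

lemma nn_integral_gauss2: "(\<integral>\<^sup>+x. ennreal (gauss2 x) \<partial>lborel) = 1"
proof -
  have "(\<integral>\<^sup>+t. ennreal (std_normal_density t) \<partial>lborel) = emeasure std_normal_distribution UNIV"
    by (simp add: emeasure_density)
  also have "\<dots> = 1"
    using prob_space.emeasure_space_1[OF prob_space_normal_density[of 1 0]] by simp
  finally show ?thesis
    by (simp add: nn_integral_lborel_prod gauss2_def ennreal_mult nn_integral_cmult)
qed

lemma integrable_gauss2: "integrable lborel (\<lambda>x. complex_of_real (gauss2 x))"
  by (rule integrableI_bounded) (simp_all add: nn_integral_gauss2)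

lemma integral_gauss2: "(LINT x|lborel. complex_of_real (gauss2 x)) = 1"
proof -
  have "(LINT x|lborel. gauss2 x) = 1"
    by (simp add: integral_eq_nn_integral nn_integral_gauss2)
  then show ?thesis
    using integral_complex_of_real[of lborel gauss2] by simp
qed

lemma integral_gauss2_cis:
  "(LINT p|lborel. complex_of_real (gauss2 p) * cis (p \<bullet> y)) = of_real (2 * pi * gauss2 y)"
proof -
  have 1: "(LINT t|lborel. complex_of_real (std_normal_density t) * cis (t * s)) = of_real (exp (- s\<^sup>2 / 2))" for s
  proof -
    have "char std_normal_distribution s = (LINT t|lborel. complex_of_real (std_normal_density t) * cis (t * s))"
      by (simp add: char_def integral_density scaleR_conv_of_real cis_conv_exp mult.commute)
    then show ?thesis
      by (simp add: char_std_normal_distribution)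
  qed
  have int: "integrable lborel (\<lambda>t. complex_of_real (std_normal_density t) * cis (t * s))" for s
    by (rule integrable_mult_bounded[where B = 1]) auto
  have "(LINT p|lborel. complex_of_real (gauss2 p) * cis (p \<bullet> y)) =
      (LINT p|lborel. (complex_of_real (std_normal_density (fst p)) * cis (fst p * fst y)) *
        (complex_of_real (std_normal_density (snd p)) * cis (snd p * snd y)))"
    by (rule Bochner_Integration.integral_cong[OF refl])
      (simp add: gauss2_def inner_prod_def cis_mult[symmetric] mult_ac)
  also have "\<dots> = of_real (exp (- (fst y)\<^sup>2 / 2)) * of_real (exp (- (snd y)\<^sup>2 / 2))"
    by (subst integral_lborel_mult_prod[OF int int]) (simp only: 1)
  also have "\<dots> = of_real (2 * pi * gauss2 y)"
  proof -
    have "exp (- (fst y)\<^sup>2 / 2) * exp (- (snd y)\<^sup>2 / 2) = exp (- (y \<bullet> y) / 2)"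
      by (simp add: exp_add[symmetric] inner_prod_def power2_eq_square field_simps)
    then show ?thesis
      by (simp only: gauss2_eq of_real_mult[symmetric]) simp
  qed
  finally show ?thesis .
qed

lemma integrable_gauss2_scaled:
  assumes "e > 0"
  shows "integrable lborel (\<lambda>x. complex_of_real (gauss2 (e *\<^sub>R x)))"
  using integrable_lborel_affine2[OF integrable_gauss2, of e e 0] assms
  by (simp add: scaleR_prod_def)

lemma integral_gauss2_scaled_cis:
  assumes e: "e > 0"
  shows "(LINT p|lborel. complex_of_real (gauss2 (e *\<^sub>R p)) * cis (p \<bullet> y)) =
    of_real (2 * pi * gauss2 (y /\<^sub>R e) / e\<^sup>2)"
proof -
  have "of_real (2 * pi * gauss2 (y /\<^sub>R e)) = (LINT p|lborel. complex_of_real (gauss2 p) * cis (p \<bullet> (y /\<^sub>R e)))"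
    by (rule integral_gauss2_cis[symmetric])
  also have "\<dots> = of_real \<bar>e * e\<bar> * (LINT p|lborel. complex_of_real (gauss2 (e *\<^sub>R p)) * cis ((e *\<^sub>R p) \<bullet> (y /\<^sub>R e)))"
    using e by (subst integral_lborel_affine2[where ?c1.0 = e and ?c2.0 = e and t = 0]) (simp_all add: scaleR_prod_def)
  also have "(\<lambda>p. (e *\<^sub>R p) \<bullet> (y /\<^sub>R e)) = (\<lambda>p. p \<bullet> y)"
    using e by (intro ext) (simp add: field_simps)
  finally show ?thesis
    using e by (simp add: power2_eq_square field_simps)
qed

lemma nn_integral_gauss2_scaled:
  assumes e: "e > 0"
  shows "(\<integral>\<^sup>+y. ennreal (gauss2 ((y - x) /\<^sub>R e) / e\<^sup>2) \<partial>lborel) = 1"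
proof -
  have "(\<integral>\<^sup>+y. ennreal (gauss2 ((y - x) /\<^sub>R e) / e\<^sup>2) \<partial>lborel) =
      ennreal \<bar>e * e\<bar> * (\<integral>\<^sup>+y. ennreal (gauss2 (((x + (e * fst y, e * snd y)) - x) /\<^sub>R e) / e\<^sup>2) \<partial>lborel)"
    using e by (intro nn_integral_lborel_affine2) auto
  also have "(\<lambda>y. ((x + (e * fst y, e * snd y)) - x) /\<^sub>R e) = (\<lambda>y. y)"
    using e by (auto simp: scaleR_prod_def)
  also have "ennreal \<bar>e * e\<bar> * (\<integral>\<^sup>+y. ennreal (gauss2 y / e\<^sup>2) \<partial>lborel) = (\<integral>\<^sup>+y. ennreal \<bar>e * e\<bar> * ennreal (gauss2 y / e\<^sup>2) \<partial>lborel)"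
    by (rule nn_integral_cmult[symmetric]) measurable
  also have "\<dots> = (\<integral>\<^sup>+y. ennreal (gauss2 y) \<partial>lborel)"
    using e by (intro nn_integral_cong) (simp add: ennreal_mult[symmetric] power2_eq_square)
  finally show ?thesis
    by (simp add: nn_integral_gauss2)
qed

text \<open>Fourier inversion in mollified form. Averaging at scale \<open>e\<close> multiplies the
  transform by 2 pi gauss2 (e p), and the inversion constant (2 pi)^-2 leaves gauss2 (e p) / (2 pi).
  The Gaussian decay in \<open>p\<close> makes the double integral absolutely convergent for any
  integrable \<open>U\<close>, so Fubini applies.\<close>

lemma gauss2_average_eq:
  fixes U :: "real \<times> real \<Rightarrow> complex"
  assumes U: "integrable lborel U" and e: "e > 0"
  shows "(LINT s|lborel. of_real (gauss2 s) * U (c + e *\<^sub>R s)) =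
    (LINT p|lborel. of_real (gauss2 (e *\<^sub>R p) / (2 * pi)) * cis (- (p \<bullet> c)) * (LINT y|lborel. U y * cis (p \<bullet> y)))"
proof -
  have [measurable]: "U \<in> borel_measurable borel"
    using U by (auto dest: borel_measurable_integrable)
  have intg: "integrable lborel (\<lambda>p. complex_of_real (gauss2 (e *\<^sub>R p) / (2 * pi)))"
    using integrable_gauss2_scaled[OF e] by simp
  have "(LINT p|lborel. of_real (gauss2 (e *\<^sub>R p) / (2 * pi)) * cis (- (p \<bullet> c)) * (LINT y|lborel. U y * cis (p \<bullet> y))) =
      (LINT p|lborel. LINT y|lborel. of_real (gauss2 (e *\<^sub>R p) / (2 * pi)) * U y * cis (p \<bullet> (y - c)))"
    unfolding cis_inner_diff_right by (subst integral_mult_right_zero[symmetric]) (simp only: mult_ac)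
  also have "\<dots> = (LINT y|lborel. LINT p|lborel. of_real (gauss2 (e *\<^sub>R p) / (2 * pi)) * U y * cis (p \<bullet> (y - c)))"
  proof (rule Fubini_lborel)
    show "integrable lborel (\<lambda>z. of_real (gauss2 (e *\<^sub>R fst z) / (2 * pi)) * U (snd z) * cis (fst z \<bullet> (snd z - c)))"
      by (rule integrable_mult_bounded[OF integrable_lborel_prod_mult[OF intg U], where B = 1]) simp_all
  qed
  also have "\<dots> = (LINT y|lborel. U y * of_real (gauss2 ((y - c) /\<^sub>R e) / e\<^sup>2))"
  proof (rule Bochner_Integration.integral_cong[OF refl])
    fix y
    have "(LINT p|lborel. of_real (gauss2 (e *\<^sub>R p) / (2 * pi)) * U y * cis (p \<bullet> (y - c))) =
        (LINT p|lborel. (U y / of_real (2 * pi)) * (of_real (gauss2 (e *\<^sub>R p)) * cis (p \<bullet> (y - c))))"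
      by (simp add: mult_ac)
    also have "\<dots> = U y * of_real (gauss2 ((y - c) /\<^sub>R e) / e\<^sup>2)"
      by (simp only: integral_mult_right_zero integral_gauss2_scaled_cis[OF e]) simp
    finally show "(LINT p|lborel. of_real (gauss2 (e *\<^sub>R p) / (2 * pi)) * U y * cis (p \<bullet> (y - c))) =
        U y * of_real (gauss2 ((y - c) /\<^sub>R e) / e\<^sup>2)" .
  qed
  also have "\<dots> = of_real \<bar>e * e\<bar> * (LINT s|lborel. U (c + (e * fst s, e * snd s)) *
      of_real (gauss2 ((c + (e * fst s, e * snd s) - c) /\<^sub>R e) / e\<^sup>2))"
    using e by (intro integral_lborel_affine2) auto
  also have "\<dots> = (LINT s|lborel. of_real \<bar>e * e\<bar> * (U (c + (e * fst s, e * snd s)) *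
      of_real (gauss2 ((c + (e * fst s, e * snd s) - c) /\<^sub>R e) / e\<^sup>2)))"
    by simp
  also have "\<dots> = (LINT s|lborel. of_real (gauss2 s) * U (c + e *\<^sub>R s))"
  proof (rule Bochner_Integration.integral_cong[OF refl])
    fix s :: "real \<times> real"
    have 1: "(e * fst s, e * snd s) = e *\<^sub>R s"
      by (simp add: scaleR_prod_def)
    have 2: "(c + e *\<^sub>R s - c) /\<^sub>R e = s"
      using e by simp
    show "of_real \<bar>e * e\<bar> * (U (c + (e * fst s, e * snd s)) *
      of_real (gauss2 ((c + (e * fst s, e * snd s) - c) /\<^sub>R e) / e\<^sup>2)) = of_real (gauss2 s) * U (c + e *\<^sub>R s)"
      unfolding 1 2 using e by (simp add: power2_eq_square)
  qed
  finally show ?thesis ..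
qed

section \<open>The planar Fourier transform and Bessel's inequality\<close>

definition fourier2 :: "(real \<times> real \<Rightarrow> complex) \<Rightarrow> real \<times> real \<Rightarrow> complex" where
  "fourier2 f p = (LINT x|lborel. f x * cis (- (p \<bullet> x)))"

lemma borel_measurable_fourier2 [measurable]:
  assumes [measurable]: "f \<in> borel_measurable borel"
  shows "fourier2 f \<in> borel_measurable borel"
  unfolding fourier2_def[abs_def] by measurable

text \<open>
  Integrating \<open>|f^|\<^sup>2\<close> against a Gaussian leads to a convolution with an approximate identity, which
  the arithmetic-geometric mean inequality bounds by \<open>\<parallel>f\<parallel>\<^sup>2\<close>.
\<close>

lemma fourier2_gauss_le:
  assumes f: "integrable lborel f" and e: "e > 0"
  shows "(\<integral>\<^sup>+p. ennreal ((cmod (fourier2 f p))\<^sup>2 * (2 * pi * gauss2 (e *\<^sub>R p))) \<partial>lborel) \<le>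
    ennreal ((2 * pi)\<^sup>2) * (\<integral>\<^sup>+x. ennreal ((cmod (f x))\<^sup>2) \<partial>lborel)"
proof -
  have [measurable]: "f \<in> borel_measurable borel"
    using f by (auto dest: borel_measurable_integrable)
  let ?I = "\<integral>\<^sup>+x. ennreal ((cmod (f x))\<^sup>2) \<partial>lborel"
  let ?g = "\<lambda>y. gauss2 (y /\<^sub>R e) / e\<^sup>2"
  have bound: "cmod (fourier2 f p) \<le> (LINT x|lborel. cmod (f x))" for p
    unfolding fourier2_def by (rule order_trans[OF integral_norm_bound]) (simp add: norm_mult)
  let ?W = "\<lambda>p. complex_of_real (2 * pi * gauss2 (e *\<^sub>R p))"
  let ?h = "\<lambda>z. f (fst z) * cnj (f (snd z))" and ?c = "\<lambda>p z. cis (p \<bullet> (snd z - fst z))"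
  let ?a = "\<lambda>z. cmod (f (fst z))" and ?b = "\<lambda>z. cmod (f (snd z))" and ?t = "\<lambda>z. ?g (snd z - fst z)"
  let ?L = "LINT p|lborel. (cmod (fourier2 f p))\<^sup>2 * (2 * pi * gauss2 (e *\<^sub>R p))"
  have intf: "integrable lborel (\<lambda>x. f x * cis (h x))" if "h \<in> borel_measurable borel" for h
    using f that by (intro integrable_mult_bounded[where B = 1]) auto
  have intg: "integrable lborel (\<lambda>p. ?W p)"
    using integrable_gauss2_scaled[OF e] by simp
  have int: "integrable lborel (\<lambda>p. ?W p * (fourier2 f p * cnj (fourier2 f p)))"
  proof (rule integrable_mult_bounded[OF intg])
    show "cmod (fourier2 f p * cnj (fourier2 f p)) \<le> (LINT x|lborel. cmod (f x)) * (LINT x|lborel. cmod (f x))" for p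
      unfolding norm_mult complex_mod_cnj by (intro mult_mono bound) auto
  qed measurable
  have sq: "?W p * (fourier2 f p * cnj (fourier2 f p)) =
      complex_of_real ((cmod (fourier2 f p))\<^sup>2 * (2 * pi * gauss2 (e *\<^sub>R p)))" for p
    unfolding complex_norm_square[symmetric] of_real_mult[symmetric] by (simp only: mult.commute)
  have intf2: "integrable lborel (\<lambda>z. f (fst z) * cnj (f (snd z)))"
    using f by (intro integrable_lborel_prod_mult) auto
  have "complex_of_real (?L) =
      (LINT p|lborel. ?W p * (fourier2 f p * cnj (fourier2 f p)))"
    unfolding sq by (rule integral_complex_of_real[symmetric])
  also have "\<dots> = (LINT p|lborel. LINT z|lborel. ?W p *
      ?h z * ?c p z)"
  proof (rule Bochner_Integration.integral_cong[OF refl])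
    fix p :: "real \<times> real"
    have "fourier2 f p * cnj (fourier2 f p) =
        (LINT x|lborel. f x * cis (- (p \<bullet> x))) * (LINT y|lborel. cnj (f y * cis (- (p \<bullet> y))))"
      by (simp only: fourier2_def Bochner_Integration.integral_cnj)
    also have "\<dots> = (LINT z|lborel. f (fst z) * cis (- (p \<bullet> fst z)) * cnj (f (snd z) * cis (- (p \<bullet> snd z))))"
      by (rule integral_lborel_mult_prod[symmetric]) (intro intf integrable_cnj; simp)+
    also have "\<dots> = (LINT z|lborel. ?h z * ?c p z)"
      unfolding cis_inner_diff_right by (rule Bochner_Integration.integral_cong[OF refl]) (simp add: cis_cnj)
    finally show "?W p * (fourier2 f p * cnj (fourier2 f p)) =
        (LINT z|lborel. ?W p *
          ?h z * ?c p z)"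
      by (simp add: mult.assoc)
  qed
  also have "\<dots> = (LINT z|lborel. LINT p|lborel. ?W p *
      ?h z * ?c p z)"
    by (rule Fubini_lborel, rule integrable_mult_bounded[OF integrable_lborel_prod_mult[OF intg intf2], where B = 1])
      simp_all
  also have "\<dots> = (LINT z|lborel. of_real ((2 * pi)\<^sup>2 * ?t z) * ?h z)"
  proof (rule Bochner_Integration.integral_cong[OF refl])
    fix z :: "real4"
    have "(LINT p|lborel. ?W p * ?h z * ?c p z) =
        (LINT p|lborel. (of_real (2 * pi) * ?h z) * (of_real (gauss2 (e *\<^sub>R p)) * ?c p z))"
      by (simp add: mult_ac)
    also have "\<dots> = of_real ((2 * pi)\<^sup>2 * ?t z) * ?h z"
      unfolding integral_mult_right_zero integral_gauss2_scaled_cis[OF e] by (simp add: power2_eq_square)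
    finally show "(LINT p|lborel. ?W p * ?h z * ?c p z) =
      of_real ((2 * pi)\<^sup>2 * ?t z) * ?h z" .
  qed
  finally have eq: "complex_of_real (?L) =
      (LINT z|lborel. of_real ((2 * pi)\<^sup>2 * ?t z) * ?h z)" .
  have "(\<integral>\<^sup>+p. ennreal ((cmod (fourier2 f p))\<^sup>2 * (2 * pi * gauss2 (e *\<^sub>R p))) \<partial>lborel) =
      ennreal (?L)"
    using int unfolding sq complex_of_real_integrable_eq by (intro nn_integral_eq_integral) auto
  also have "\<dots> \<le> ennreal (norm (complex_of_real (?L)))"
    by (intro ennreal_leI) (simp only: norm_of_real abs_ge_self)
  also have "\<dots> \<le> (\<integral>\<^sup>+z. ennreal (norm (of_real ((2 * pi)\<^sup>2 * ?t z) * ?h z)) \<partial>lborel)"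
    unfolding eq by (rule ennreal_norm_integral_le)
  also have "\<dots> = (\<integral>\<^sup>+z. ennreal ((2 * pi)\<^sup>2) * ennreal (?t z * (?a z * ?b z)) \<partial>lborel)"
    by (intro nn_integral_cong) (simp add: norm_mult norm_power norm_divide ennreal_mult[symmetric])
  also have "\<dots> = ennreal ((2 * pi)\<^sup>2) * (\<integral>\<^sup>+z. ennreal (?t z * (?a z * ?b z)) \<partial>lborel)"
    by (rule nn_integral_cmult) measurable
  also have "\<dots> \<le> ennreal ((2 * pi)\<^sup>2) * ?I"
  proof (rule mult_left_mono)
    let ?J = "\<integral>\<^sup>+z. ennreal (?t z * (?a z * ?b z)) \<partial>lborel"
    have "2 * ?J = (\<integral>\<^sup>+z. 2 * ennreal (?t z * (?a z * ?b z)) \<partial>lborel)"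
      by (rule nn_integral_cmult[symmetric]) measurable
    also have "\<dots> \<le> (\<integral>\<^sup>+z. ennreal ((?a z)\<^sup>2) * ennreal (?t z) +
        ennreal ((?b z)\<^sup>2) * ennreal (?t z) \<partial>lborel)"
    proof (rule nn_integral_mono)
      fix z :: "real4"
      have amgm: "2 * ennreal (t * (a * b)) \<le> ennreal (a\<^sup>2) * ennreal t + ennreal (b\<^sup>2) * ennreal t"
        if "0 \<le> t" "0 \<le> a" "0 \<le> b" for a b t :: real
      proof -
        have "2 * (t * (a * b)) \<le> a\<^sup>2 * t + b\<^sup>2 * t"
          using mult_left_mono[OF sum_squares_bound[of a b] that(1)] by (simp add: algebra_simps)
        then have "ennreal (2 * (t * (a * b))) \<le> ennreal (a\<^sup>2 * t + b\<^sup>2 * t)"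
          by (rule ennreal_leI)
        then show ?thesis
          using that by (simp add: ennreal_mult ennreal_plus)
      qed
      show "2 * ennreal (?t z * (?a z * ?b z)) \<le> ennreal ((?a z)\<^sup>2) * ennreal (?t z) + ennreal ((?b z)\<^sup>2) * ennreal (?t z)"
        by (rule amgm) simp_all
    qed
    also have "\<dots> = (\<integral>\<^sup>+z. ennreal ((?a z)\<^sup>2) * ennreal (?t z) \<partial>lborel) +
        (\<integral>\<^sup>+z. ennreal ((?b z)\<^sup>2) * ennreal (?t z) \<partial>lborel)"
      by (rule nn_integral_add) measurable
    also have "(\<integral>\<^sup>+z. ennreal ((?a z)\<^sup>2) * ennreal (?t z) \<partial>lborel) =
        (\<integral>\<^sup>+x. \<integral>\<^sup>+y. ennreal ((cmod (f x))\<^sup>2) * ennreal (?g (y - x)) \<partial>lborel \<partial>lborel)"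
      by (subst nn_integral_lborel_prod) simp_all
    also have "\<dots> = ?I"
      by (simp add: nn_integral_cmult nn_integral_gauss2_scaled[OF e])
    also have "(\<integral>\<^sup>+z. ennreal ((?b z)\<^sup>2) * ennreal (?t z) \<partial>lborel) =
        (\<integral>\<^sup>+x. \<integral>\<^sup>+y. ennreal ((cmod (f y))\<^sup>2) * ennreal (?g (y - x)) \<partial>lborel \<partial>lborel)"
      by (subst nn_integral_lborel_prod) simp_all
    also have "\<dots> = (\<integral>\<^sup>+y. \<integral>\<^sup>+x. ennreal ((cmod (f y))\<^sup>2) * ennreal (?g (y - x)) \<partial>lborel \<partial>lborel)"
      by (rule nn_integral_lborel_swap) measurable
    also have "\<dots> = (\<integral>\<^sup>+y. \<integral>\<^sup>+x. ennreal ((cmod (f y))\<^sup>2) * ennreal (?g (x - y)) \<partial>lborel \<partial>lborel)"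
    proof -
      have "gauss2 ((y - x) /\<^sub>R e) = gauss2 ((x - y) /\<^sub>R e)" for x y
        using gauss2_minus[of "(x - y) /\<^sub>R e"] by (simp only: scaleR_minus_right[symmetric] minus_diff_eq)
      then show ?thesis by simp
    qed
    also have "\<dots> = ?I"
      by (simp add: nn_integral_cmult nn_integral_gauss2_scaled[OF e])
    finally have "2 * ?J \<le> 2 * ?I"
      by (simp add: mult_2)
    then show "?J \<le> ?I"
      by (simp add: ennreal_mult_le_mult_iff)
  qed simp
  finally show ?thesis .
qed

text \<open>As the scale tends to 0, the weights 2 pi gauss2 (e p) = exp (- e^2 |p|^2 / 2) tend to
  1, and Fatou's lemma removes them from \<open>fourier2_gauss_le\<close>. The factor (2 pi)^2 is
  the Plancherel constant of the unnormalised transform.\<close>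

lemma fourier2_Bessel:
  assumes f: "integrable lborel f"
  shows "(\<integral>\<^sup>+p. ennreal ((cmod (fourier2 f p))\<^sup>2) \<partial>lborel) \<le>
    ennreal ((2 * pi)\<^sup>2) * (\<integral>\<^sup>+x. ennreal ((cmod (f x))\<^sup>2) \<partial>lborel)"
proof -
  have [measurable]: "f \<in> borel_measurable borel"
    using f by (auto dest: borel_measurable_integrable)
  let ?h = "\<lambda>n p. ennreal ((cmod (fourier2 f p))\<^sup>2 * (2 * pi * gauss2 ((1 / real (Suc n)) *\<^sub>R p)))"
  have lim: "liminf (\<lambda>n. ?h n p) = ennreal ((cmod (fourier2 f p))\<^sup>2)" for p
  proof (rule lim_imp_Liminf)
    have lim0: "(\<lambda>n. 1 / real (Suc n)) \<longlonglongrightarrow> 0"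
      by (rule LIMSEQ_Suc[OF lim_1_over_n])
    have "(\<lambda>n. (cmod (fourier2 f p))\<^sup>2 * exp (- ((1 / real (Suc n)) * (1 / real (Suc n)) * (p \<bullet> p)) / 2)) \<longlonglongrightarrow>
        (cmod (fourier2 f p))\<^sup>2 * exp (- (0 * 0 * (p \<bullet> p)) / 2)"
      by (intro tendsto_mult tendsto_exp tendsto_divide tendsto_minus tendsto_const lim0) simp
    moreover have "2 * pi * gauss2 (c *\<^sub>R p) = exp (- (c * c * (p \<bullet> p)) / 2)" for c
      by (simp add: gauss2_eq mult.assoc)
    ultimately show "(\<lambda>n. ?h n p) \<longlonglongrightarrow> ennreal ((cmod (fourier2 f p))\<^sup>2)"
      by (intro tendsto_ennrealI) simp
  qed simp
  have "(\<integral>\<^sup>+p. ennreal ((cmod (fourier2 f p))\<^sup>2) \<partial>lborel) = (\<integral>\<^sup>+p. liminf (\<lambda>n. ?h n p) \<partial>lborel)"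
    by (simp only: lim)
  also have "\<dots> \<le> liminf (\<lambda>n. \<integral>\<^sup>+p. ?h n p \<partial>lborel)"
    by (rule nn_integral_liminf) measurable
  also have "\<dots> \<le> ennreal ((2 * pi)\<^sup>2) * (\<integral>\<^sup>+x. ennreal ((cmod (f x))\<^sup>2) \<partial>lborel)"
    by (rule order_trans[OF Liminf_le]) (auto intro!: always_eventually fourier2_gauss_le[OF f])
  finally show ?thesis .
qed

section \<open>Coefficients of bounded functions with bounded support\<close>

definition bounded_support :: "('a::euclidean_space \<Rightarrow> complex) set" where
  "bounded_support = {f \<in> borel_measurable borel. (\<exists>M. \<forall>x. cmod (f x) \<le> M) \<and> (\<exists>r. \<forall>x. norm x > r \<longrightarrow> f x = 0)}"

lemma bounded_supportI:
  assumes "f \<in> borel_measurable borel" "\<And>x. cmod (f x) \<le> M" "\<And>x. norm x > r \<Longrightarrow> f x = 0"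
  shows "f \<in> bounded_support"
  using assms by (auto simp: bounded_support_def)

lemma bounded_supportE:
  assumes "f \<in> bounded_support"
  obtains M r where "f \<in> borel_measurable borel" "\<And>x. cmod (f x) \<le> M" "0 \<le> M"
    "\<And>x. norm x > r \<Longrightarrow> f x = 0" "0 \<le> r"
proof -
  obtain M r where Mr: "f \<in> borel_measurable borel" "\<And>x. cmod (f x) \<le> M" "\<And>x. norm x > r \<Longrightarrow> f x = 0"
    using assms by (auto simp: bounded_support_def)
  have "0 \<le> M"
    using Mr(2)[of 0] norm_ge_zero order_trans by blast
  then show ?thesis
    using Mr by (intro that[of M "max r 0"]) auto
qed

lemma bounded_support_measurable: "f \<in> bounded_support \<Longrightarrow> f \<in> borel_measurable borel"
  by (simp add: bounded_support_def)

lemma integrable_bounded_support: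
  assumes "f \<in> bounded_support"
  shows "integrable lborel f"
proof -
  obtain M r where Mr: "f \<in> borel_measurable borel" "\<And>x. cmod (f x) \<le> M" "\<And>x. norm x > r \<Longrightarrow> f x = 0"
    by (rule bounded_supportE[OF assms]) blast
  show ?thesis
  proof (rule integrableI_bounded_set[where A = "cball 0 r" and B = M])
    show "emeasure lborel (cball 0 r :: 'a set) < \<infinity>"
      by (rule emeasure_compact_finite[OF compact_cball])
  qed (use Mr in auto)
qed

lemma bounded_support_L2: "f \<in> bounded_support \<Longrightarrow> f \<in> L2 aff2_haar"
  by (elim bounded_supportE) (rule L2_aff2_bounded_support)

definition slice :: "(real4 \<Rightarrow> complex) \<Rightarrow> real \<times> real \<Rightarrow> real \<times> real \<Rightarrow> complex" where
  "slice \<xi> A = (\<lambda>x. \<xi> (regroup (A, x)))"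

lemma norm_regroup [simp]: "norm (regroup z) = norm z"
  by (simp add: regroup_def norm_prod_def)

lemma norm_snd_le_norm: "norm (snd z) \<le> norm z"
  using norm_snd_le[of "snd z" "fst z"] by simp

lemma bounded_support_slice:
  assumes "\<xi> \<in> bounded_support"
  shows "slice \<xi> A \<in> bounded_support"
proof -
  obtain M r where [measurable]: "\<xi> \<in> borel_measurable borel" and Mr: "\<And>x. cmod (\<xi> x) \<le> M" "\<And>x. norm x > r \<Longrightarrow> \<xi> x = 0"
    by (rule bounded_supportE[OF assms]) blast
  show ?thesis
  proof (rule bounded_supportI)
    show "slice \<xi> A \<in> borel_measurable borel"
      unfolding slice_def by measurable
    show "cmod (slice \<xi> A x) \<le> M" for x
      by (simp add: slice_def Mr)
    show "slice \<xi> A x = 0" if "norm x > r" for x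
      using norm_snd_le_norm[of "(A, x)"] that by (simp add: slice_def Mr(2))
  qed
qed

lemma borel_measurable_fourier2_slice [measurable (raw)]:
  assumes [measurable]: "\<xi> \<in> borel_measurable borel" "f \<in> borel_measurable M" "g \<in> borel_measurable M"
  shows "(\<lambda>z. fourier2 (slice \<xi> (f z)) (g z)) \<in> borel_measurable M"
proof -
  have "(\<lambda>z. fourier2 (slice \<xi> (fst z)) (snd z)) \<in> borel_measurable borel"
    unfolding fourier2_def slice_def by measurable
  from measurable_compose[OF _ this, of "\<lambda>z. (f z, g z)" M] show ?thesis
    by simp
qed

text \<open>Bessel's inequality on each slice; the Haar weight depends on the slice alone, so
  integrating over the slices reassembles the norm of \<open>\<xi>\<close>.\<close>

lemma nn_integral_fourier2_slice_le:
  assumes \<xi>: "\<xi> \<in> bounded_support"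
  shows "(\<integral>\<^sup>+A. ennreal (haar_weight A) * (\<integral>\<^sup>+p. ennreal ((cmod (fourier2 (slice \<xi> A) p))\<^sup>2) \<partial>lborel) \<partial>lborel) \<le>
    ennreal ((2 * pi)\<^sup>2 * (L2_norm aff2_haar \<xi>)\<^sup>2)"
proof -
  have [measurable]: "\<xi> \<in> borel_measurable borel"
    using \<xi> by (rule bounded_support_measurable)
  have "(\<integral>\<^sup>+A. ennreal (haar_weight A) * (\<integral>\<^sup>+p. ennreal ((cmod (fourier2 (slice \<xi> A) p))\<^sup>2) \<partial>lborel) \<partial>lborel) \<le>
      (\<integral>\<^sup>+A. ennreal (haar_weight A) * (ennreal ((2 * pi)\<^sup>2) * (\<integral>\<^sup>+x. ennreal ((cmod (slice \<xi> A x))\<^sup>2) \<partial>lborel)) \<partial>lborel)"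
    by (intro nn_integral_mono mult_left_mono fourier2_Bessel integrable_bounded_support bounded_support_slice \<xi>) simp
  also have "\<dots> = (\<integral>\<^sup>+A. ennreal ((2 * pi)\<^sup>2) * (\<integral>\<^sup>+x. ennreal (haar_weight A) * ennreal ((cmod (\<xi> (regroup (A, x))))\<^sup>2) \<partial>lborel) \<partial>lborel)"
    by (intro nn_integral_cong) (simp add: nn_integral_cmult slice_def mult.left_commute)
  also have "\<dots> = ennreal ((2 * pi)\<^sup>2) * (\<integral>\<^sup>+A. \<integral>\<^sup>+x. ennreal (haar_weight A) * ennreal ((cmod (\<xi> (regroup (A, x))))\<^sup>2) \<partial>lborel \<partial>lborel)"
    by (rule nn_integral_cmult) measurable
  also have "(\<integral>\<^sup>+A. \<integral>\<^sup>+x. ennreal (haar_weight A) * ennreal ((cmod (\<xi> (regroup (A, x))))\<^sup>2) \<partial>lborel \<partial>lborel) =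
      (\<integral>\<^sup>+h. ennreal ((cmod (\<xi> h))\<^sup>2) \<partial>aff2_haar)"
    by (simp add: nn_integral_aff2_haar nn_integral_lborel_prod)
  finally show ?thesis
    by (simp add: L2_nn_integral[OF bounded_support_L2[OF \<xi>]] ennreal_mult)
qed

text \<open>The points \<open>(g, g\<^sup>-\<^sup>1)\<close> with \<open>g = (b, \<alpha>)\<close> all lie on the plane that \<open>coeff_slice u \<alpha>\<close> restricts \<open>u\<close> to.\<close>

definition coeff_slice ::
  "(real4 \<Rightarrow> complex) \<Rightarrow> real \<Rightarrow> real \<times> real \<Rightarrow> complex" where
  "coeff_slice u \<alpha> y = u ((fst y, \<alpha>), (snd y, - \<alpha>))"

text \<open>The sign in the exponent is opposite to that of \<open>fourier2\<close>, so that the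
  transform of a coefficient is expressed by \<open>\<xi>\<close> and the conjugate of
  \<open>\<eta>\<close> at frequencies without a change of sign.\<close>

definition coeff_slice_hat ::
  "(real4 \<Rightarrow> complex) \<Rightarrow> real \<Rightarrow> real \<times> real \<Rightarrow> complex" where
  "coeff_slice_hat u \<alpha> p = (LINT y|lborel. coeff_slice u \<alpha> y * cis (p \<bullet> y))"

lemma borel_measurable_coeff_slice [measurable (raw)]:
  assumes [measurable]: "u \<in> borel_measurable borel" "f \<in> borel_measurable M" "g \<in> borel_measurable M"
  shows "(\<lambda>z. coeff_slice u (f z) (g z)) \<in> borel_measurable M"
  unfolding coeff_slice_def by measurable

lemma borel_measurable_coeff_slice_hat [measurable (raw)]:
  assumes [measurable]: "u \<in> borel_measurable borel" "f \<in> borel_measurable M" "g \<in> borel_measurable M"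
  shows "(\<lambda>z. coeff_slice_hat u (f z) (g z)) \<in> borel_measurable M"
proof -
  have "(\<lambda>z. coeff_slice_hat u (fst z) (snd z)) \<in> borel_measurable borel"
    unfolding coeff_slice_hat_def by measurable
  from measurable_compose[OF _ this, of "\<lambda>z. (f z, g z)" M] show ?thesis
    by simp
qed

context
  fixes \<xi> \<eta> :: "real4 \<Rightarrow> complex"
  assumes \<xi>: "\<xi> \<in> bounded_support" and \<eta>: "\<eta> \<in> bounded_support"
begin

private lemma [measurable]: "\<xi> \<in> borel_measurable borel" "\<eta> \<in> borel_measurable borel"
  using \<xi> \<eta> by (simp_all add: bounded_support_measurable)

text \<open>The integrand of the coefficient at
  \<open>((fst y, \<alpha>), (snd y, - \<alpha>))\<close> in regrouped coordinates: translation
  shifts the \<open>a\<close>-coordinates and dilates the \<open>b\<close>-coordinates in opposite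
  senses in the two factors.\<close>

definition coeff_integrand :: "real \<Rightarrow> real \<times> real \<Rightarrow> real4 \<Rightarrow> complex" where
  "coeff_integrand \<alpha> y z = of_real (haar_weight (fst z)) *
    (slice \<xi> (fst (fst z) - \<alpha>, snd (fst z) + \<alpha>) (exp (- \<alpha>) * (fst (snd z) - fst y), exp \<alpha> * (snd (snd z) - snd y)) *
     cnj (slice \<eta> (fst z) (snd z)))"

lemma coeff_slice_eq:
  "coeff_slice (coefficient_fun aff2 aff2_haar \<xi> \<eta>) \<alpha> y = (LINT z|lborel. coeff_integrand \<alpha> y z)"
proof -
  let ?g = "((fst y, \<alpha>), (snd y, - \<alpha>))"
  have [measurable]: "left_regular aff2 ?g \<xi> \<in> borel_measurable borel"
    unfolding left_regular_aff2 by measurable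
  have "coefficient_fun aff2 aff2_haar \<xi> \<eta> ?g =
      (LINT z|lborel. of_real (haar_weight (fst z)) * (left_regular aff2 ?g \<xi> (regroup z) * cnj (\<eta> (regroup z))))"
    unfolding coefficient_fun_def L2_inner_def by (rule integral_aff2_haar) measurable
  then show ?thesis
    by (simp add: coeff_slice_def coeff_integrand_def left_regular_aff2 slice_def regroup_def)
qed

text \<open>Fubini needs integrability jointly in \<open>y\<close> and \<open>z\<close>. For fixed
  \<alpha> the dilations are bounded by exp |\<alpha>|, so the integrand is bounded with bounded
  support in all six real variables.\<close>

lemma integrable_coeff_integrand:
  "integrable lborel (\<lambda>w. coeff_integrand \<alpha> (fst w) (snd w))"
proof (rule integrable_bounded_support)
  obtain M r where M: "\<And>x. cmod (\<xi> x) \<le> M" "0 \<le> M" and r: "\<And>x. norm x > r \<Longrightarrow> \<xi> x = 0" "0 \<le> r"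
    by (rule bounded_supportE[OF \<xi>]) blast
  obtain M' r' where M': "\<And>x. cmod (\<eta> x) \<le> M'" "0 \<le> M'" and r': "\<And>x. norm x > r' \<Longrightarrow> \<eta> x = 0" "0 \<le> r'"
    by (rule bounded_supportE[OF \<eta>]) blast
  define E where "E = exp \<bar>\<alpha>\<bar>"
  show "(\<lambda>w. coeff_integrand \<alpha> (fst w) (snd w)) \<in> bounded_support"
  proof (rule bounded_supportI)
    show "(\<lambda>w. coeff_integrand \<alpha> (fst w) (snd w)) \<in> borel_measurable borel"
      unfolding coeff_integrand_def slice_def by measurable
    fix w :: "(real \<times> real) \<times> real4"
    obtain y A x where w: "w = (y, (A, x))" by (cases w; cases "snd w") auto
    let ?s = "slice \<xi> (fst A - \<alpha>, snd A + \<alpha>) (exp (- \<alpha>) * (fst x - fst y), exp \<alpha> * (snd x - snd y))"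
    have I: "coeff_integrand \<alpha> (fst w) (snd w) = of_real (haar_weight A) * (?s * cnj (slice \<eta> A x))"
      by (simp add: w coeff_integrand_def)
    show "cmod (coeff_integrand \<alpha> (fst w) (snd w)) \<le> exp (2 * r') * (M * M')"
    proof (cases "norm (A, x) \<le> r'")
      case True
      then have "haar_weight A \<le> exp (2 * r')"
        using abs_coordinate_le_norm[of "(A, x)"] by (simp add: haar_weight_def)
      then show ?thesis
        unfolding I norm_mult slice_def using M M' by (intro mult_mono) auto
    next
      case False
      then show ?thesis
        using M M' by (simp add: I slice_def r')
    qed
    \<comment> \<open>On the support, (A, x) and x have norm at most \<open>r'\<close>, and each
      coordinate of x - y is at most \<open>E * r\<close>; the bound follows from norm w \<le> norm
      y + norm (A, x).\<close>
    assume far: "norm w > 2 * r' + 2 * (E * r)"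
    show "coeff_integrand \<alpha> (fst w) (snd w) = 0"
    proof (rule ccontr)
      assume nz: "coeff_integrand \<alpha> (fst w) (snd w) \<noteq> 0"
      then have Ax: "norm (A, x) \<le> r'"
        using r'(1)[of "regroup (A, x)"] by (force simp: I slice_def)
      let ?k = "((fst A - \<alpha>, snd A + \<alpha>), (exp (- \<alpha>) * (fst x - fst y), exp \<alpha> * (snd x - snd y)))"
      have k: "norm ?k \<le> r"
        using nz r(1)[of "regroup ?k"] by (force simp: I slice_def)
      have E: "1 \<le> E" "exp \<alpha> \<le> E" "exp (- \<alpha>) \<le> E"
        by (auto simp: E_def)
      have "\<bar>exp (- \<alpha>) * (fst x - fst y)\<bar> \<le> r" "\<bar>exp \<alpha> * (snd x - snd y)\<bar> \<le> r"
        using abs_coordinate_le_norm(3,4)[of ?k] k by simp_all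
      then have "exp \<alpha> * \<bar>exp (- \<alpha>) * (fst x - fst y)\<bar> \<le> E * r" "exp (- \<alpha>) * \<bar>exp \<alpha> * (snd x - snd y)\<bar> \<le> E * r"
        using E r(2) by (auto intro!: mult_mono)
      then have "\<bar>fst x - fst y\<bar> \<le> E * r" "\<bar>snd x - snd y\<bar> \<le> E * r"
        by (simp_all add: abs_mult mult.assoc[symmetric] exp_add[symmetric])
      moreover have "norm (x - y) \<le> \<bar>fst x - fst y\<bar> + \<bar>snd x - snd y\<bar>"
        using norm_Pair_le[of "fst x - fst y" "snd x - snd y"] by (simp add: minus_prod_def)
      moreover have "norm y \<le> norm x + norm (x - y)"
        using norm_triangle_ineq4[of x "x - y"] by simp
      moreover have "norm x \<le> r'"
        using norm_snd_le_norm[of "(A, x)"] Ax by simp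
      moreover have "norm w \<le> norm y + norm (A, x)"
        unfolding w by (rule norm_Pair_le)
      ultimately show False
        using Ax far by linarith
    qed
  qed
qed

lemma integrable_coeff_slice:
  "integrable lborel (coeff_slice (coefficient_fun aff2 aff2_haar \<xi> \<eta>) \<alpha>)"
proof -
  have "integrable (lborel \<Otimes>\<^sub>M lborel) (\<lambda>(y, z). coeff_integrand \<alpha> y z)"
    using integrable_coeff_integrand by (simp add: lborel_prod case_prod_beta')
  from lborel_pair.integrable_fst[OF this] show ?thesis
    by (simp add: coeff_slice_eq[abs_def])
qed

text \<open>The slice of a coefficient is a convolution up to dilation. The substitution y = x -
  (exp \<alpha> * v1, exp (-\<alpha>) * v2), of Jacobian 1, separates the integral over
  \<open>y\<close> from the one over \<open>x\<close> and moves the dilation to the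
  frequency.\<close>

lemma coeff_slice_hat_eq:
  "coeff_slice_hat (coefficient_fun aff2 aff2_haar \<xi> \<eta>) \<alpha> p =
    (LINT A|lborel. of_real (haar_weight A) *
      (fourier2 (slice \<xi> (fst A - \<alpha>, snd A + \<alpha>)) (exp \<alpha> * fst p, exp (- \<alpha>) * snd p) *
       cnj (fourier2 (slice \<eta> A) p)))"
proof -
  let ?I = "\<lambda>y z. coeff_integrand \<alpha> y z * cis (p \<bullet> y)"
  have int: "integrable lborel (\<lambda>w. ?I (fst w) (snd w))"
    by (rule integrable_mult_bounded[OF integrable_coeff_integrand, where B = 1]) simp_all
  have int2: "integrable lborel (\<lambda>z. LINT y|lborel. ?I y z)"
    using lborel_pair.integrable_snd[of ?I] int by (simp add: lborel_prod case_prod_beta')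
  have inner: "(LINT y|lborel. ?I y (A, x)) = of_real (haar_weight A) *
      (fourier2 (slice \<xi> (fst A - \<alpha>, snd A + \<alpha>)) (exp \<alpha> * fst p, exp (- \<alpha>) * snd p) *
       cnj (slice \<eta> A x * cis (- (p \<bullet> x))))" for A x
  proof -
    let ?X = "slice \<xi> (fst A - \<alpha>, snd A + \<alpha>)"
    have [measurable]: "?X \<in> borel_measurable borel"
      unfolding slice_def by measurable
    have "(LINT y|lborel. ?X (exp (- \<alpha>) * (fst x - fst y), exp \<alpha> * (snd x - snd y)) * cis (p \<bullet> y)) =
        of_real \<bar>- exp \<alpha> * - exp (- \<alpha>)\<bar> * (LINT v|lborel.
          ?X (exp (- \<alpha>) * (fst x - fst (x + (- exp \<alpha> * fst v, - exp (- \<alpha>) * snd v))),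
              exp \<alpha> * (snd x - snd (x + (- exp \<alpha> * fst v, - exp (- \<alpha>) * snd v)))) *
          cis (p \<bullet> (x + (- exp \<alpha> * fst v, - exp (- \<alpha>) * snd v))))"
      by (rule integral_lborel_affine2) simp_all
    also have "\<dots> = (LINT v|lborel. cis (p \<bullet> x) * (?X v * cis (- ((exp \<alpha> * fst p, exp (- \<alpha>) * snd p) \<bullet> v))))"
    proof -
      have e: "exp (- \<alpha>) * (exp \<alpha> * t) = t" "exp \<alpha> * (exp (- \<alpha>) * t) = t" for t
        by (simp_all add: mult.assoc[symmetric] exp_add[symmetric])
      have "cis (p \<bullet> (x + (- exp \<alpha> * fst v, - exp (- \<alpha>) * snd v))) =
          cis (p \<bullet> x) * cis (- ((exp \<alpha> * fst p, exp (- \<alpha>) * snd p) \<bullet> v))" for v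
        by (simp add: cis_mult inner_add_right inner_prod_def algebra_simps)
      then show ?thesis
        by (simp add: e exp_add[symmetric] mult_ac)
    qed
    also have "\<dots> = cis (p \<bullet> x) * fourier2 ?X (exp \<alpha> * fst p, exp (- \<alpha>) * snd p)"
      by (simp add: fourier2_def)
    finally have eq1: "(LINT y|lborel. ?X (exp (- \<alpha>) * (fst x - fst y), exp \<alpha> * (snd x - snd y)) * cis (p \<bullet> y)) =
        cis (p \<bullet> x) * fourier2 ?X (exp \<alpha> * fst p, exp (- \<alpha>) * snd p)" .
    have eq2: "(LINT y|lborel. ?I y (A, x)) = (of_real (haar_weight A) * cnj (slice \<eta> A x)) *
        (LINT y|lborel. ?X (exp (- \<alpha>) * (fst x - fst y), exp \<alpha> * (snd x - snd y)) * cis (p \<bullet> y))"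
      by (subst integral_mult_right_zero[symmetric]) (simp add: coeff_integrand_def mult_ac)
    show ?thesis
      unfolding eq2 eq1 by (simp add: cis_cnj)
  qed
  have "coeff_slice_hat (coefficient_fun aff2 aff2_haar \<xi> \<eta>) \<alpha> p = (LINT y|lborel. LINT z|lborel. ?I y z)"
    by (simp add: coeff_slice_hat_def coeff_slice_eq)
  also have "\<dots> = (LINT z|lborel. LINT y|lborel. ?I y z)"
    by (rule Fubini_lborel[OF int])
  also have "\<dots> = (LINT A|lborel. LINT x|lborel. LINT y|lborel. ?I y (A, x))"
    by (rule integral_lborel_prod(1)[OF int2])
  also have "\<dots> = (LINT A|lborel. of_real (haar_weight A) *
      (fourier2 (slice \<xi> (fst A - \<alpha>, snd A + \<alpha>)) (exp \<alpha> * fst p, exp (- \<alpha>) * snd p) *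
       cnj (fourier2 (slice \<eta> A) p)))"
    unfolding inner by (simp add: fourier2_def del: complex_cnj_mult)
  finally show ?thesis .
qed

end

section \<open>The Schur test\<close>

text \<open>The factor coming from \<open>\<xi>\<close> depends on \<open>p\<close> only.
  Integrating the kernel over \<alpha> first therefore costs the constant \<open>C\<close> and
  leaves Bessel's bound.\<close>

lemma schur_half:
  fixes k :: "real \<Rightarrow> real \<times> real \<Rightarrow> real"
  assumes \<xi>: "\<xi> \<in> bounded_support"
    and k[measurable]: "(\<lambda>z. k (fst z) (snd z)) \<in> borel_measurable borel"
    and C: "\<And>p. (\<integral>\<^sup>+\<alpha>. ennreal (k \<alpha> p) \<partial>lborel) \<le> ennreal C" and "0 \<le> C"
  shows "(\<integral>\<^sup>+\<alpha>. \<integral>\<^sup>+p. ennreal (k \<alpha> p) *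
      (\<integral>\<^sup>+A. ennreal (haar_weight A) * ennreal ((cmod (fourier2 (slice \<xi> A) p))\<^sup>2) \<partial>lborel) \<partial>lborel \<partial>lborel) \<le>
    ennreal (C * ((2 * pi)\<^sup>2 * (L2_norm aff2_haar \<xi>)\<^sup>2))"
proof -
  have [measurable]: "\<xi> \<in> borel_measurable borel"
    using \<xi> by (rule bounded_support_measurable)
  have kp [measurable]: "(\<lambda>\<alpha>. k \<alpha> p) \<in> borel_measurable borel" for p
    using measurable_compose[OF _ k, of "\<lambda>\<alpha>. (\<alpha>, p)" borel] by simp
  define n where "n p = (\<integral>\<^sup>+A. ennreal (haar_weight A) * ennreal ((cmod (fourier2 (slice \<xi> A) p))\<^sup>2) \<partial>lborel)" for p
  have [measurable]: "n \<in> borel_measurable borel"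
    unfolding n_def by measurable
  have "(\<integral>\<^sup>+\<alpha>. \<integral>\<^sup>+p. ennreal (k \<alpha> p) * n p \<partial>lborel \<partial>lborel) = (\<integral>\<^sup>+p. \<integral>\<^sup>+\<alpha>. ennreal (k \<alpha> p) * n p \<partial>lborel \<partial>lborel)"
    by (rule nn_integral_lborel_swap) measurable
  also have "\<dots> = (\<integral>\<^sup>+p. (\<integral>\<^sup>+\<alpha>. ennreal (k \<alpha> p) \<partial>lborel) * n p \<partial>lborel)"
    by (simp add: nn_integral_multc)
  also have "\<dots> \<le> (\<integral>\<^sup>+p. ennreal C * n p \<partial>lborel)"
    by (intro nn_integral_mono mult_right_mono C) simp
  also have "\<dots> = ennreal C * (\<integral>\<^sup>+p. n p \<partial>lborel)"
    by (rule nn_integral_cmult) measurable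
  also have "(\<integral>\<^sup>+p. n p \<partial>lborel) =
      (\<integral>\<^sup>+A. \<integral>\<^sup>+p. ennreal (haar_weight A) * ennreal ((cmod (fourier2 (slice \<xi> A) p))\<^sup>2) \<partial>lborel \<partial>lborel)"
    unfolding n_def by (rule nn_integral_lborel_swap) measurable
  also have "\<dots> = (\<integral>\<^sup>+A. ennreal (haar_weight A) * (\<integral>\<^sup>+p. ennreal ((cmod (fourier2 (slice \<xi> A) p))\<^sup>2) \<partial>lborel) \<partial>lborel)"
    by (intro nn_integral_cong nn_integral_cmult) measurable
  also have "ennreal C * \<dots> \<le> ennreal C * ennreal ((2 * pi)\<^sup>2 * (L2_norm aff2_haar \<xi>)\<^sup>2)"
    by (intro mult_left_mono nn_integral_fourier2_slice_le \<xi>) simp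
  finally show ?thesis
    unfolding n_def using \<open>0 \<le> C\<close> by (simp add: ennreal_mult)
qed

text \<open>The opposite shifts preserve the sum of the two \<open>a\<close>-coordinates, hence the
  Haar weight.\<close>

lemma nn_integral_haar_weight_shift:
  assumes [measurable]: "g \<in> borel_measurable borel"
  shows "(\<integral>\<^sup>+A. ennreal (haar_weight A) * g (fst A - \<alpha>, snd A + \<alpha>) \<partial>lborel) =
    (\<integral>\<^sup>+A. ennreal (haar_weight A) * g A \<partial>lborel)"
proof -
  have "(\<integral>\<^sup>+A. ennreal (haar_weight A) * g A \<partial>lborel) = ennreal \<bar>1 * 1\<bar> *
      (\<integral>\<^sup>+A. ennreal (haar_weight ((- \<alpha>, \<alpha>) + (1 * fst A, 1 * snd A))) * g ((- \<alpha>, \<alpha>) + (1 * fst A, 1 * snd A)) \<partial>lborel)"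
    by (rule nn_integral_lborel_affine2) simp_all
  moreover have "(- \<alpha>, \<alpha>) + (1 * fst A, 1 * snd A) = (fst A - \<alpha>, snd A + \<alpha>)" for A :: "real \<times> real"
    by (simp add: plus_prod_def)
  moreover have "haar_weight (fst A - \<alpha>, snd A + \<alpha>) = haar_weight A" for A
    by (simp add: haar_weight_def)
  ultimately show ?thesis
    by simp
qed

text \<open>
  The two Schur bounds are the integrals of the kernel along the orbit
  \<open>\<alpha> \<mapsto> (exp \<alpha> * p, exp (- \<alpha>) * q)\<close>, started from either end.
\<close>

locale schur_kernel =
  fixes v1 v2 :: "real \<Rightarrow> complex" and C :: real
  assumes v1: "integrable lborel v1" and v2: "integrable lborel v2" and C: "0 \<le> C"
    and schur1: "\<And>q1 q2. (\<integral>\<^sup>+\<alpha>. ennreal (cmod (v2 \<alpha>) * (\<bar>exp (- \<alpha>) * q1\<bar> *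
      cmod (fourier_transform v1 (exp (- \<alpha>) * q1 - q2)))) \<partial>lborel) \<le> ennreal C"
    and schur2: "\<And>p1 p2. (\<integral>\<^sup>+\<alpha>. ennreal (cmod (v2 \<alpha>) * (\<bar>p1\<bar> *
      cmod (fourier_transform v1 (p1 - exp (- \<alpha>) * p2)))) \<partial>lborel) \<le> ennreal C"
begin

lemma v_measurable [measurable]: "v1 \<in> borel_measurable borel" "v2 \<in> borel_measurable borel"
  using v1 v2 by (auto dest: borel_measurable_integrable)

lemma v1_hat_measurable [measurable]: "fourier_transform v1 \<in> borel_measurable borel"
  unfolding fourier_transform_def[abs_def] by measurable

text \<open>The transform of \<open>v1\<close> enters because p . (\<beta>, - exp (-\<alpha>)
  \<beta>) = (p1 - exp (-\<alpha>) p2) \<beta> at the points (g, g^-1), so integrating over \<beta>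
  evaluates it. The multiplier of the difference quotient is kept out, so that one bound serves all
  steps \<open>e\<close>.\<close>

definition symbol :: "(real4 \<Rightarrow> complex) \<Rightarrow> real \<times> (real \<times> real) \<Rightarrow> complex" where
  "symbol u z = v2 (fst z) * fourier_transform v1 (fst (snd z) - exp (- fst z) * snd (snd z)) *
    coeff_slice_hat u (fst z) (snd z)"

lemma symbol_measurable [measurable]:
  assumes [measurable]: "u \<in> borel_measurable borel"
  shows "symbol u \<in> borel_measurable borel"
  unfolding symbol_def by measurable

text \<open>The arithmetic-geometric mean inequality splits the product in
  \<open>coeff_slice_hat_eq\<close> into two squares, and each square meets one of the two Schur
  bounds. The factor (2 pi)^2 is that of Bessel's inequality.\<close>

lemma nn_integral_symbol_le:
  assumes \<xi>: "\<xi> \<in> bounded_support" and \<eta>: "\<eta> \<in> bounded_support"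
  shows "2 * (\<integral>\<^sup>+z. ennreal (\<bar>fst (snd z)\<bar> * cmod (symbol (coefficient_fun aff2 aff2_haar \<xi> \<eta>) z)) \<partial>lborel) \<le>
    ennreal (C * ((2 * pi)\<^sup>2 * ((L2_norm aff2_haar \<xi>)\<^sup>2 + (L2_norm aff2_haar \<eta>)\<^sup>2)))"
proof -
  have [measurable]: "\<xi> \<in> borel_measurable borel" "\<eta> \<in> borel_measurable borel"
    using \<xi> \<eta> by (simp_all add: bounded_support_measurable)
  define u where "u = coefficient_fun aff2 aff2_haar \<xi> \<eta>"
  have [measurable]: "u \<in> borel_measurable borel"
    unfolding u_def by (intro borel_measurable_coefficient_fun_aff2 bounded_support_L2 \<xi> \<eta>)
  define k where "k \<alpha> p = cmod (v2 \<alpha>) * (\<bar>fst p\<bar> * cmod (fourier_transform v1 (fst p - exp (- \<alpha>) * snd p)))"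
    for \<alpha> :: real and p :: "real \<times> real"
  have [measurable]: "(\<lambda>z. k (fst z) (snd z)) \<in> borel_measurable borel"
    unfolding k_def by measurable
  have km [measurable]: "(\<lambda>p. k \<alpha> p) \<in> borel_measurable borel" for \<alpha>
    unfolding k_def by measurable
  have [measurable (raw)]: "(\<lambda>x. k (f x) (g x)) \<in> borel_measurable M"
    if [measurable]: "f \<in> borel_measurable M" "g \<in> borel_measurable M" for f g and M :: "(real \<times> (real \<times> real)) measure"
    unfolding k_def by measurable
  define X where "X \<alpha> A p = fourier2 (slice \<xi> (fst A - \<alpha>, snd A + \<alpha>)) (exp \<alpha> * fst p, exp (- \<alpha>) * snd p)"
    for \<alpha> and A p :: "real \<times> real"
  define N where "N A p = fourier2 (slice \<eta> A) p" for A p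
  have [measurable]: "(\<lambda>A. X \<alpha> A p) \<in> borel_measurable borel" "(\<lambda>A. N A p) \<in> borel_measurable borel" for \<alpha> p
    unfolding X_def N_def by measurable
  define a where "a \<alpha> p = (\<integral>\<^sup>+A. ennreal (haar_weight A) * ennreal ((cmod (X \<alpha> A p))\<^sup>2) \<partial>lborel)" for \<alpha> p
  define b where "b p = (\<integral>\<^sup>+A. ennreal (haar_weight A) * ennreal ((cmod (N A p))\<^sup>2) \<partial>lborel)" for p
  have [measurable]: "(\<lambda>z. a (fst z) (snd z)) \<in> borel_measurable borel" "b \<in> borel_measurable borel"
    "(\<lambda>p. a \<alpha> p) \<in> borel_measurable borel" for \<alpha>
    unfolding a_def b_def X_def N_def by measurable
  have [measurable (raw)]: "(\<lambda>x. a (f x) (g x)) \<in> borel_measurable M"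
    if [measurable]: "f \<in> borel_measurable M" "g \<in> borel_measurable M" for f g and M :: "(real \<times> (real \<times> real)) measure"
    unfolding a_def X_def by measurable
  have V: "2 * ennreal (cmod (coeff_slice_hat u \<alpha> p)) \<le> a \<alpha> p + b p" for \<alpha> p
  proof -
    have "2 * ennreal (cmod (coeff_slice_hat u \<alpha> p)) \<le>
        2 * (\<integral>\<^sup>+A. ennreal (cmod (of_real (haar_weight A) * (X \<alpha> A p * cnj (N A p)))) \<partial>lborel)"
      unfolding u_def coeff_slice_hat_eq[OF \<xi> \<eta>] X_def N_def
      by (intro mult_left_mono ennreal_norm_integral_le) simp
    also have "\<dots> = (\<integral>\<^sup>+A. 2 * ennreal (cmod (of_real (haar_weight A) * (X \<alpha> A p * cnj (N A p)))) \<partial>lborel)"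
      by (rule nn_integral_cmult[symmetric]) measurable
    also have "\<dots> \<le> (\<integral>\<^sup>+A. ennreal (haar_weight A) * ennreal ((cmod (X \<alpha> A p))\<^sup>2) +
        ennreal (haar_weight A) * ennreal ((cmod (N A p))\<^sup>2) \<partial>lborel)"
    proof (rule nn_integral_mono)
      fix A
      have "haar_weight A * (2 * cmod (X \<alpha> A p * cnj (N A p))) \<le>
          haar_weight A * ((cmod (X \<alpha> A p))\<^sup>2 + (cmod (N A p))\<^sup>2)"
        by (intro mult_left_mono cmod_mult_cnj_le) simp
      then have "2 * cmod (of_real (haar_weight A) * (X \<alpha> A p * cnj (N A p))) \<le>
          haar_weight A * (cmod (X \<alpha> A p))\<^sup>2 + haar_weight A * (cmod (N A p))\<^sup>2"
        by (simp add: norm_mult algebra_simps)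
      then have "ennreal (2 * cmod (of_real (haar_weight A) * (X \<alpha> A p * cnj (N A p)))) \<le>
          ennreal (haar_weight A * (cmod (X \<alpha> A p))\<^sup>2 + haar_weight A * (cmod (N A p))\<^sup>2)"
        by (rule ennreal_leI)
      then show "2 * ennreal (cmod (of_real (haar_weight A) * (X \<alpha> A p * cnj (N A p)))) \<le>
          ennreal (haar_weight A) * ennreal ((cmod (X \<alpha> A p))\<^sup>2) + ennreal (haar_weight A) * ennreal ((cmod (N A p))\<^sup>2)"
        by (simp only: ennreal_mult ennreal_plus ennreal_numeral norm_ge_zero mult_nonneg_nonneg zero_le_power2
            haar_weight_pos zero_le_numeral)
    qed
    also have "\<dots> = a \<alpha> p + b p"
      unfolding a_def b_def by (rule nn_integral_add) measurable
    finally show ?thesis .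
  qed
  have "2 * (\<integral>\<^sup>+z. ennreal (\<bar>fst (snd z)\<bar> * cmod (symbol u z)) \<partial>lborel) =
      2 * (\<integral>\<^sup>+\<alpha>. \<integral>\<^sup>+p. ennreal (k \<alpha> p) * ennreal (cmod (coeff_slice_hat u \<alpha> p)) \<partial>lborel \<partial>lborel)"
    by (subst nn_integral_lborel_prod)
      (simp_all add: symbol_def k_def norm_mult mult_ac flip: ennreal_mult)
  also have "\<dots> = (\<integral>\<^sup>+\<alpha>. \<integral>\<^sup>+p. ennreal (k \<alpha> p) * (2 * ennreal (cmod (coeff_slice_hat u \<alpha> p))) \<partial>lborel \<partial>lborel)"
    by (simp add: nn_integral_cmult mult.left_commute)
  also have "\<dots> \<le> (\<integral>\<^sup>+\<alpha>. \<integral>\<^sup>+p. ennreal (k \<alpha> p) * a \<alpha> p + ennreal (k \<alpha> p) * b p \<partial>lborel \<partial>lborel)"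
    unfolding distrib_left[symmetric] by (intro nn_integral_mono mult_left_mono V) simp
  also have "\<dots> = (\<integral>\<^sup>+\<alpha>. \<integral>\<^sup>+p. ennreal (k \<alpha> p) * a \<alpha> p \<partial>lborel \<partial>lborel) + (\<integral>\<^sup>+\<alpha>. \<integral>\<^sup>+p. ennreal (k \<alpha> p) * b p \<partial>lborel \<partial>lborel)"
    by (simp add: nn_integral_add)
  also have "\<dots> \<le> ennreal (C * ((2 * pi)\<^sup>2 * (L2_norm aff2_haar \<xi>)\<^sup>2)) + ennreal (C * ((2 * pi)\<^sup>2 * (L2_norm aff2_haar \<eta>)\<^sup>2))"
  proof (rule add_mono)
    show "(\<integral>\<^sup>+\<alpha>. \<integral>\<^sup>+p. ennreal (k \<alpha> p) * b p \<partial>lborel \<partial>lborel) \<le> ennreal (C * ((2 * pi)\<^sup>2 * (L2_norm aff2_haar \<eta>)\<^sup>2))"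
      unfolding b_def N_def
    proof (rule schur_half[OF \<eta> _ _ C])
      show "(\<integral>\<^sup>+\<alpha>. ennreal (k \<alpha> p) \<partial>lborel) \<le> ennreal C" for p
        unfolding k_def by (rule schur2)
    qed measurable
    \<comment> \<open>The kernel in the variable q = (exp \<alpha> * p1, exp (-\<alpha>) * p2),
      where the contribution of \<open>\<xi>\<close> no longer depends on \<alpha>;
      \<open>schur1\<close> bounds it.\<close>
    define k' where "k' \<alpha> q = cmod (v2 \<alpha>) * (\<bar>exp (- \<alpha>) * fst q\<bar> * cmod (fourier_transform v1 (exp (- \<alpha>) * fst q - snd q)))"
      for \<alpha> :: real and q :: "real \<times> real"
    have "(\<integral>\<^sup>+p. ennreal (k \<alpha> p) * a \<alpha> p \<partial>lborel) = (\<integral>\<^sup>+q. ennreal (k' \<alpha> q) *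
        (\<integral>\<^sup>+A. ennreal (haar_weight A) * ennreal ((cmod (fourier2 (slice \<xi> A) q))\<^sup>2) \<partial>lborel) \<partial>lborel)" for \<alpha>
    proof -
      have a: "a \<alpha> p = (\<integral>\<^sup>+A. ennreal (haar_weight A) *
          ennreal ((cmod (fourier2 (slice \<xi> A) (exp \<alpha> * fst p, exp (- \<alpha>) * snd p)))\<^sup>2) \<partial>lborel)" for p
        unfolding a_def X_def
        by (rule nn_integral_haar_weight_shift[of "\<lambda>A. ennreal ((cmod (fourier2 (slice \<xi> A) _))\<^sup>2)"]) measurable
      have "(\<integral>\<^sup>+p. ennreal (k \<alpha> p) * a \<alpha> p \<partial>lborel) = ennreal \<bar>exp (- \<alpha>) * exp \<alpha>\<bar> *
          (\<integral>\<^sup>+q. ennreal (k \<alpha> (0 + (exp (- \<alpha>) * fst q, exp \<alpha> * snd q))) * a \<alpha> (0 + (exp (- \<alpha>) * fst q, exp \<alpha> * snd q)) \<partial>lborel)"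
        by (rule nn_integral_lborel_affine2) simp_all
      also have "\<dots> = (\<integral>\<^sup>+q. ennreal (k' \<alpha> q) *
          (\<integral>\<^sup>+A. ennreal (haar_weight A) * ennreal ((cmod (fourier2 (slice \<xi> A) q))\<^sup>2) \<partial>lborel) \<partial>lborel)"
        by (simp add: a k_def k'_def mult.assoc[symmetric] exp_add[symmetric])
      finally show ?thesis .
    qed
    then have "(\<integral>\<^sup>+\<alpha>. \<integral>\<^sup>+p. ennreal (k \<alpha> p) * a \<alpha> p \<partial>lborel \<partial>lborel) = (\<integral>\<^sup>+\<alpha>. \<integral>\<^sup>+q. ennreal (k' \<alpha> q) *
        (\<integral>\<^sup>+A. ennreal (haar_weight A) * ennreal ((cmod (fourier2 (slice \<xi> A) q))\<^sup>2) \<partial>lborel) \<partial>lborel \<partial>lborel)"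
      by simp
    also have "\<dots> \<le> ennreal (C * ((2 * pi)\<^sup>2 * (L2_norm aff2_haar \<xi>)\<^sup>2))"
    proof (rule schur_half[OF \<xi> _ _ C])
      show "(\<integral>\<^sup>+\<alpha>. ennreal (k' \<alpha> q) \<partial>lborel) \<le> ennreal C" for q
        unfolding k'_def by (rule schur1)
      show "(\<lambda>z. k' (fst z) (snd z)) \<in> borel_measurable borel"
        unfolding k'_def by measurable
    qed
    finally show "(\<integral>\<^sup>+\<alpha>. \<integral>\<^sup>+p. ennreal (k \<alpha> p) * a \<alpha> p \<partial>lborel \<partial>lborel) \<le> ennreal (C * ((2 * pi)\<^sup>2 * (L2_norm aff2_haar \<xi>)\<^sup>2))" .
  qed
  also have "\<dots> = ennreal (C * ((2 * pi)\<^sup>2 * ((L2_norm aff2_haar \<xi>)\<^sup>2 + (L2_norm aff2_haar \<eta>)\<^sup>2)))"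
    using C by (simp add: ennreal_plus[symmetric] distrib_left del: ennreal_plus)
  finally show ?thesis
    unfolding u_def .
qed

end

section \<open>The approximating functionals\<close>

text \<open>The Fourier multiplier of \<open>diff_quotient\<close> averaged over a Gaussian
  \<open>s\<close>: the factor from \<open>gauss2_average_eq\<close> times the multiplier of a
  difference quotient with step \<open>e\<close> in the first coordinate.\<close>

definition gauss_quotient :: "real \<Rightarrow> real \<times> real \<Rightarrow> complex" where
  "gauss_quotient e p = of_real (gauss2 (e *\<^sub>R p) / (2 * pi)) * ((cis (- (fst p * e)) - 1) / of_real e)"

lemma gauss_quotient_measurable [measurable]: "gauss_quotient e \<in> borel_measurable borel"
  unfolding gauss_quotient_def by measurable

lemma cmod_cis_minus_1_le: "cmod (cis t - 1) \<le> \<bar>t\<bar>"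
  using iexp_approx1[of t 0] by (simp add: cis_conv_exp)

text \<open>The Gaussian factor is at most (2 pi)^-2 and the difference quotient of
  \<open>cis\<close> at most |p1|, both uniformly in \<open>e\<close>. This is the growth that the
  weight in \<open>nn_integral_symbol_le\<close> absorbs.\<close>

lemma cmod_gauss_quotient_le:
  assumes "e > 0"
  shows "cmod (gauss_quotient e p) \<le> \<bar>fst p\<bar> / (2 * pi)\<^sup>2"
proof -
  have "gauss2 x / (2 * pi) \<le> 1 / (2 * pi)\<^sup>2" for x
  proof -
    have "gauss2 x / (2 * pi) = exp (- (x \<bullet> x) / 2) / (2 * pi)\<^sup>2"
      by (simp add: gauss2_eq power2_eq_square)
    also have "\<dots> \<le> 1 / (2 * pi)\<^sup>2"
      by (intro divide_right_mono) auto
    finally show ?thesis .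
  qed
  moreover have "cmod ((cis (- (fst p * e)) - 1) / of_real e) \<le> \<bar>fst p\<bar>"
    using cmod_cis_minus_1_le[of "- (fst p * e)"] assms
    by (simp add: norm_divide abs_mult divide_le_eq)
  ultimately have "gauss2 (e *\<^sub>R p) / (2 * pi) * cmod ((cis (- (fst p * e)) - 1) / of_real e) \<le> 1 / (2 * pi)\<^sup>2 * \<bar>fst p\<bar>"
    by (intro mult_mono) auto
  then show ?thesis
    unfolding gauss_quotient_def norm_mult norm_of_real
    by (subst abs_of_nonneg) (simp_all only: gauss2_nonneg divide_nonneg_pos mult_1 times_divide_eq_left, simp_all)
qed

lemma gauss_quotient_tendsto:
  "(\<lambda>n. gauss_quotient (1 / real (Suc n)) p) \<longlonglongrightarrow> - (\<i> * of_real (fst p)) / of_real ((2 * pi)\<^sup>2)"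
proof -
  let ?e = "\<lambda>n. 1 / real (Suc n)"
  have e: "?e \<longlonglongrightarrow> 0"
    by (rule LIMSEQ_Suc[OF lim_1_over_n])
  have "(\<lambda>n. (cis (- (fst p * ?e n)) - 1) / of_real (?e n) - - (\<i> * of_real (fst p))) \<longlonglongrightarrow> 0"
  proof (rule Lim_null_comparison)
    show "\<forall>\<^sub>F n in sequentially. norm ((cis (- (fst p * ?e n)) - 1) / of_real (?e n) - - (\<i> * of_real (fst p))) \<le>
        (fst p)\<^sup>2 / 2 * ?e n"
    proof (intro always_eventually allI)
      fix n
      define d where "d = ?e n"
      have d: "d > 0" by (simp add: d_def)
      have le: "cmod (cis (- (fst p * d)) - (1 + \<i> * of_real (- (fst p * d)))) \<le> (fst p * d)\<^sup>2 / 2"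
        using iexp_approx1[of "- (fst p * d)" 1] by (simp add: cis_conv_exp numeral_2_eq_2 algebra_simps)
      have "(cis (- (fst p * d)) - 1) / of_real d - - (\<i> * of_real (fst p)) =
          (cis (- (fst p * d)) - (1 + \<i> * of_real (- (fst p * d)))) / of_real d"
        using d by (simp add: field_simps)
      then have "cmod ((cis (- (fst p * d)) - 1) / of_real d - - (\<i> * of_real (fst p))) =
          cmod (cis (- (fst p * d)) - (1 + \<i> * of_real (- (fst p * d)))) / d"
        using d by (simp only: norm_divide norm_of_real abs_of_pos)
      also have "\<dots> \<le> (fst p * d)\<^sup>2 / 2 / d"
        using le d by (intro divide_right_mono) auto
      also have "\<dots> = (fst p)\<^sup>2 / 2 * d"
        using d by (simp add: power2_eq_square)
      finally show "norm ((cis (- (fst p * ?e n)) - 1) / of_real (?e n) - - (\<i> * of_real (fst p))) \<le> (fst p)\<^sup>2 / 2 * ?e n"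
        unfolding d_def .
    qed
    show "(\<lambda>n. (fst p)\<^sup>2 / 2 * ?e n) \<longlonglongrightarrow> 0"
      using tendsto_mult_left[OF e, of "(fst p)\<^sup>2 / 2"] by simp
  qed
  then have 1: "(\<lambda>n. (cis (- (fst p * ?e n)) - 1) / of_real (?e n)) \<longlonglongrightarrow> - (\<i> * of_real (fst p))"
    by (rule LIM_zero_cancel)
  have "(\<lambda>n. exp (- (?e n * (?e n * (p \<bullet> p))) / 2) / (2 * pi) / (2 * pi)) \<longlonglongrightarrow> exp (- (0 * (0 * (p \<bullet> p))) / 2) / (2 * pi) / (2 * pi)"
    by (intro tendsto_mult tendsto_exp tendsto_divide tendsto_minus tendsto_const e) simp_all
  then have 2: "(\<lambda>n. gauss2 (?e n *\<^sub>R p) / (2 * pi)) \<longlonglongrightarrow> 1 / (2 * pi)\<^sup>2"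
    unfolding gauss2_eq inner_scaleR_left inner_scaleR_right by (simp add: power2_eq_square)
  have "(\<lambda>n. gauss_quotient (?e n) p) \<longlonglongrightarrow> of_real (1 / (2 * pi)\<^sup>2) * - (\<i> * of_real (fst p))"
    unfolding gauss_quotient_def by (intro tendsto_mult tendsto_of_real 1 2)
  then show ?thesis
    by (simp only: of_real_divide of_real_1 times_divide_eq_left mult_1)
qed

text \<open>
  This approximates the derivative along \<open>Y\<close> at \<open>(g, g\<^sup>-\<^sup>1)\<close> with \<open>g = (\<beta>, \<alpha>)\<close>, up to the factor \<open>exp \<alpha>\<close>
  that the density of the Haar measure cancels. The point is shifted by \<open>e *\<^sub>R s\<close>, where \<open>s\<close> will
  be Gaussian, so \<open>e\<close> is both the step and the scale of the mollification.
\<close>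

definition diff_quotient ::
  "real \<Rightarrow> (real4 \<Rightarrow> complex) \<Rightarrow> real \<Rightarrow> real \<Rightarrow> real \<times> real \<Rightarrow> complex" where
  "diff_quotient e u \<alpha> \<beta> s =
    (coeff_slice u \<alpha> ((\<beta> + e, - exp (- \<alpha>) * \<beta>) + e *\<^sub>R s) - coeff_slice u \<alpha> ((\<beta>, - exp (- \<alpha>) * \<beta>) + e *\<^sub>R s)) / of_real e"

lemma diff_quotient_measurable [measurable (raw)]:
  assumes [measurable]: "u \<in> borel_measurable borel" "f \<in> borel_measurable M" "g \<in> borel_measurable M" "h \<in> borel_measurable M"
  shows "(\<lambda>z. diff_quotient e u (f z) (g z) (h z)) \<in> borel_measurable M"
  unfolding diff_quotient_def by measurable

lemma cmod_diff_quotient_le: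
  assumes "\<And>x. cmod (u x) \<le> B" "e > 0"
  shows "cmod (diff_quotient e u \<alpha> \<beta> s) \<le> 2 * B / e"
proof -
  have "cmod (coeff_slice u \<alpha> x - coeff_slice u \<alpha> y) \<le> 2 * B" for x y
    using norm_triangle_ineq4[of "coeff_slice u \<alpha> x" "coeff_slice u \<alpha> y"]
      assms(1)[of "((fst x, \<alpha>), (snd x, - \<alpha>))"] assms(1)[of "((fst y, \<alpha>), (snd y, - \<alpha>))"]
    by (simp add: coeff_slice_def)
  then show ?thesis
    using assms(2) unfolding diff_quotient_def norm_divide by (simp add: divide_right_mono)
qed

lemma diff_quotient_add:
  "diff_quotient e (\<lambda>x. u x + w x) \<alpha> \<beta> s = diff_quotient e u \<alpha> \<beta> s + diff_quotient e w \<alpha> \<beta> s"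
  unfolding diff_quotient_def coeff_slice_def add_divide_distrib[symmetric] by (rule arg_cong[where f = "\<lambda>x. x / _"]) simp

lemma diff_quotient_cmult: "diff_quotient e (\<lambda>x. c * u x) \<alpha> \<beta> s = c * diff_quotient e u \<alpha> \<beta> s"
  by (simp only: diff_quotient_def coeff_slice_def right_diff_distrib[symmetric] times_divide_eq_right)

context schur_kernel
begin

text \<open>The mollification variable is carried along as a further integration variable, so that
  step and mollification disappear in one passage to the limit.\<close>

definition density_fun :: "real \<times> real \<times> (real \<times> real) \<Rightarrow> complex" where
  "density_fun z = v2 (fst z) * (v1 (fst (snd z)) * of_real (gauss2 (snd (snd z))))"

lemma integrable_density_fun: "integrable lborel density_fun"
  unfolding density_fun_def[abs_def]
  by (rule integrable_lborel_prod_mult[OF v2 integrable_lborel_prod_mult[OF v1 integrable_gauss2]])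

text \<open>Given by the values of \<open>u\<close> alone, so it makes sense for every bounded
  measurable \<open>u\<close> and does not see the vectors behind a coefficient.\<close>

definition approx_functional :: "real \<Rightarrow> (real4 \<Rightarrow> complex) \<Rightarrow> complex" where
  "approx_functional e u = (LINT z|lborel. density_fun z * diff_quotient e u (fst z) (fst (snd z)) (snd (snd z)))"

lemma approx_integrable:
  assumes [measurable]: "u \<in> borel_measurable borel" and "\<And>x. cmod (u x) \<le> B" "e > 0"
  shows "integrable lborel (\<lambda>z. density_fun z * diff_quotient e u (fst z) (fst (snd z)) (snd (snd z)))"
  by (rule integrable_mult_bounded[OF integrable_density_fun _ cmod_diff_quotient_le[OF assms(2,3)]]) simp

lemma approx_functional_add:
  assumes "u \<in> borel_measurable borel" "\<And>x. cmod (u x) \<le> B" "w \<in> borel_measurable borel" "\<And>x. cmod (w x) \<le> B'" "e > 0"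
  shows "approx_functional e (\<lambda>x. u x + w x) = approx_functional e u + approx_functional e w"
  using Bochner_Integration.integral_add[OF approx_integrable[OF assms(1,2,5)] approx_integrable[OF assms(3,4,5)]]
  by (simp only: approx_functional_def diff_quotient_add distrib_left)

lemma approx_functional_cmult: "approx_functional e (\<lambda>x. c * u x) = c * approx_functional e u"
  unfolding approx_functional_def diff_quotient_cmult
  by (simp only: mult.left_commute[of _ c] integral_mult_right_zero)

lemma cmod_approx_functional_le:
  assumes "\<And>x. cmod (u x) \<le> B" "e > 0"
  shows "cmod (approx_functional e u) \<le> (LINT z|lborel. cmod (density_fun z)) * (2 * B / e)"
proof -
  have "cmod (approx_functional e u) \<le> (LINT z|lborel. cmod (density_fun z * diff_quotient e u (fst z) (fst (snd z)) (snd (snd z))))"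
    unfolding approx_functional_def by (rule integral_norm_bound)
  also have "\<dots> \<le> (LINT z|lborel. cmod (density_fun z) * (2 * B / e))"
  proof (rule Bochner_Integration.integral_mono')
    show "integrable lborel (\<lambda>z. cmod (density_fun z) * (2 * B / e))"
      by (intro integrable_mult_left integrable_norm integrable_density_fun)
    show "cmod (density_fun z * diff_quotient e u (fst z) (fst (snd z)) (snd (snd z))) \<le> cmod (density_fun z) * (2 * B / e)" for z
      unfolding norm_mult by (intro mult_left_mono cmod_diff_quotient_le assms) simp
    have "0 \<le> B"
      using norm_ge_zero assms(1)[of 0] by (rule order_trans)
    then show "0 \<le> cmod (density_fun z) * (2 * B / e)" for z
      using assms(2) by simp
  qed
  finally show ?thesis
    by simp
qed

text \<open>For fixed \<alpha>, \<open>gauss2_average_eq\<close> turns the Gaussian averages at the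
  two points of the difference quotient into integrals over \<open>p\<close>; exchanging these with
  the integral over \<beta> produces the transform of \<open>v1\<close>.\<close>

lemma approx_functional_eq:
  assumes \<xi>: "\<xi> \<in> bounded_support" and \<eta>: "\<eta> \<in> bounded_support" and e: "e > 0"
  defines "u \<equiv> coefficient_fun aff2 aff2_haar \<xi> \<eta>"
  shows "integrable lborel (\<lambda>z. of_real \<bar>fst (snd z)\<bar> * symbol u z)"
    and "approx_functional e u = (LINT z|lborel. gauss_quotient e (snd z) * symbol u z)"
proof -
  define B where "B = L2_norm aff2_haar \<xi> * L2_norm aff2_haar \<eta>"
  have B: "cmod (u x) \<le> B" for x
    unfolding u_def B_def by (intro cmod_coefficient_fun_aff2_le bounded_support_L2 \<xi> \<eta>)
  have um[measurable]: "u \<in> borel_measurable borel"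
    unfolding u_def by (intro borel_measurable_coefficient_fun_aff2 bounded_support_L2 \<xi> \<eta>)
  have U: "integrable lborel (coeff_slice u \<alpha>)" for \<alpha>
    unfolding u_def by (rule integrable_coeff_slice[OF \<xi> \<eta>])
  have Ub: "cmod (coeff_slice u \<alpha> y) \<le> B" for \<alpha> y
    by (simp add: coeff_slice_def B)
  show int_symbol: "integrable lborel (\<lambda>z. of_real \<bar>fst (snd z)\<bar> * symbol u z)"
  proof (rule integrableI_bounded)
    have "2 * (\<integral>\<^sup>+z. ennreal (\<bar>fst (snd z)\<bar> * cmod (symbol u z)) \<partial>lborel) < \<infinity>"
      unfolding u_def by (rule le_less_trans[OF nn_integral_symbol_le[OF \<xi> \<eta>]]) simp
    then show "(\<integral>\<^sup>+z. ennreal (norm (of_real \<bar>fst (snd z)\<bar> * symbol u z)) \<partial>lborel) < \<infinity>"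
      by (auto simp: norm_mult ennreal_mult_less_top)
  qed measurable
  have int_gq: "integrable lborel (\<lambda>z. gauss_quotient e (snd z) * symbol u z)"
  proof (rule Bochner_Integration.integrable_bound[OF int_symbol])
    show "AE z in lborel. norm (gauss_quotient e (snd z) * symbol u z) \<le> norm (of_real \<bar>fst (snd z)\<bar> * symbol u z)"
    proof (rule AE_I2)
      fix z :: "real \<times> real \<times> real"
      have "cmod (gauss_quotient e (snd z)) \<le> \<bar>fst (snd z)\<bar> / (2 * pi)\<^sup>2"
        by (rule cmod_gauss_quotient_le[OF e])
      \<comment> \<open>Only integrability is at stake here, so the constant is weakened to
        1.\<close>
      also have "\<dots> \<le> \<bar>fst (snd z)\<bar> / 1"
      proof -
        have "1 \<le> 2 * pi"
          using pi_gt3 by linarith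
        then have "1 \<le> (2 * pi)\<^sup>2"
          by (rule one_le_power)
        then show ?thesis
          by (intro divide_left_mono) auto
      qed
      finally show "norm (gauss_quotient e (snd z) * symbol u z) \<le> norm (of_real \<bar>fst (snd z)\<bar> * symbol u z)"
        unfolding norm_mult by (intro mult_right_mono) auto
    qed
  qed measurable
  have inner: "(LINT w|lborel. density_fun (\<alpha>, w) * diff_quotient e u \<alpha> (fst w) (snd w)) =
      (LINT p|lborel. gauss_quotient e p * symbol u (\<alpha>, p))" for \<alpha>
  proof -
    let ?U = "coeff_slice u \<alpha>" and ?V = "coeff_slice_hat u \<alpha>"
    define c where "c \<beta> = (\<beta>, - exp (- \<alpha>) * \<beta>)" for \<beta>
    define G where "G p = complex_of_real (gauss2 (e *\<^sub>R p) / (2 * pi))" for p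
    have V: "cmod (?V p) \<le> (LINT y|lborel. cmod (?U y))" for p
      unfolding coeff_slice_hat_def by (rule order_trans[OF integral_norm_bound]) (simp add: norm_mult)
    have G: "integrable lborel G"
      unfolding G_def using integrable_gauss2_scaled[OF e] by simp
    have GV: "integrable lborel (\<lambda>p. G p * cis (h p) * ?V p)" if [measurable]: "h \<in> borel_measurable borel" for h
    proof -
      have "integrable lborel (\<lambda>p. G p * cis (h p))"
        by (rule integrable_mult_bounded[OF G, where B = 1]) simp_all
      then show ?thesis
        by (rule integrable_mult_bounded[OF _ _ V]) simp
    qed
    have gU: "integrable lborel (\<lambda>s. of_real (gauss2 s) * ?U (x + e *\<^sub>R s))" for x
      by (rule integrable_mult_bounded[OF integrable_gauss2 _ Ub]) simp
    have avg: "(LINT s|lborel. of_real (gauss2 s) * ?U (x + e *\<^sub>R s)) = (LINT p|lborel. G p * cis (- (p \<bullet> x)) * ?V p)" for x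
      unfolding G_def coeff_slice_hat_def by (rule gauss2_average_eq[OF U e])
    \<comment> \<open>The subtracted term is written with \<open>cis 0\<close> to have the shape
      covered by \<open>GV\<close>.\<close>
    have alg1: "g * ((c - 1) / d) * w = (g * c * w - g * cis 0 * w) / d" for g c d w :: complex
      by (cases "d = 0") (simp_all add: field_simps)
    have alg2: "(g * (c * c') * w - g * c' * w) / d = (g * c * w - g * cis 0 * w) / d * c'" for g c c' d w :: complex
      by (cases "d = 0") (simp_all add: field_simps)
    define Q where "Q p = gauss_quotient e p * ?V p" for p
    have Q: "Q p = (G p * cis (- (fst p * e)) * ?V p - G p * cis 0 * ?V p) / of_real e" for p
      unfolding Q_def G_def gauss_quotient_def by (rule alg1)
    have intQ: "integrable lborel Q"
      unfolding Q[abs_def] by (intro integrable_divide Bochner_Integration.integrable_diff GV) simp_all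
    have quot: "(LINT s|lborel. of_real (gauss2 s) * diff_quotient e u \<alpha> \<beta> s) = (LINT p|lborel. Q p * cis (- (p \<bullet> c \<beta>)))" for \<beta>
    proof -
      have "(LINT s|lborel. of_real (gauss2 s) * diff_quotient e u \<alpha> \<beta> s) =
          (LINT s|lborel. (of_real (gauss2 s) * ?U (((e, 0) + c \<beta>) + e *\<^sub>R s) - of_real (gauss2 s) * ?U (c \<beta> + e *\<^sub>R s)) / of_real e)"
        by (simp add: diff_quotient_def c_def right_diff_distrib add.commute)
      also have "\<dots> = ((LINT p|lborel. G p * cis (- (p \<bullet> ((e, 0) + c \<beta>))) * ?V p) - (LINT p|lborel. G p * cis (- (p \<bullet> c \<beta>)) * ?V p)) / of_real e"
        by (simp only: integral_divide_zero Bochner_Integration.integral_diff[OF gU gU] avg)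
      also have "\<dots> = (LINT p|lborel. (G p * cis (- (p \<bullet> ((e, 0) + c \<beta>))) * ?V p - G p * cis (- (p \<bullet> c \<beta>)) * ?V p) / of_real e)"
        by (subst Bochner_Integration.integral_diff[symmetric]) (simp_all add: GV)
      also have "\<dots> = (LINT p|lborel. Q p * cis (- (p \<bullet> c \<beta>)))"
      proof (rule Bochner_Integration.integral_cong[OF refl])
        fix p :: "real \<times> real"
        have "cis (- (p \<bullet> ((e, 0) + c \<beta>))) = cis (- (fst p * e)) * cis (- (p \<bullet> c \<beta>))"
          by (simp add: cis_mult inner_prod_def algebra_simps)
        then show "(G p * cis (- (p \<bullet> ((e, 0) + c \<beta>))) * ?V p - G p * cis (- (p \<bullet> c \<beta>)) * ?V p) / of_real e = Q p * cis (- (p \<bullet> c \<beta>))"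
          unfolding Q by (simp only: alg2)
      qed
      finally show ?thesis .
    qed
    have int_w: "integrable lborel (\<lambda>w. (v1 (fst w) * of_real (gauss2 (snd w))) * diff_quotient e u \<alpha> (fst w) (snd w))"
      by (rule integrable_mult_bounded[OF integrable_lborel_prod_mult[OF v1 integrable_gauss2] _ cmod_diff_quotient_le[OF B e]]) simp
    have "(LINT w|lborel. density_fun (\<alpha>, w) * diff_quotient e u \<alpha> (fst w) (snd w)) =
        v2 \<alpha> * (LINT w|lborel. (v1 (fst w) * of_real (gauss2 (snd w))) * diff_quotient e u \<alpha> (fst w) (snd w))"
      by (simp add: density_fun_def mult.assoc)
    also have "\<dots> = v2 \<alpha> * (LINT \<beta>|lborel. v1 \<beta> * (LINT s|lborel. of_real (gauss2 s) * diff_quotient e u \<alpha> \<beta> s))"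
      by (subst integral_lborel_prod(1)[OF int_w]) (simp add: mult.assoc)
    also have "\<dots> = v2 \<alpha> * (LINT \<beta>|lborel. LINT p|lborel. v1 \<beta> * Q p * cis (- (p \<bullet> c \<beta>)))"
      by (simp add: quot mult.assoc)
    also have "\<dots> = v2 \<alpha> * (LINT p|lborel. LINT \<beta>|lborel. v1 \<beta> * Q p * cis (- (p \<bullet> c \<beta>)))"
    proof (subst Fubini_lborel)
      show "integrable lborel (\<lambda>z. v1 (fst z) * Q (snd z) * cis (- (snd z \<bullet> c (fst z))))"
        by (rule integrable_mult_bounded[OF integrable_lborel_prod_mult[OF v1 intQ], where B = 1])
          (simp_all add: c_def)
    qed simp
    also have "\<dots> = v2 \<alpha> * (LINT p|lborel. Q p * fourier_transform v1 (fst p - exp (- \<alpha>) * snd p))"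
    proof -
      have "(LINT \<beta>|lborel. v1 \<beta> * Q p * cis (- (p \<bullet> c \<beta>))) = Q p * fourier_transform v1 (fst p - exp (- \<alpha>) * snd p)" for p
      proof -
        have "p \<bullet> c \<beta> = (fst p - exp (- \<alpha>) * snd p) * \<beta>" for \<beta>
          by (simp add: c_def inner_prod_def algebra_simps)
        then show ?thesis
          unfolding fourier_transform_def by (subst integral_mult_right_zero[symmetric]) (simp add: mult_ac)
      qed
      then show ?thesis by simp
    qed
    also have "\<dots> = (LINT p|lborel. gauss_quotient e p * symbol u (\<alpha>, p))"
      by (subst integral_mult_right_zero[symmetric]) (simp add: Q_def symbol_def mult_ac)
    finally show ?thesis .
  qed
  show "approx_functional e u = (LINT z|lborel. gauss_quotient e (snd z) * symbol u z)"
    unfolding approx_functional_def integral_lborel_prod(1)[OF approx_integrable[OF um B e]] integral_lborel_prod(1)[OF int_gq]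
    by (simp add: inner)
qed

text \<open>The (2 pi)^-2 of \<open>cmod_gauss_quotient_le\<close> cancels Bessel's (2 pi)^2; the
  factor 1/2 stems from the arithmetic-geometric mean inequality.\<close>

lemma approx_functional_bounded_support_le:
  assumes \<xi>: "\<xi> \<in> bounded_support" and \<eta>: "\<eta> \<in> bounded_support" and e: "e > 0"
  shows "cmod (approx_functional e (coefficient_fun aff2 aff2_haar \<xi> \<eta>)) \<le>
    C / 2 * ((L2_norm aff2_haar \<xi>)\<^sup>2 + (L2_norm aff2_haar \<eta>)\<^sup>2)"
proof -
  define u where "u = coefficient_fun aff2 aff2_haar \<xi> \<eta>"
  note eq = approx_functional_eq[OF \<xi> \<eta> e, folded u_def]
  let ?N = "(L2_norm aff2_haar \<xi>)\<^sup>2 + (L2_norm aff2_haar \<eta>)\<^sup>2"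
  let ?I = "LINT z|lborel. \<bar>fst (snd z)\<bar> * cmod (symbol u z)"
  have int: "integrable lborel (\<lambda>z. \<bar>fst (snd z)\<bar> * cmod (symbol u z))"
    using integrable_norm[OF eq(1)] by (simp add: norm_mult)
  have "2 * ennreal ?I \<le> ennreal (C * ((2 * pi)\<^sup>2 * ?N))"
    using nn_integral_symbol_le[OF \<xi> \<eta>, folded u_def] nn_integral_eq_integral[OF int] by simp
  then have I: "2 * ?I \<le> C * ((2 * pi)\<^sup>2 * ?N)"
    using C by (simp add: ennreal_mult'[symmetric] flip: ennreal_numeral)
  have "cmod (approx_functional e u) \<le> (LINT z|lborel. cmod (gauss_quotient e (snd z) * symbol u z))"
    unfolding eq(2) by (rule integral_norm_bound)
  also have "\<dots> \<le> (LINT z|lborel. (1 / (2 * pi)\<^sup>2) * (\<bar>fst (snd z)\<bar> * cmod (symbol u z)))"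
  proof (rule Bochner_Integration.integral_mono')
    show "integrable lborel (\<lambda>z. (1 / (2 * pi)\<^sup>2) * (\<bar>fst (snd z)\<bar> * cmod (symbol u z)))"
      using int by (rule integrable_mult_right)
    show "cmod (gauss_quotient e (snd z) * symbol u z) \<le> (1 / (2 * pi)\<^sup>2) * (\<bar>fst (snd z)\<bar> * cmod (symbol u z))" for z
      using mult_right_mono[OF cmod_gauss_quotient_le[OF e, of "snd z"], of "cmod (symbol u z)"] by (simp add: norm_mult)
  qed simp
  also have "\<dots> = (1 / (2 * pi)\<^sup>2) * ?I"
    by simp
  also have "\<dots> \<le> (1 / (2 * pi)\<^sup>2) * (C * ((2 * pi)\<^sup>2 * ?N) / 2)"
    using I by (intro mult_left_mono) auto
  also have "\<dots> = C / 2 * ?N"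
    by simp
  finally show ?thesis
    unfolding u_def .
qed

text \<open>The multipliers converge pointwise and are dominated by a multiple of |p1|, against
  which \<open>symbol\<close> is absolutely integrable.\<close>

lemma approx_functional_bounded_support_convergent:
  assumes \<xi>: "\<xi> \<in> bounded_support" and \<eta>: "\<eta> \<in> bounded_support"
  shows "convergent (\<lambda>n. approx_functional (1 / real (Suc n)) (coefficient_fun aff2 aff2_haar \<xi> \<eta>))"
proof -
  define u where "u = coefficient_fun aff2 aff2_haar \<xi> \<eta>"
  have [measurable]: "u \<in> borel_measurable borel"
    unfolding u_def by (intro borel_measurable_coefficient_fun_aff2 bounded_support_L2 \<xi> \<eta>)
  have e: "0 < 1 / real (Suc n)" for n
    by simp
  note eq = approx_functional_eq[OF \<xi> \<eta> e, folded u_def]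
  have "(\<lambda>n. LINT z|lborel. gauss_quotient (1 / real (Suc n)) (snd z) * symbol u z) \<longlonglongrightarrow>
      (LINT z|lborel. - (\<i> * of_real (fst (snd z))) / of_real ((2 * pi)\<^sup>2) * symbol u z)"
  proof (rule integral_dominated_convergence)
    show "integrable lborel (\<lambda>z. (1 / (2 * pi)\<^sup>2) * norm (of_real \<bar>fst (snd z)\<bar> * symbol u z))"
      by (intro integrable_mult_right integrable_norm eq(1))
    show "AE z in lborel. (\<lambda>n. gauss_quotient (1 / real (Suc n)) (snd z) * symbol u z) \<longlonglongrightarrow>
        - (\<i> * of_real (fst (snd z))) / of_real ((2 * pi)\<^sup>2) * symbol u z"
      by (intro AE_I2 tendsto_mult gauss_quotient_tendsto tendsto_const)
    show "AE z in lborel. norm (gauss_quotient (1 / real (Suc n)) (snd z) * symbol u z) \<le>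
        (1 / (2 * pi)\<^sup>2) * norm (of_real \<bar>fst (snd z)\<bar> * symbol u z)" for n
    proof (rule AE_I2)
      fix z :: "real \<times> real \<times> real"
      have "cmod (gauss_quotient (1 / real (Suc n)) (snd z)) * cmod (symbol u z) \<le>
          \<bar>fst (snd z)\<bar> / (2 * pi)\<^sup>2 * cmod (symbol u z)"
        by (intro mult_right_mono cmod_gauss_quotient_le e) simp
      then show "norm (gauss_quotient (1 / real (Suc n)) (snd z) * symbol u z) \<le>
          (1 / (2 * pi)\<^sup>2) * norm (of_real \<bar>fst (snd z)\<bar> * symbol u z)"
        by (simp add: norm_mult)
    qed
  qed measurable
  then show ?thesis
    unfolding u_def[symmetric] eq(2) by (rule convergentI)
qed

end

section \<open>Extension to square-integrable functions\<close>

definition truncation ::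
  "nat \<Rightarrow> ('a::euclidean_space \<Rightarrow> complex) \<Rightarrow> 'a \<Rightarrow> complex" where
  "truncation k \<xi> x = (if cmod (\<xi> x) \<le> real k \<and> norm x \<le> real k then \<xi> x else 0)"

lemma truncation_bounded_support:
  assumes [measurable]: "\<xi> \<in> borel_measurable borel"
  shows "truncation k \<xi> \<in> bounded_support"
proof (rule bounded_supportI)
  show "truncation k \<xi> \<in> borel_measurable borel"
    unfolding truncation_def by measurable
  show "cmod (truncation k \<xi> x) \<le> real k" for x
    by (simp add: truncation_def)
  show "truncation k \<xi> x = 0" if "norm x > real k" for x
    using that by (simp add: truncation_def)
qed

lemma truncation_L2:
  assumes "\<xi> \<in> L2 aff2_haar"
  shows "truncation k \<xi> \<in> L2 aff2_haar"
  by (intro bounded_support_L2 truncation_bounded_support L2_aff2_measurable assms)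

lemma L2_norm_truncation_le:
  assumes "\<xi> \<in> L2 aff2_haar"
  shows "L2_norm aff2_haar (truncation k \<xi>) \<le> L2_norm aff2_haar \<xi>"
proof -
  have "(LINT x|aff2_haar. (cmod (truncation k \<xi> x))\<^sup>2) \<le> (LINT x|aff2_haar. (cmod (\<xi> x))\<^sup>2)"
    by (intro Bochner_Integration.integral_mono L2_integrable_square truncation_L2 assms) (simp add: truncation_def)
  then show ?thesis
    by (simp add: L2_norm_def)
qed

lemma L2_norm_truncation_tendsto:
  assumes \<xi>: "\<xi> \<in> L2 aff2_haar"
  shows "(\<lambda>k. L2_norm aff2_haar (\<lambda>x. \<xi> x - truncation k \<xi> x)) \<longlonglongrightarrow> 0"
proof -
  have "(\<lambda>k. LINT x|aff2_haar. (cmod (\<xi> x - truncation k \<xi> x))\<^sup>2) \<longlonglongrightarrow> (LINT x|aff2_haar. 0)"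
  proof (rule integral_dominated_convergence)
    show "integrable aff2_haar (\<lambda>x. (cmod (\<xi> x))\<^sup>2)"
      by (rule L2_integrable_square[OF \<xi>])
    show "(\<lambda>x. (cmod (\<xi> x - truncation k \<xi> x))\<^sup>2) \<in> borel_measurable aff2_haar" for k
      using L2_integrable_square[OF L2_diff[OF \<xi> truncation_L2[OF \<xi>]]] by (rule borel_measurable_integrable)
    show "AE x in aff2_haar. norm ((cmod (\<xi> x - truncation k \<xi> x))\<^sup>2) \<le> (cmod (\<xi> x))\<^sup>2" for k
      by (simp add: truncation_def)
    show "AE x in aff2_haar. (\<lambda>k. (cmod (\<xi> x - truncation k \<xi> x))\<^sup>2) \<longlonglongrightarrow> 0"
    proof (rule AE_I2)
      fix x
      obtain K where K: "cmod (\<xi> x) \<le> real K" "norm x \<le> real K"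
        using real_arch_simple[of "max (cmod (\<xi> x)) (norm x)"] by auto
      show "(\<lambda>k. (cmod (\<xi> x - truncation k \<xi> x))\<^sup>2) \<longlonglongrightarrow> 0"
        by (rule tendsto_eventually, rule eventually_sequentiallyI[of K])
          (use K in \<open>auto simp: truncation_def\<close>)
    qed
  qed simp
  then have "(\<lambda>k. sqrt (LINT x|aff2_haar. (cmod (\<xi> x - truncation k \<xi> x))\<^sup>2)) \<longlonglongrightarrow> sqrt 0"
    by (intro tendsto_real_sqrt) simp
  then show ?thesis
    by (simp add: L2_norm_def)
qed

lemma fourier_algebra_aff2_bounded:
  assumes "u \<in> fourier_algebra aff2 aff2_haar"
  obtains B where "u \<in> borel_measurable borel" "\<And>x. cmod (u x) \<le> B"
  using assms borel_measurable_coefficient_fun_aff2 cmod_coefficient_fun_aff2_le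
  unfolding fourier_algebra_def by blast

lemma coefficient_fun_in_fourier_algebra:
  "\<xi> \<in> L2 \<mu> \<Longrightarrow> \<eta> \<in> L2 \<mu> \<Longrightarrow> coefficient_fun G \<mu> \<xi> \<eta> \<in> fourier_algebra G \<mu>"
  by (auto simp: fourier_algebra_def)

context schur_kernel
begin

abbreviation form :: "real \<Rightarrow> (real4 \<Rightarrow> complex) \<Rightarrow> (real4 \<Rightarrow> complex) \<Rightarrow> complex" where
  "form e \<xi> \<eta> \<equiv> approx_functional e (coefficient_fun aff2 aff2_haar \<xi> \<eta>)"

lemma approx_functional_add_fourier_algebra:
  assumes "u \<in> fourier_algebra aff2 aff2_haar" "w \<in> fourier_algebra aff2 aff2_haar" "e > 0"
  shows "approx_functional e (\<lambda>x. u x + w x) = approx_functional e u + approx_functional e w"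
  using assms by (elim fourier_algebra_aff2_bounded) (rule approx_functional_add)

lemma form_diff:
  assumes L: "\<xi> \<in> L2 aff2_haar" "\<eta> \<in> L2 aff2_haar" "\<xi>' \<in> L2 aff2_haar" "\<eta>' \<in> L2 aff2_haar" and e: "e > 0"
  shows "form e \<xi> \<eta> - form e \<xi>' \<eta>' = form e (\<lambda>x. \<xi> x - \<xi>' x) \<eta> + form e \<xi>' (\<lambda>x. \<eta> x - \<eta>' x)"
proof -
  have left: "coefficient_fun aff2 aff2_haar (\<lambda>x. (\<xi> x - \<xi>' x) + \<xi>' x) \<eta> =
      (\<lambda>g. coefficient_fun aff2 aff2_haar (\<lambda>x. \<xi> x - \<xi>' x) \<eta> g + coefficient_fun aff2 aff2_haar \<xi>' \<eta> g)"
    by (intro coefficient_fun_add_left left_regular_aff2_L2 L2_diff L)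
  have right: "coefficient_fun aff2 aff2_haar \<xi>' (\<lambda>x. (\<eta> x - \<eta>' x) + \<eta>' x) =
      (\<lambda>g. coefficient_fun aff2 aff2_haar \<xi>' (\<lambda>x. \<eta> x - \<eta>' x) g + coefficient_fun aff2 aff2_haar \<xi>' \<eta>' g)"
    by (intro coefficient_fun_add_right left_regular_aff2_L2 L2_diff L)
  have "form e \<xi> \<eta> = form e (\<lambda>x. (\<xi> x - \<xi>' x) + \<xi>' x) \<eta>"
    by simp
  also have "\<dots> = form e (\<lambda>x. \<xi> x - \<xi>' x) \<eta> + form e \<xi>' \<eta>"
    unfolding left
    by (intro approx_functional_add_fourier_algebra coefficient_fun_in_fourier_algebra L2_diff L e)
  also have "form e \<xi>' \<eta> = form e \<xi>' (\<lambda>x. (\<eta> x - \<eta>' x) + \<eta>' x)"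
    by simp
  also have "\<dots> = form e \<xi>' (\<lambda>x. \<eta> x - \<eta>' x) + form e \<xi>' \<eta>'"
    unfolding right
    by (intro approx_functional_add_fourier_algebra coefficient_fun_in_fourier_algebra L2_diff L e)
  finally show ?thesis
    by simp
qed

text \<open>Times a bound for the form, this controls the error of truncating both vectors, by way
  of \<open>form_diff\<close>.\<close>

definition truncation_defect :: "(real4 \<Rightarrow> complex) \<Rightarrow> (real4 \<Rightarrow> complex) \<Rightarrow> nat \<Rightarrow> real" where
  "truncation_defect \<xi> \<eta> k =
    L2_norm aff2_haar (\<lambda>x. \<xi> x - truncation k \<xi> x) * L2_norm aff2_haar \<eta> +
    L2_norm aff2_haar (truncation k \<xi>) * L2_norm aff2_haar (\<lambda>x. \<eta> x - truncation k \<eta> x)"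

lemma truncation_defect_tendsto:
  assumes \<xi>: "\<xi> \<in> L2 aff2_haar" and \<eta>: "\<eta> \<in> L2 aff2_haar"
  shows "truncation_defect \<xi> \<eta> \<longlonglongrightarrow> 0"
  unfolding truncation_defect_def[abs_def]
proof (rule tendsto_add_zero)
  show "(\<lambda>k. L2_norm aff2_haar (\<lambda>x. \<xi> x - truncation k \<xi> x) * L2_norm aff2_haar \<eta>) \<longlonglongrightarrow> 0"
    by (intro tendsto_mult_left_zero L2_norm_truncation_tendsto \<xi>)
  show "(\<lambda>k. L2_norm aff2_haar (truncation k \<xi>) * L2_norm aff2_haar (\<lambda>x. \<eta> x - truncation k \<eta> x)) \<longlonglongrightarrow> 0"
  proof (rule Lim_null_comparison)
    show "\<forall>\<^sub>F k in sequentially. norm (L2_norm aff2_haar (truncation k \<xi>) * L2_norm aff2_haar (\<lambda>x. \<eta> x - truncation k \<eta> x)) \<le>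
        L2_norm aff2_haar \<xi> * L2_norm aff2_haar (\<lambda>x. \<eta> x - truncation k \<eta> x)"
      by (intro always_eventually allI) (simp add: abs_mult mult_right_mono L2_norm_truncation_le[OF \<xi>])
    show "(\<lambda>k. L2_norm aff2_haar \<xi> * L2_norm aff2_haar (\<lambda>x. \<eta> x - truncation k \<eta> x)) \<longlonglongrightarrow> 0"
      by (intro tendsto_mult_right_zero L2_norm_truncation_tendsto \<eta>)
  qed
qed

text \<open>The constant is of order 1/e. It serves for a single \<open>e\<close>: to pass from
  truncations to general vectors, and to settle vectors of norm 0.\<close>

lemma form_crude_bound:
  assumes e: "e > 0"
  obtains K where "\<And>\<xi> \<eta>. \<xi> \<in> L2 aff2_haar \<Longrightarrow> \<eta> \<in> L2 aff2_haar \<Longrightarrow>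
    cmod (form e \<xi> \<eta>) \<le> K * (L2_norm aff2_haar \<xi> * L2_norm aff2_haar \<eta>)"
proof
  fix \<xi> \<eta> assume "\<xi> \<in> L2 aff2_haar" "\<eta> \<in> L2 aff2_haar"
  then have "cmod (form e \<xi> \<eta>) \<le> (LINT z|lborel. cmod (density_fun z)) * (2 * (L2_norm aff2_haar \<xi> * L2_norm aff2_haar \<eta>) / e)"
    by (intro cmod_approx_functional_le cmod_coefficient_fun_aff2_le e)
  then show "cmod (form e \<xi> \<eta>) \<le> (LINT z|lborel. cmod (density_fun z)) * 2 / e * (L2_norm aff2_haar \<xi> * L2_norm aff2_haar \<eta>)"
    by simp
qed

text \<open>Here the constant does not depend on \<open>e\<close>. The bound by a sum of squares
  passes from truncations to all vectors by continuity for fixed \<open>e\<close>; invariance of the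
  form under scaling \<open>\<xi>\<close> by \<open>t\<close> and \<open>\<eta>\<close> by
  \<open>1 / t\<close> turns the sum into a product.\<close>

lemma cmod_form_le:
  assumes \<xi>: "\<xi> \<in> L2 aff2_haar" and \<eta>: "\<eta> \<in> L2 aff2_haar" and e: "e > 0"
  shows "cmod (form e \<xi> \<eta>) \<le> C * (L2_norm aff2_haar \<xi> * L2_norm aff2_haar \<eta>)"
proof -
  obtain K where K: "\<And>\<xi> \<eta>. \<xi> \<in> L2 aff2_haar \<Longrightarrow> \<eta> \<in> L2 aff2_haar \<Longrightarrow>
      cmod (form e \<xi> \<eta>) \<le> K * (L2_norm aff2_haar \<xi> * L2_norm aff2_haar \<eta>)"
    using form_crude_bound[OF e] by blast
  have sq: "cmod (form e \<xi> \<eta>) \<le> C / 2 * ((L2_norm aff2_haar \<xi>)\<^sup>2 + (L2_norm aff2_haar \<eta>)\<^sup>2)"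
    if \<xi>: "\<xi> \<in> L2 aff2_haar" and \<eta>: "\<eta> \<in> L2 aff2_haar" for \<xi> \<eta>
  proof -
    have "(\<lambda>k. form e \<xi> \<eta> - form e (truncation k \<xi>) (truncation k \<eta>)) \<longlonglongrightarrow> 0"
    proof (rule Lim_null_comparison)
      show "\<forall>\<^sub>F k in sequentially. norm (form e \<xi> \<eta> - form e (truncation k \<xi>) (truncation k \<eta>)) \<le>
          K * truncation_defect \<xi> \<eta> k"
      proof (intro always_eventually allI)
        fix k
        note T = truncation_L2[OF \<xi>, of k] truncation_L2[OF \<eta>, of k]
        show "norm (form e \<xi> \<eta> - form e (truncation k \<xi>) (truncation k \<eta>)) \<le>
            K * truncation_defect \<xi> \<eta> k"
          unfolding form_diff[OF \<xi> \<eta> T e] truncation_defect_def distrib_left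
          by (intro norm_triangle_mono K L2_diff \<xi> \<eta> T)
      qed
      show "(\<lambda>k. K * truncation_defect \<xi> \<eta> k) \<longlonglongrightarrow> 0"
        by (intro tendsto_mult_right_zero truncation_defect_tendsto \<xi> \<eta>)
    qed
    from tendsto_diff[OF tendsto_const this, of "form e \<xi> \<eta>"]
    have "(\<lambda>k. form e (truncation k \<xi>) (truncation k \<eta>)) \<longlonglongrightarrow> form e \<xi> \<eta>"
      by simp
    then have "(\<lambda>k. cmod (form e (truncation k \<xi>) (truncation k \<eta>))) \<longlonglongrightarrow> cmod (form e \<xi> \<eta>)"
      by (rule tendsto_norm)
    then show ?thesis
    proof (rule LIMSEQ_le_const2, intro exI allI impI)
      fix k :: nat
      have "cmod (form e (truncation k \<xi>) (truncation k \<eta>)) \<le>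
          C / 2 * ((L2_norm aff2_haar (truncation k \<xi>))\<^sup>2 + (L2_norm aff2_haar (truncation k \<eta>))\<^sup>2)"
        by (intro approx_functional_bounded_support_le truncation_bounded_support L2_aff2_measurable \<xi> \<eta> e)
      also have "\<dots> \<le> C / 2 * ((L2_norm aff2_haar \<xi>)\<^sup>2 + (L2_norm aff2_haar \<eta>)\<^sup>2)"
        using C by (intro mult_left_mono add_mono power_mono L2_norm_truncation_le \<xi> \<eta>) auto
      finally show "cmod (form e (truncation k \<xi>) (truncation k \<eta>)) \<le>
          C / 2 * ((L2_norm aff2_haar \<xi>)\<^sup>2 + (L2_norm aff2_haar \<eta>)\<^sup>2)" .
    qed
  qed
  let ?a = "L2_norm aff2_haar \<xi>" and ?b = "L2_norm aff2_haar \<eta>"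
  show ?thesis
  proof (cases "?a = 0 \<or> ?b = 0")
    case True
    then show ?thesis
      using K[OF \<xi> \<eta>] by auto
  next
    case False
    then have ab: "?a > 0" "?b > 0"
      by (simp_all add: less_le)
    \<comment> \<open>With this scale both vectors have the same norm, sqrt (?a * ?b).\<close>
    define t where "t = sqrt (?b / ?a)"
    have t: "t > 0" "t\<^sup>2 = ?b / ?a"
      using ab by (simp_all add: t_def)
    have "form e (\<lambda>x. of_real t * \<xi> x) (\<lambda>x. of_real (1 / t) * \<eta> x) = form e \<xi> \<eta>"
      unfolding coefficient_fun_cmult_left coefficient_fun_cmult_right approx_functional_cmult using t(1) by simp
    then have "cmod (form e \<xi> \<eta>) \<le> C / 2 * ((t * ?a)\<^sup>2 + (1 / t * ?b)\<^sup>2)"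
      using sq[OF L2_cmult[OF \<xi>, of "of_real t"] L2_cmult[OF \<eta>, of "of_real (1 / t)"]] t(1)
      unfolding L2_norm_cmult norm_of_real by simp
    also have "(t * ?a)\<^sup>2 + (1 / t * ?b)\<^sup>2 = 2 * (?a * ?b)"
      unfolding power_mult_distrib power_divide t(2) using ab by (simp add: power2_eq_square field_simps)
    finally show ?thesis
      by simp
  qed
qed

text \<open>By \<open>cmod_form_le\<close> the truncation error is small uniformly in
  \<open>n\<close>, so the Cauchy property is inherited from a single truncation.\<close>

lemma form_convergent:
  assumes \<xi>: "\<xi> \<in> L2 aff2_haar" and \<eta>: "\<eta> \<in> L2 aff2_haar"
  shows "convergent (\<lambda>n. form (1 / real (Suc n)) \<xi> \<eta>)"
proof (rule Cauchy_convergent, rule metric_CauchyI)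
  fix r :: real assume r: "r > 0"
  let ?f = "\<lambda>n. form (1 / real (Suc n)) \<xi> \<eta>" and ?t = "\<lambda>k n. form (1 / real (Suc n)) (truncation k \<xi>) (truncation k \<eta>)"
  have "(\<lambda>k. C * truncation_defect \<xi> \<eta> k) \<longlonglongrightarrow> 0"
    by (intro tendsto_mult_right_zero truncation_defect_tendsto \<xi> \<eta>)
  then obtain k where k: "\<bar>C * truncation_defect \<xi> \<eta> k\<bar> < r / 3"
    using LIMSEQ_D[of "\<lambda>k. C * truncation_defect \<xi> \<eta> k" 0 "r / 3"] r by auto
  note T = truncation_L2[OF \<xi>, of k] truncation_L2[OF \<eta>, of k]
  have near: "dist (?f n) (?t k n) < r / 3" for n
  proof -
    have e: "1 / real (Suc n) > 0" by simp
    have "norm (?f n - ?t k n) \<le> C * truncation_defect \<xi> \<eta> k"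
      unfolding form_diff[OF \<xi> \<eta> T e] truncation_defect_def distrib_left
      by (intro norm_triangle_mono cmod_form_le L2_diff \<xi> \<eta> T) simp_all
    then show ?thesis
      using k by (simp add: dist_norm)
  qed
  have "Cauchy (?t k)"
    by (intro convergent_Cauchy approx_functional_bounded_support_convergent truncation_bounded_support
        L2_aff2_measurable \<xi> \<eta>)
  then obtain N where N: "\<And>m n. N \<le> m \<Longrightarrow> N \<le> n \<Longrightarrow> dist (?t k m) (?t k n) < r / 3"
    using r unfolding Cauchy_def by (meson divide_pos_pos zero_less_numeral)
  show "\<exists>N. \<forall>m\<ge>N. \<forall>n\<ge>N. dist (?f m) (?f n) < r"
  proof (intro exI[of _ N] allI impI)
    fix m n assume "N \<le> m" "N \<le> n"
    then show "dist (?f m) (?f n) < r"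
      using near[of m] near[of n] N[of m n] dist_triangle[of "?f m" "?f n" "?t k m"]
        dist_triangle[of "?t k m" "?f n" "?t k n"] dist_commute[of "?f n" "?t k n"] by linarith
  qed
qed

lemma approx_functional_convergent:
  assumes "u \<in> fourier_algebra aff2 aff2_haar"
  shows "convergent (\<lambda>n. approx_functional (1 / real (Suc n)) u)"
  using assms form_convergent by (auto simp: fourier_algebra_def)

text \<open>The limit exists on the whole Fourier algebra, depends on \<open>u\<close> only, and
  keeps the uniform bound \<open>C\<close>, as \<open>VN_of_functional\<close> demands.\<close>

theorem exists_VN_operator:
  "\<exists>S\<in>VN aff2 aff2_haar. \<forall>u\<in>fourier_algebra aff2 aff2_haar.
    VN_apply aff2 aff2_haar S u = lim (\<lambda>n. approx_functional (1 / real (Suc n)) u)"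
proof (rule VN_of_functional)
  show "carrier aff2 = UNIV"
    by (rule carrier_aff2)
  show "left_regular aff2 g \<xi> \<in> L2 aff2_haar" if "\<xi> \<in> L2 aff2_haar" for g \<xi>
    using that by (rule left_regular_aff2_L2)
  fix u w assume u: "u \<in> fourier_algebra aff2 aff2_haar" and w: "w \<in> fourier_algebra aff2 aff2_haar"
  show "lim (\<lambda>n. approx_functional (1 / real (Suc n)) (\<lambda>x. u x + w x)) =
      lim (\<lambda>n. approx_functional (1 / real (Suc n)) u) + lim (\<lambda>n. approx_functional (1 / real (Suc n)) w)"
    using tendsto_add[OF approx_functional_convergent[OF u, unfolded convergent_LIMSEQ_iff]
        approx_functional_convergent[OF w, unfolded convergent_LIMSEQ_iff]]
    by (intro limI) (simp add: approx_functional_add_fourier_algebra[OF u w])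
next
  fix c u assume u: "u \<in> fourier_algebra aff2 aff2_haar"
  show "lim (\<lambda>n. approx_functional (1 / real (Suc n)) (\<lambda>x. c * u x)) = c * lim (\<lambda>n. approx_functional (1 / real (Suc n)) u)"
    using tendsto_mult_left[OF approx_functional_convergent[OF u, unfolded convergent_LIMSEQ_iff], of c]
    by (intro limI) (simp add: approx_functional_cmult)
next
  fix \<xi> \<eta> assume L: "\<xi> \<in> L2 aff2_haar" "\<eta> \<in> L2 aff2_haar"
  have "(\<lambda>n. form (1 / real (Suc n)) \<xi> \<eta>) \<longlonglongrightarrow> lim (\<lambda>n. form (1 / real (Suc n)) \<xi> \<eta>)"
    using form_convergent[OF L] by (simp add: convergent_LIMSEQ_iff)
  from tendsto_norm[OF this]
  show "cmod (lim (\<lambda>n. form (1 / real (Suc n)) \<xi> \<eta>)) \<le> C * L2_norm aff2_haar \<xi> * L2_norm aff2_haar \<eta>"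
    using cmod_form_le[OF L] by (intro LIMSEQ_le_const2) (auto simp: mult.assoc)
qed

end

section \<open>The limit on test functions\<close>

text \<open>The mean value inequality for h t - t c. It is used with \<open>c\<close> the limiting
  derivative for convergence, and with c = 0 for a uniform bound on difference quotients.\<close>

lemma vector_derivative_deviation_le:
  fixes h :: "real \<Rightarrow> complex"
  assumes h: "\<And>t. (h has_vector_derivative h' t) (at t)" and B: "\<And>t. 0 \<le> t \<Longrightarrow> t \<le> e \<Longrightarrow> cmod (h' t - c) \<le> B"
    and e: "e > 0"
  shows "cmod ((h e - h 0) / of_real e - c) \<le> B"
proof -
  define k where "k t = h t - of_real t * c" for t
  have k': "(k has_vector_derivative h' t - c) (at t)" for t
    unfolding k_def using h[of t] by (auto intro!: derivative_eq_intros)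
  have "cmod (k e - k 0) \<le> B * norm (e - 0)"
  proof (rule differentiable_bound)
    show "(k has_derivative (\<lambda>x. x *\<^sub>R (h' t - c))) (at t within {0..e})" for t
      using k' by (auto simp: has_vector_derivative_def intro: has_derivative_at_withinI)
    show "onorm (\<lambda>x. x *\<^sub>R (h' t - c)) \<le> B" if "t \<in> {0..e}" for t
      using B[of t] that by (intro onorm_le) (simp add: mult.commute[of B] mult_left_mono)
  qed (use e in auto)
  then have "cmod (k e - k 0) \<le> B * e"
    using e by simp
  moreover have "(h e - h 0) / of_real e - c = (k e - k 0) / of_real e"
    using e by (simp add: k_def field_simps)
  ultimately show ?thesis
    using e by (simp add: norm_divide divide_le_eq)
qed

definition dir_b :: "real4" where
  "dir_b = ((1, 0), (0, 0))"

context
  fixes u :: "real4 \<Rightarrow> complex"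
  assumes u: "u \<in> test_functions"
begin

interpretation smooth_function u
  by (rule test_functionsD(1)[OF u])

lemma coeff_slice_has_vector_derivative:
  "((\<lambda>t. coeff_slice u \<alpha> ((b + t, d) + x)) has_vector_derivative coeff_slice (dd dir_b) \<alpha> ((b + t, d) + x)) (at t)"
proof -
  have "((\<lambda>t. ((b + t + fst x, \<alpha>), (d + snd x, - \<alpha>))) has_vector_derivative dir_b) (at t)"
    unfolding dir_b_def by (auto intro!: derivative_eq_intros has_vector_derivative_Pair simp: zero_prod_def)
  from has_vector_derivative_curve[OF this] show ?thesis
    by (simp add: coeff_slice_def)
qed

lemma diff_quotient_deviation_le:
  assumes "e > 0" and "\<And>t. 0 \<le> t \<Longrightarrow> t \<le> e \<Longrightarrow>
    cmod (coeff_slice (dd dir_b) \<alpha> ((\<beta> + t, - exp (- \<alpha>) * \<beta>) + e *\<^sub>R s) - c) \<le> B"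
  shows "cmod (diff_quotient e u \<alpha> \<beta> s - c) \<le> B"
  using vector_derivative_deviation_le[OF coeff_slice_has_vector_derivative assms(2) assms(1)]
  by (simp add: diff_quotient_def)

lemma continuous_coeff_slice_dd: "continuous_on UNIV (coeff_slice (dd dir_b) \<alpha>)"
  unfolding coeff_slice_def
  by (rule continuous_on_compose2[OF smooth_function.cont[OF smooth_dd]]) (auto intro!: continuous_intros)

lemma diff_quotient_tendsto:
  "(\<lambda>n. diff_quotient (1 / real (Suc n)) u \<alpha> \<beta> s) \<longlonglongrightarrow> coeff_slice (dd dir_b) \<alpha> (\<beta>, - exp (- \<alpha>) * \<beta>)"
proof (rule LIMSEQ_I)
  fix r :: real assume r: "r > 0"
  let ?P = "(\<beta>, - exp (- \<alpha>) * \<beta>)"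
  obtain \<delta> where \<delta>: "\<delta> > 0" and close: "\<And>y. dist y ?P < \<delta> \<Longrightarrow>
      dist (coeff_slice (dd dir_b) \<alpha> y) (coeff_slice (dd dir_b) \<alpha> ?P) < r / 2"
    using continuous_coeff_slice_dd[of \<alpha>] r unfolding continuous_on_iff by (metis UNIV_I half_gt_zero)
  \<comment> \<open>The derivative is evaluated at points that differ from \<open>?P\<close> by (t,
    0) + e s with 0 \<le> t \<le> e, so at distance at most e (1 + norm s).\<close>
  have "(\<lambda>n. 1 / real (Suc n) * (1 + norm s)) \<longlonglongrightarrow> 0 * (1 + norm s)"
    by (intro tendsto_intros LIMSEQ_Suc[OF lim_1_over_n])
  then obtain N where N: "\<And>n. n \<ge> N \<Longrightarrow> \<bar>1 / real (Suc n) * (1 + norm s)\<bar> < \<delta>"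
    using LIMSEQ_D[of _ 0 \<delta>] \<delta> by fastforce
  show "\<exists>no. \<forall>n\<ge>no. norm (diff_quotient (1 / real (Suc n)) u \<alpha> \<beta> s - coeff_slice (dd dir_b) \<alpha> ?P) < r"
  proof (intro exI[of _ N] allI impI)
    fix n assume n: "n \<ge> N"
    define e where "e = 1 / real (Suc n)"
    have e: "e > 0" "e * (1 + norm s) < \<delta>"
      using N[OF n] by (auto simp: e_def abs_of_nonneg)
    have "cmod (diff_quotient e u \<alpha> \<beta> s - coeff_slice (dd dir_b) \<alpha> ?P) \<le> r / 2"
    proof (rule diff_quotient_deviation_le[OF e(1)])
      fix t assume t: "0 \<le> t" "t \<le> e"
      have "((\<beta> + t, - exp (- \<alpha>) * \<beta>) + e *\<^sub>R s) - ?P = (t, 0) + e *\<^sub>R s"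
        by (simp add: prod_eq_iff)
      then have "dist ((\<beta> + t, - exp (- \<alpha>) * \<beta>) + e *\<^sub>R s) ?P \<le> norm (t, 0::real) + norm (e *\<^sub>R s)"
        unfolding dist_norm by (simp only: norm_triangle_ineq)
      also have "\<dots> \<le> e * (1 + norm s)"
        using t e by (simp add: norm_Pair algebra_simps)
      finally have "dist ((\<beta> + t, - exp (- \<alpha>) * \<beta>) + e *\<^sub>R s) ?P < \<delta>"
        using e(2) by simp
      from close[OF this] show "cmod (coeff_slice (dd dir_b) \<alpha> ((\<beta> + t, - exp (- \<alpha>) * \<beta>) + e *\<^sub>R s) -
          coeff_slice (dd dir_b) \<alpha> ?P) \<le> r / 2"
        by (simp add: dist_norm)
    qed
    then show "norm (diff_quotient (1 / real (Suc n)) u \<alpha> \<beta> s - coeff_slice (dd dir_b) \<alpha> ?P) < r"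
      unfolding e_def using r by linarith
  qed
qed

text \<open>Right multiplication by (t, 0) moves \<open>b\<close> by exp a * t, and the Haar density
  cancels the resulting factor exp a.\<close>

lemma deriv_fst_aff:
  "deriv_fst aff aff_Y u ((b, a), inv\<^bsub>aff\<^esub> (b, a)) =
    of_real (exp a) * coeff_slice (dd dir_b) a (b, - exp (- a) * b)"
proof -
  have "((\<lambda>t. ((b + exp a * t, a), inv\<^bsub>aff\<^esub> (b, a))) has_vector_derivative exp a *\<^sub>R dir_b) (at 0)"
    unfolding dir_b_def by (auto intro!: derivative_eq_intros has_vector_derivative_Pair simp: zero_prod_def)
  from has_vector_derivative_curve[OF this]
  have "((\<lambda>t. u ((b + exp a * t, a), inv\<^bsub>aff\<^esub> (b, a))) has_vector_derivative dd (exp a *\<^sub>R dir_b) ((b, a), inv\<^bsub>aff\<^esub> (b, a))) (at 0)"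
    by simp
  then have "vector_derivative (\<lambda>t. u ((b + exp a * t, a), inv\<^bsub>aff\<^esub> (b, a))) (at 0) = dd (exp a *\<^sub>R dir_b) ((b, a), inv\<^bsub>aff\<^esub> (b, a))"
    by (rule vector_derivative_at)
  then show ?thesis
    by (simp add: deriv_fst_def aff_Y_def aff_def[THEN arg_cong[where f = mult]] inv_aff coeff_slice_def linear_scale[OF linear_deriv] scaleR_conv_of_real)
qed

lemma dd_bounded: obtains M where "0 \<le> M" "\<And>x. cmod (dd dir_b x) \<le> M"
proof -
  obtain K where K: "compact K" and u0: "\<And>x. x \<notin> K \<Longrightarrow> u x = 0"
    using test_functionsD(2)[OF u] by blast
  show ?thesis
    by (rule bounded_if_compact_support[OF smooth_function.cont[OF smooth_dd] K dd_eq_0[OF compact_imp_closed[OF K] u0]])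
      (use that in blast)+
qed

lemma dd_measurable [measurable]: "dd w \<in> borel_measurable borel"
  by (rule borel_measurable_continuous_onI[OF smooth_function.cont[OF smooth_dd]])

lemma test_function_measurable [measurable]: "u \<in> borel_measurable borel"
  by (rule borel_measurable_continuous_onI[OF cont])

text \<open>The derivative of a test function is bounded, so the difference quotients are bounded
  uniformly in the step and the Gaussian variable, and the integrable \<open>density_fun\<close>
  allows dominated convergence.\<close>

lemma approx_functional_test_function:
  assumes "schur_kernel v1 v2 C"
  shows "lim (\<lambda>n. schur_kernel.approx_functional v1 v2 (1 / real (Suc n)) u) =
    (LINT g|aff_haar. deriv_fst aff aff_Y u (g, inv\<^bsub>aff\<^esub> g) * (v1 (fst g) * v2 (snd g)))"
proof -
  interpret schur_kernel v1 v2 C by fact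
  obtain M where M: "0 \<le> M" "\<And>x. cmod (dd dir_b x) \<le> M"
    by (rule dd_bounded) blast
  define d where "d \<alpha> \<beta> = coeff_slice (dd dir_b) \<alpha> (\<beta>, - exp (- \<alpha>) * \<beta>)" for \<alpha> \<beta>
  have d_le: "cmod (d \<alpha> \<beta>) \<le> M" for \<alpha> \<beta>
    by (simp add: d_def coeff_slice_def M)
  have [measurable]: "(\<lambda>z. d (fst z) (fst (snd z))) \<in> borel_measurable (borel :: (real \<times> real \<times> (real \<times> real)) measure)"
    "(\<lambda>z. d (snd z) (fst z)) \<in> borel_measurable borel"
    unfolding d_def by measurable
  have [measurable]: "density_fun \<in> borel_measurable borel"
    using integrable_density_fun by (auto dest: borel_measurable_integrable)
  have dq: "cmod (diff_quotient (1 / real (Suc n)) u \<alpha> \<beta> s) \<le> M" for n \<alpha> \<beta> s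
    using diff_quotient_deviation_le[of "1 / real (Suc n)" \<alpha> \<beta> s 0 M] by (simp add: coeff_slice_def M)
  have "(\<lambda>n. approx_functional (1 / real (Suc n)) u) \<longlonglongrightarrow> (LINT z|lborel. density_fun z * d (fst z) (fst (snd z)))"
    unfolding approx_functional_def
  proof (rule integral_dominated_convergence)
    show "integrable lborel (\<lambda>z. cmod (density_fun z) * M)"
      by (intro integrable_mult_left integrable_norm integrable_density_fun)
    show "AE z in lborel. (\<lambda>n. density_fun z * diff_quotient (1 / real (Suc n)) u (fst z) (fst (snd z)) (snd (snd z)))
        \<longlonglongrightarrow> density_fun z * d (fst z) (fst (snd z))"
      unfolding d_def by (intro AE_I2 tendsto_mult tendsto_const diff_quotient_tendsto)
    show "AE z in lborel. norm (density_fun z * diff_quotient (1 / real (Suc n)) u (fst z) (fst (snd z)) (snd (snd z))) \<le>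
        cmod (density_fun z) * M" for n
      unfolding norm_mult by (intro AE_I2 mult_left_mono dq) simp
  qed measurable
  then have "lim (\<lambda>n. approx_functional (1 / real (Suc n)) u) = (LINT z|lborel. density_fun z * d (fst z) (fst (snd z)))"
    by (rule limI)
  also have "\<dots> = (LINT \<alpha>|lborel. LINT w|lborel. density_fun (\<alpha>, w) * d \<alpha> (fst w))"
    by (subst integral_lborel_prod(1)[OF integrable_mult_bounded[OF integrable_density_fun _ d_le]]) simp_all
  also have "\<dots> = (LINT \<alpha>|lborel. LINT \<beta>|lborel. v1 \<beta> * v2 \<alpha> * d \<alpha> \<beta>)"
  proof (rule Bochner_Integration.integral_cong[OF refl])
    fix \<alpha>
    have [measurable]: "d \<alpha> \<in> borel_measurable borel"
      unfolding d_def by measurable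
    have int: "integrable lborel (\<lambda>\<beta>. v1 \<beta> * d \<alpha> \<beta>)"
      by (rule integrable_mult_bounded[OF v1 _ d_le]) simp
    have "(LINT w|lborel. density_fun (\<alpha>, w) * d \<alpha> (fst w)) =
        (LINT w|lborel. v2 \<alpha> * ((v1 (fst w) * d \<alpha> (fst w)) * of_real (gauss2 (snd w))))"
      by (simp add: density_fun_def mult_ac)
    \<comment> \<open>The limit no longer involves \<open>s\<close>, so the Gaussian integrates to
      1.\<close>
    also have "\<dots> = v2 \<alpha> * (LINT \<beta>|lborel. v1 \<beta> * d \<alpha> \<beta>)"
      unfolding integral_mult_right_zero integral_lborel_mult_prod[OF int integrable_gauss2] integral_gauss2 by simp
    also have "\<dots> = (LINT \<beta>|lborel. v1 \<beta> * v2 \<alpha> * d \<alpha> \<beta>)"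
      by (subst integral_mult_right_zero[symmetric]) (simp add: mult_ac)
    finally show "(LINT w|lborel. density_fun (\<alpha>, w) * d \<alpha> (fst w)) = (LINT \<beta>|lborel. v1 \<beta> * v2 \<alpha> * d \<alpha> \<beta>)" .
  qed
  also have "\<dots> = (LINT g|lborel. v1 (fst g) * v2 (snd g) * d (snd g) (fst g))"
    by (subst integral_lborel_prod(2)[OF integrable_mult_bounded[OF integrable_lborel_prod_mult[OF v1 v2] _ d_le]]) simp_all
  also have "\<dots> = (LINT g|lborel. exp (- snd g) *\<^sub>R (deriv_fst aff aff_Y u (g, inv\<^bsub>aff\<^esub> g) * (v1 (fst g) * v2 (snd g))))"
  proof (rule Bochner_Integration.integral_cong[OF refl])
    fix g :: "real \<times> real"
    have "deriv_fst aff aff_Y u (g, inv\<^bsub>aff\<^esub> g) = of_real (exp (snd g)) * d (snd g) (fst g)"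
      using deriv_fst_aff[of "fst g" "snd g"] by (simp add: d_def)
    then show "v1 (fst g) * v2 (snd g) * d (snd g) (fst g) =
        exp (- snd g) *\<^sub>R (deriv_fst aff aff_Y u (g, inv\<^bsub>aff\<^esub> g) * (v1 (fst g) * v2 (snd g)))"
      by (simp add: scaleR_conv_of_real exp_minus field_simps)
  qed
  also have "\<dots> = (LINT g|aff_haar. deriv_fst aff aff_Y u (g, inv\<^bsub>aff\<^esub> g) * (v1 (fst g) * v2 (snd g)))"
  proof -
    have "deriv_fst aff aff_Y u (g, inv\<^bsub>aff\<^esub> g) = of_real (exp (snd g)) * d (snd g) (fst g)" for g
      using deriv_fst_aff[of "fst g" "snd g"] by (simp add: d_def)
    then have [measurable]: "(\<lambda>g. deriv_fst aff aff_Y u (g, inv\<^bsub>aff\<^esub> g)) \<in> borel_measurable borel"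
      by simp
    show ?thesis
      unfolding aff_haar_eq by (rule integral_density[symmetric]) auto
  qed
  finally show ?thesis .
qed

end


section \<open>The constants of the Schur test\<close>

text \<open>The factor |q| exp (-\<alpha>) is the Jacobian of x = t + q exp (-\<alpha>), which makes
  the bound independent of \<open>q\<close>, \<open>t\<close> and \<open>M\<close>.\<close>

lemma nn_integral_exp_substitution_le:
  fixes f :: "real \<Rightarrow> real"
  assumes [measurable]: "f \<in> borel_measurable borel" and f: "\<And>x. 0 \<le> f x" and M: "0 \<le> M"
  shows "(\<integral>\<^sup>+\<alpha>. ennreal (\<bar>q\<bar> * exp (- \<alpha>) * f (t + q * exp (- \<alpha>))) * indicator {- M..M} \<alpha> \<partial>lborel) \<le>
    (\<integral>\<^sup>+x. ennreal (f x) \<partial>lborel)"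
proof -
  \<comment> \<open>The substitution rule needs a nondecreasing function: - |q| exp (-\<alpha>) is
    one for either sign of \<open>q\<close>, and \<open>s\<close> restores the sign.\<close>
  define s where "s = (if 0 \<le> q then - 1 else 1 :: real)"
  have s: "s \<noteq> 0" "\<bar>s\<bar> = 1" "s * (- \<bar>q\<bar>) = q"
    by (auto simp: s_def)
  let ?g = "\<lambda>\<alpha>. - \<bar>q\<bar> * exp (- \<alpha>)" and ?g' = "\<lambda>\<alpha>. \<bar>q\<bar> * exp (- \<alpha>)" and ?f = "\<lambda>x. f (t + s * x)"
  have "(\<integral>\<^sup>+\<alpha>. ennreal (\<bar>q\<bar> * exp (- \<alpha>) * f (t + q * exp (- \<alpha>))) * indicator {- M..M} \<alpha> \<partial>lborel) =
      (\<integral>\<^sup>+\<alpha>. ennreal (?f (?g \<alpha>) * ?g' \<alpha> * indicator {- M..M} \<alpha>) \<partial>lborel)"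
  proof (rule nn_integral_cong)
    fix \<alpha> :: real
    have "q * exp (- \<alpha>) = s * ?g \<alpha>"
      using s(3) by (metis mult.assoc)
    then show "ennreal (\<bar>q\<bar> * exp (- \<alpha>) * f (t + q * exp (- \<alpha>))) * indicator {- M..M} \<alpha> =
        ennreal (?f (?g \<alpha>) * ?g' \<alpha> * indicator {- M..M} \<alpha>)"
      by (simp add: indicator_def mult_ac)
  qed
  also have "\<dots> = (\<integral>\<^sup>+x. ennreal (?f x * indicator {?g (- M)..?g M} x) \<partial>lborel)"
  proof (rule nn_integral_substitution[symmetric])
    show "set_borel_measurable borel {?g (- M)..?g M} ?f"
      unfolding set_borel_measurable_def by measurable
    show "(?g has_real_derivative ?g' \<alpha>) (at \<alpha>)" for \<alpha>
      by (auto intro!: derivative_eq_intros)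
    show "continuous_on {- M..M} ?g'"
      by (intro continuous_intros)
  qed (use M in auto)
  also have "\<dots> \<le> (\<integral>\<^sup>+x. ennreal (?f x) \<partial>lborel)"
    by (intro nn_integral_mono ennreal_leI) (simp add: indicator_def f)
  also have "\<dots> = (\<integral>\<^sup>+x. ennreal (f x) \<partial>lborel)"
    by (subst (2) nn_integral_real_affine[OF _ s(1), of _ t]) (simp_all add: s(2))
  finally show ?thesis .
qed

lemma compactly_supported_real_bound:
  fixes f :: "real \<Rightarrow> complex"
  assumes "compactly_supported f"
  obtains R where "0 \<le> R" "\<And>x. \<bar>x\<bar> > R \<Longrightarrow> f x = 0"
proof -
  obtain R where R: "\<And>x. x \<in> closure {x. f x \<noteq> 0} \<Longrightarrow> \<bar>x\<bar> \<le> R"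
    using compact_imp_bounded[OF assms[unfolded compactly_supported_def]] by (auto simp: bounded_iff)
  have "f x = 0" if "\<bar>x\<bar> > max R 0" for x
    using R[of x] closure_subset[of "{x. f x \<noteq> 0}"] that by force
  then show ?thesis
    by (intro that[of "max R 0"]) auto
qed

text \<open>In \<open>schur1\<close> the unbounded factor is the Jacobian of the substitution
  itself. In \<open>schur2\<close> it is first replaced, at the cost of a bounded error on the
  support of \<open>v2\<close>, by the quantity for which the same holds.\<close>

lemma schur_kernel_of_compact_support:
  assumes v1: "integrable lborel v1" and f: "compactly_supported (fourier_transform v1)" and v2: "v2 \<in> Cc"
  shows "\<exists>C. schur_kernel v1 v2 C"
proof -
  let ?f = "fourier_transform v1"
  have [measurable]: "v1 \<in> borel_measurable borel"
    using v1 by (auto dest: borel_measurable_integrable)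
  have [measurable]: "?f \<in> borel_measurable borel"
    unfolding fourier_transform_def[abs_def] by measurable
  have v2c: "continuous_on UNIV v2" and v2s: "compactly_supported v2"
    using v2 by (auto simp: Cc_def)
  have [measurable]: "v2 \<in> borel_measurable borel"
    using v2c by (rule borel_measurable_continuous_onI)
  define F where "F = (LINT x|lborel. cmod (v1 x))"
  have F: "cmod (?f s) \<le> F" for s
    unfolding fourier_transform_def F_def by (rule order_trans[OF integral_norm_bound]) (simp add: norm_mult)
  have F0: "0 \<le> F"
    by (simp add: F_def)
  obtain R where R: "0 \<le> R" "\<And>s. \<bar>s\<bar> > R \<Longrightarrow> ?f s = 0"
    by (rule compactly_supported_real_bound[OF f]) blast
  obtain M where M: "0 \<le> M" "\<And>\<alpha>. \<bar>\<alpha>\<bar> > M \<Longrightarrow> v2 \<alpha> = 0"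
    by (rule compactly_supported_real_bound[OF v2s]) blast
  obtain V where V: "0 \<le> V" "\<And>\<alpha>. cmod (v2 \<alpha>) \<le> V"
    using bounded_if_compact_support[OF v2c v2s[unfolded compactly_supported_def]]
      closure_subset[of "{x. v2 x \<noteq> 0}"] by blast
  have int_bound: "(\<integral>\<^sup>+x. ennreal B * indicator {- r..r} x \<partial>lborel) = ennreal (B * (2 * r))"
    if "0 \<le> B" "0 \<le> r" for B r :: real
    using that by (simp add: nn_integral_cmult_indicator ennreal_mult)
  have "(\<integral>\<^sup>+x. ennreal (cmod (?f x)) \<partial>lborel) \<le> (\<integral>\<^sup>+x. ennreal F * indicator {- R..R} x \<partial>lborel)"
  proof (rule nn_integral_mono)
    show "ennreal (cmod (?f x)) \<le> ennreal F * indicator {- R..R} x" for x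
      using F[of x] R(2)[of x] by (cases "\<bar>x\<bar> \<le> R") (auto simp: indicator_def abs_le_iff intro: ennreal_leI)
  qed
  then have f_int: "(\<integral>\<^sup>+x. ennreal (cmod (?f x)) \<partial>lborel) \<le> ennreal (F * (2 * R))"
    unfolding int_bound[OF F0 R(1)] .
  have v2_le: "cmod (v2 \<alpha>) \<le> V * indicator {- M..M} \<alpha>" for \<alpha>
    using V(2)[of \<alpha>] M(2)[of \<alpha>] by (cases "\<bar>\<alpha>\<bar> \<le> M") (auto simp: indicator_def abs_le_iff)
  have sub: "(\<integral>\<^sup>+\<alpha>. ennreal (cmod (v2 \<alpha>) * (\<bar>q\<bar> * exp (- \<alpha>) * h (t + q * exp (- \<alpha>)))) \<partial>lborel) \<le> ennreal (V * (F * (2 * R)))"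
    if [measurable]: "h \<in> borel_measurable borel" and h: "\<And>x. 0 \<le> h x" and hf: "(\<integral>\<^sup>+x. ennreal (h x) \<partial>lborel) \<le> ennreal (F * (2 * R))"
    for h :: "real \<Rightarrow> real" and q t :: real
  proof -
    have "(\<integral>\<^sup>+\<alpha>. ennreal (cmod (v2 \<alpha>) * (\<bar>q\<bar> * exp (- \<alpha>) * h (t + q * exp (- \<alpha>)))) \<partial>lborel) \<le>
        (\<integral>\<^sup>+\<alpha>. ennreal V * (ennreal (\<bar>q\<bar> * exp (- \<alpha>) * h (t + q * exp (- \<alpha>))) * indicator {- M..M} \<alpha>) \<partial>lborel)"
    proof (rule nn_integral_mono)
      fix \<alpha> :: real
      let ?k = "\<bar>q\<bar> * exp (- \<alpha>) * h (t + q * exp (- \<alpha>))"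
      have "cmod (v2 \<alpha>) * ?k \<le> V * indicator {- M..M} \<alpha> * ?k"
        by (intro mult_right_mono v2_le) (simp add: h)
      then have "ennreal (cmod (v2 \<alpha>) * ?k) \<le> ennreal (V * indicator {- M..M} \<alpha> * ?k)"
        by (rule ennreal_leI)
      also have "\<dots> = ennreal V * (ennreal ?k * indicator {- M..M} \<alpha>)"
        using V(1) h by (simp add: indicator_def ennreal_mult)
      finally show "ennreal (cmod (v2 \<alpha>) * ?k) \<le> ennreal V * (ennreal ?k * indicator {- M..M} \<alpha>)" .
    qed
    also have "\<dots> = ennreal V * (\<integral>\<^sup>+\<alpha>. ennreal (\<bar>q\<bar> * exp (- \<alpha>) * h (t + q * exp (- \<alpha>))) * indicator {- M..M} \<alpha> \<partial>lborel)"
      by (rule nn_integral_cmult) measurable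
    also have "\<dots> \<le> ennreal V * ennreal (F * (2 * R))"
      by (intro mult_left_mono order_trans[OF nn_integral_exp_substitution_le hf] h M(1)) (simp_all)
    finally show ?thesis
      using V(1) F0 R(1) by (simp add: ennreal_mult)
  qed
  \<comment> \<open>The first summand is \<open>V\<close> times the bound F * (2 * R) for the
    integral of the transform. The second is the error R * F of replacing the factor in
    \<open>schur2\<close>, integrated over the support of \<open>v2\<close>, which has length at
    most 2 * M.\<close>
  define C where "C = V * (F * (2 * R)) + V * (R * F) * (2 * M)"
  have C: "0 \<le> C"
    using V(1) F0 R(1) M(1) by (simp add: C_def)
  have "schur_kernel v1 v2 C"
  proof
    show "integrable lborel v1" "0 \<le> C" by fact+
    show "integrable lborel v2"
    proof (rule integrable_bounded_support, rule bounded_supportI)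
      show "v2 \<in> borel_measurable borel" by measurable
      show "cmod (v2 x) \<le> V" for x by (rule V(2))
      show "v2 x = 0" if "norm x > M" for x using that M(2) by simp
    qed
    fix q1 q2 :: real
    have "(\<integral>\<^sup>+x. ennreal (cmod (?f (x - q2))) \<partial>lborel) = (\<integral>\<^sup>+x. ennreal (cmod (?f x)) \<partial>lborel)"
      by (subst nn_integral_real_affine[of _ 1 q2]) simp_all
    then have "(\<integral>\<^sup>+\<alpha>. ennreal (cmod (v2 \<alpha>) * (\<bar>q1\<bar> * exp (- \<alpha>) * cmod (?f ((0 + q1 * exp (- \<alpha>)) - q2)))) \<partial>lborel) \<le> ennreal (V * (F * (2 * R)))"
      using f_int by (intro sub[where h = "\<lambda>x. cmod (?f (x - q2))" and q = q1 and t = 0]) simp_all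
    also have "\<dots> \<le> ennreal C"
      unfolding C_def using V(1) F0 R(1) M(1) by (intro ennreal_leI) simp
    finally show "(\<integral>\<^sup>+\<alpha>. ennreal (cmod (v2 \<alpha>) * (\<bar>exp (- \<alpha>) * q1\<bar> * cmod (?f (exp (- \<alpha>) * q1 - q2)))) \<partial>lborel) \<le> ennreal C"
      by (simp add: abs_mult mult.commute mult.left_commute)
  next
    fix p1 p2 :: real
    \<comment> \<open>On the support of the Fourier transform the unbounded factor \<open>p1\<close> can be traded for \<open>y\<close>.\<close>
    have le: "\<bar>p1\<bar> * cmod (?f (p1 - y)) \<le> \<bar>y\<bar> * cmod (?f (p1 - y)) + R * F" for y
    proof (cases "\<bar>p1 - y\<bar> \<le> R")
      case True
      then have "\<bar>p1\<bar> * cmod (?f (p1 - y)) \<le> (\<bar>y\<bar> + R) * cmod (?f (p1 - y))"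
        by (intro mult_right_mono) auto
      moreover have "R * cmod (?f (p1 - y)) \<le> R * F"
        by (intro mult_left_mono F R)
      ultimately show ?thesis
        by (simp add: distrib_right)
    qed (use R F0 in auto)
    have "(\<integral>\<^sup>+\<alpha>. ennreal (cmod (v2 \<alpha>) * (\<bar>p1\<bar> * cmod (?f (p1 - exp (- \<alpha>) * p2)))) \<partial>lborel) \<le>
        (\<integral>\<^sup>+\<alpha>. ennreal (cmod (v2 \<alpha>) * (\<bar>- p2\<bar> * exp (- \<alpha>) * cmod (?f (p1 + - p2 * exp (- \<alpha>))))) +
          ennreal (V * (R * F)) * indicator {- M..M} \<alpha> \<partial>lborel)"
    proof (rule nn_integral_mono)
      fix \<alpha> :: real
      have y: "\<bar>exp (- \<alpha>) * p2\<bar> = \<bar>- p2\<bar> * exp (- \<alpha>)" "p1 - exp (- \<alpha>) * p2 = p1 + - p2 * exp (- \<alpha>)"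
        by (simp_all add: abs_mult)
      let ?k = "\<bar>- p2\<bar> * exp (- \<alpha>) * cmod (?f (p1 + - p2 * exp (- \<alpha>)))"
      have "cmod (v2 \<alpha>) * (\<bar>p1\<bar> * cmod (?f (p1 - exp (- \<alpha>) * p2))) \<le> cmod (v2 \<alpha>) * (?k + R * F)"
        using le[of "exp (- \<alpha>) * p2"] unfolding y by (intro mult_left_mono) auto
      also have "\<dots> \<le> cmod (v2 \<alpha>) * ?k + V * (R * F) * indicator {- M..M} \<alpha>"
        using mult_right_mono[OF v2_le[of \<alpha>], of "R * F"] R(1) F0 by (simp add: distrib_left mult_ac)
      finally have "ennreal (cmod (v2 \<alpha>) * (\<bar>p1\<bar> * cmod (?f (p1 - exp (- \<alpha>) * p2)))) \<le>
          ennreal (cmod (v2 \<alpha>) * ?k + V * (R * F) * indicator {- M..M} \<alpha>)"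
        by (rule ennreal_leI)
      also have "\<dots> = ennreal (cmod (v2 \<alpha>) * ?k) + ennreal (V * (R * F)) * indicator {- M..M} \<alpha>"
        using V(1) R(1) F0 by (simp add: ennreal_plus indicator_def)
      finally show "ennreal (cmod (v2 \<alpha>) * (\<bar>p1\<bar> * cmod (?f (p1 - exp (- \<alpha>) * p2)))) \<le>
          ennreal (cmod (v2 \<alpha>) * ?k) + ennreal (V * (R * F)) * indicator {- M..M} \<alpha>" .
    qed
    also have "\<dots> = (\<integral>\<^sup>+\<alpha>. ennreal (cmod (v2 \<alpha>) * (\<bar>- p2\<bar> * exp (- \<alpha>) * cmod (?f (p1 + - p2 * exp (- \<alpha>))))) \<partial>lborel) +
        (\<integral>\<^sup>+\<alpha>. ennreal (V * (R * F)) * indicator {- M..M} \<alpha> \<partial>lborel)"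
      by (rule nn_integral_add) measurable
    also have "\<dots> \<le> ennreal (V * (F * (2 * R))) + ennreal (V * (R * F) * (2 * M))"
    proof (rule add_mono)
      show "(\<integral>\<^sup>+\<alpha>. ennreal (cmod (v2 \<alpha>) * (\<bar>- p2\<bar> * exp (- \<alpha>) * cmod (?f (p1 + - p2 * exp (- \<alpha>))))) \<partial>lborel) \<le> ennreal (V * (F * (2 * R)))"
        using f_int by (intro sub[where h = "\<lambda>x. cmod (?f x)"]) simp_all
      show "(\<integral>\<^sup>+\<alpha>. ennreal (V * (R * F)) * indicator {- M..M} \<alpha> \<partial>lborel) \<le> ennreal (V * (R * F) * (2 * M))"
        using V(1) R(1) F0 M(1) by (subst int_bound) simp_all
    qed
    also have "\<dots> = ennreal C"
      unfolding C_def using V(1) R(1) F0 M(1) by (intro ennreal_plus[symmetric]) simp_all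
    finally show "(\<integral>\<^sup>+\<alpha>. ennreal (cmod (v2 \<alpha>) * (\<bar>p1\<bar> * cmod (?f (p1 - exp (- \<alpha>) * p2)))) \<partial>lborel) \<le> ennreal C" .
  qed
  then show ?thesis ..
qed

theorem theorem2p9:
  fixes v1 v2 :: "real \<Rightarrow> complex" and v :: "real \<times> real \<Rightarrow> complex"
  assumes "integrable lborel v1"
    and "fourier_transform v1 \<in> fourier_algebra_c real_group lborel"
    and "v2 \<in> Cc"
    and "\<And>b a. v (b, a) = v1 b * v2 a"
  shows "\<exists>S \<in> VN aff2 aff2_haar. \<forall>u \<in> test_functions.
    VN_apply aff2 aff2_haar S u =
      (LINT g|aff_haar. deriv_fst aff aff_Y u (g, inv\<^bsub>aff\<^esub> g) * v g)"
proof -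
  have "compactly_supported (fourier_transform v1)"
    using assms(2) by (simp add: fourier_algebra_c_def)
  then obtain C where C: "schur_kernel v1 v2 C"
    using schur_kernel_of_compact_support assms(1,3) by blast
  have v: "v = (\<lambda>g. v1 (fst g) * v2 (snd g))"
    using assms(4) by auto
  obtain S where S: "S \<in> VN aff2 aff2_haar"
    and apply_S: "\<And>u. u \<in> fourier_algebra aff2 aff2_haar \<Longrightarrow> VN_apply aff2 aff2_haar S u =
      lim (\<lambda>n. schur_kernel.approx_functional v1 v2 (1 / real (Suc n)) u)"
    using schur_kernel.exists_VN_operator[OF C] by blast
  show ?thesis
  proof (intro bexI[OF _ S] ballI)
    fix u :: "real4 \<Rightarrow> complex" assume u: "u \<in> test_functions"
    then have "u \<in> fourier_algebra aff2 aff2_haar"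
      using test_functions_subset_fourier_algebra by blast
    then show "VN_apply aff2 aff2_haar S u = (LINT g|aff_haar. deriv_fst aff aff_Y u (g, inv\<^bsub>aff\<^esub> g) * v g)"
      unfolding v approx_functional_test_function[OF u C, symmetric] by (rule apply_S)
  qed
qed

end
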